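(* Let $(A_n)_{n\in\mathbb{N}}$ be a sequence of complex square matrices with spectra in the open unit disc $\mathbb{D}$, and let $H_n=\mathrm{H}^2\ominus B_{A_n}\mathrm{H}^2$ be the model space of $A_n$. Then $(A_n)_{n\in\mathbb{N}}$ is interpolating for $\mathrm{H}^\infty$ if and only if the sequence $(H_n)_{n\in\mathbb{N}}$ is strongly separated, i.e. if and only if \[ \inf_{n\in\mathbb{N}}\ \sin\Big(H_n,\ \overline{\mathrm{span}}_{j\neq n}\{H_j\}\Big)>0 . \]
   Context: $\mathrm{H}^\infty$ is the space of bounded analytic functions on the unit disc $\mathbb{D}$ and $\mathrm{H}^2$ is the Hardy space of $\mathbb{D}$. For $f$ holomorphic on $\mathbb{D}$ and a square matrix $M$ with spectrum in $\mathbb{D}$, $f(M)$ is defined by the Riesz–Dunford holomorphic functional calculus; equivalently by the power series of $f$ at $0$. Interpolating: a sequence $(A_n)_{n\in\mathbb{N}}$ of complex square matrices (of perhaps different dimensions) with spectra in $\mathbb{D}$ is interpolating for $\mathrm{H}^\infty$ if for every bounded sequence $(\phi_n)_{n\in\mathbb{N}}$ in $\mathrm{H}^\infty$ there exists $\varphi\in\mathrm{H}^\infty$ with $\varphi(A_n)=\phi_n(A_n)$ for all $n\in\mathbb{N}$. For $\tau\in\mathbb{D}$, $b_\tau(z)=\frac{\tau-z}{1-\overline{\tau}z}$. The order of an eigenvalue $\lambda$ of a square matrix $M$ is the maximal size of the Jordan blocks of $M$ associated with $\lambda$. If $M$ has distinct eigenvalues $\lambda_1,\dots,\lambda_k\in\mathbb{D}$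 with orders $m_1,\dots,m_k$, then $B_M(z)=\prod_{j=1}^k b_{\lambda_j}(z)^{m_j}$. For closed subspaces $L,K$ of a Hilbert space, $\sin(L,K):=\inf\{\mathrm{dist}(k,L)\mid k\in K,\ \|k\|=1\}$. *)

theory Defs
  imports
    "HOL-Complex_Analysis.Complex_Analysis"
    "Jordan_Normal_Form.Jordan_Normal_Form_Uniqueness"
    "Jordan_Normal_Form.Spectral_Radius"
begin

abbreviation unit_disc :: "complex set" where
  "unit_disc \<equiv> ball 0 1"

abbreviation taylor_coeff :: "(complex \<Rightarrow> complex) \<Rightarrow> nat \<Rightarrow> complex" where
  "taylor_coeff f k \<equiv> fps_nth (fps_expansion f 0) k"

text \<open>
  The Hardy space is the space of holomorphic functions on the disc with square-summable Taylor
  coefficients at 0. As HOL functions are total, its elements are represented by their extension by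
  0 to the whole plane, which makes the representation unique.
\<close>

lemma taylor_coeff_add:
  assumes "f holomorphic_on unit_disc" "g holomorphic_on unit_disc"
  shows "taylor_coeff (\<lambda>z. f z + g z) k = taylor_coeff f k + taylor_coeff g k"
  using higher_deriv_add[OF assms open_ball, of 0 k]
  by (simp add: fps_expansion_def add_divide_distrib)

lemma taylor_coeff_cmult:
  assumes "f holomorphic_on unit_disc"
  shows "taylor_coeff (\<lambda>z. c * f z) k = c * taylor_coeff f k"
  using higher_deriv_cmult[OF assms, of 0 k c]
  by (simp add: fps_expansion_def)

lemma summable_cmod_square_add:
  fixes a b :: "nat \<Rightarrow> complex"
  assumes "summable (\<lambda>k. (cmod (a k))\<^sup>2)" "summable (\<lambda>k. (cmod (b k))\<^sup>2)"
  shows "summable (\<lambda>k. (cmod (a k + b k))\<^sup>2)"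
proof (rule summable_comparison_test')
  show "summable (\<lambda>k. 2 * (cmod (a k))\<^sup>2 + 2 * (cmod (b k))\<^sup>2)"
    by (intro summable_add summable_mult assms)
  fix k :: nat
  have "(cmod (a k + b k))\<^sup>2 \<le> (cmod (a k) + cmod (b k))\<^sup>2"
    by (intro power_mono norm_triangle_ineq) auto
  also have "\<dots> \<le> 2 * (cmod (a k))\<^sup>2 + 2 * (cmod (b k))\<^sup>2"
    using zero_le_power2[of "cmod (a k) - cmod (b k)"]
    by (simp add: power2_eq_square algebra_simps)
  finally show "norm ((cmod (a k + b k))\<^sup>2) \<le> 2 * (cmod (a k))\<^sup>2 + 2 * (cmod (b k))\<^sup>2"
    by simp
qed

lemma summable_mult_cnj:
  fixes a b :: "nat \<Rightarrow> complex"
  assumes "summable (\<lambda>k. (cmod (a k))\<^sup>2)" "summable (\<lambda>k. (cmod (b k))\<^sup>2)"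
  shows "summable (\<lambda>k. a k * cnj (b k))"
proof (rule summable_comparison_test')
  show "summable (\<lambda>k. (cmod (a k))\<^sup>2 + (cmod (b k))\<^sup>2)"
    by (intro summable_add assms)
  fix k :: nat
  have "2 * (cmod (a k) * cmod (b k)) \<le> (cmod (a k))\<^sup>2 + (cmod (b k))\<^sup>2"
    using sum_squares_bound[of "cmod (a k)" "cmod (b k)"] by simp
  moreover have "0 \<le> cmod (a k) * cmod (b k)"
    by simp
  moreover have "norm (a k * cnj (b k)) = cmod (a k) * cmod (b k)"
    by (simp add: norm_mult)
  ultimately show "norm (a k * cnj (b k)) \<le> (cmod (a k))\<^sup>2 + (cmod (b k))\<^sup>2"
    by linarith
qed

typedef hardy2 =
  "{f :: complex \<Rightarrow> complex.
      f holomorphic_on unit_disc \<and> (\<forall>z. z \<notin> unit_disc \<longrightarrow> f z = 0) \<and>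
      summable (\<lambda>k. (cmod (taylor_coeff f k))\<^sup>2)}"
  morphisms h2_fun Abs_hardy2
proof -
  have "summable (\<lambda>k. (cmod (taylor_coeff (\<lambda>z. 0) k))\<^sup>2)"
    using taylor_coeff_cmult[of "\<lambda>z. 0" 0] by simp
  then show ?thesis
    by (intro exI[of _ "\<lambda>z. 0"]) auto
qed

setup_lifting type_definition_hardy2

lemma h2_fun_holomorphic: "h2_fun f holomorphic_on unit_disc"
  and h2_fun_outside: "z \<notin> unit_disc \<Longrightarrow> h2_fun f z = 0"
  and h2_fun_summable: "summable (\<lambda>k. (cmod (taylor_coeff (h2_fun f) k))\<^sup>2)"
  using h2_fun[of f] by auto

lift_definition h2_scale :: "complex \<Rightarrow> hardy2 \<Rightarrow> hardy2" is "\<lambda>c f z. c * f z"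
  by (auto intro!: holomorphic_intros
      simp: taylor_coeff_cmult norm_mult power_mult_distrib summable_mult simp del: mem_ball)

instantiation hardy2 :: real_vector
begin

lift_definition zero_hardy2 :: hardy2 is "\<lambda>z. 0"
  using taylor_coeff_cmult[of "\<lambda>z. 0" 0] by auto

lift_definition plus_hardy2 :: "hardy2 \<Rightarrow> hardy2 \<Rightarrow> hardy2" is "\<lambda>f g z. f z + g z"
  by (auto intro!: holomorphic_intros summable_cmod_square_add
      simp: taylor_coeff_add simp del: mem_ball)

definition "scaleR r f = h2_scale (complex_of_real r) f"

definition "- f = h2_scale (- 1) f"

definition "f - g = f + - g" for f g :: hardy2

instance
  by standard
    (unfold scaleR_hardy2_def uminus_hardy2_def minus_hardy2_def,
     (transfer; auto simp: algebra_simps)+)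

end

global_interpretation h2: Vector_Spaces.vector_space h2_scale
  defines h2_span = h2.span
  by unfold_locales (transfer; auto simp: algebra_simps)+

definition h2_inner :: "hardy2 \<Rightarrow> hardy2 \<Rightarrow> complex" where
  "h2_inner f g = (\<Sum>k. taylor_coeff (h2_fun f) k * cnj (taylor_coeff (h2_fun g) k))"

lemma h2_inner_summable:
  "summable (\<lambda>k. taylor_coeff (h2_fun f) k * cnj (taylor_coeff (h2_fun g) k))"
  by (intro summable_mult_cnj h2_fun_summable)

lemma h2_inner_commute: "h2_inner f g = cnj (h2_inner g f)"
  unfolding h2_inner_def
  using sums_cnj[THEN iffD2, OF summable_sums[OF h2_inner_summable[of g f]]]
  by (simp add: sums_iff mult.commute)

lemma h2_inner_add_left: "h2_inner (f + g) h = h2_inner f h + h2_inner g h"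
  unfolding h2_inner_def plus_hardy2.rep_eq
  by (simp add: taylor_coeff_add[OF h2_fun_holomorphic h2_fun_holomorphic] distrib_right
      suminf_add[OF h2_inner_summable h2_inner_summable])

lemma h2_inner_scale_left: "h2_inner (h2_scale c f) h = c * h2_inner f h"
  unfolding h2_inner_def h2_scale.rep_eq
  by (simp add: taylor_coeff_cmult[OF h2_fun_holomorphic] mult.assoc
      suminf_mult[OF h2_inner_summable])

lemma h2_inner_self:
  "h2_inner f f = complex_of_real (\<Sum>k. (cmod (taylor_coeff (h2_fun f) k))\<^sup>2)"
  unfolding h2_inner_def
  by (simp add: complex_mult_cnj cmod_power2 suminf_of_real[OF h2_fun_summable, unfolded cmod_power2])

lemma h2_eq_zero_if_coeffs:
  assumes "\<And>k. taylor_coeff (h2_fun f) k = 0"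
  shows "f = 0"
proof -
  have "h2_fun f z = 0" for z
  proof (cases "z \<in> unit_disc")
    case True
    show ?thesis
      by (rule holomorphic_fun_eq_0_on_ball[OF h2_fun_holomorphic True])
        (use assms in \<open>simp add: fps_expansion_def\<close>)
  qed (rule h2_fun_outside)
  then show ?thesis
    by (simp add: h2_fun_inject[symmetric] zero_hardy2.rep_eq fun_eq_iff)
qed

text \<open>The underlying real inner product is the real part of the complex one; it has the same norm.\<close>

instantiation hardy2 :: real_inner
begin

definition "inner f g = Re (h2_inner f g)"

definition "norm (f :: hardy2) = sqrt (Re (h2_inner f f))"

definition "sgn f = inverse (norm f) *\<^sub>R f" for f :: hardy2

definition "dist f g = norm (f - g)" for f g :: hardy2

definition uniformity_hardy2 :: "(hardy2 \<times> hardy2) filter" where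
  "uniformity_hardy2 = (INF e\<in>{0<..}. principal {(x, y). dist x y < e})"

definition open_hardy2 :: "hardy2 set \<Rightarrow> bool" where
  "open_hardy2 U \<longleftrightarrow> (\<forall>x\<in>U. eventually (\<lambda>(x', y). x' = x \<longrightarrow> y \<in> U) uniformity)"

instance
proof
  fix f g h :: hardy2 and r :: real
  show "inner f g = inner g f"
    using h2_inner_commute[of f g] by (simp add: inner_hardy2_def)
  show "inner (f + g) h = inner f h + inner g h"
    by (simp add: inner_hardy2_def h2_inner_add_left)
  show "inner (r *\<^sub>R f) g = r * inner f g"
    by (simp add: inner_hardy2_def scaleR_hardy2_def h2_inner_scale_left)
  show "0 \<le> inner f f"
    by (simp add: inner_hardy2_def h2_inner_self suminf_nonneg[OF h2_fun_summable])
  show "inner f f = 0 \<longleftrightarrow> f = 0"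
  proof
    assume "inner f f = 0"
    then have "\<forall>k. (cmod (taylor_coeff (h2_fun f) k))\<^sup>2 = 0"
      using suminf_eq_zero_iff[OF h2_fun_summable[of f]]
      by (simp add: inner_hardy2_def h2_inner_self)
    then show "f = 0"
      by (intro h2_eq_zero_if_coeffs) simp
  next
    assume "f = 0"
    then have "f = h2_scale 0 f"
      by simp
    then show "inner f f = 0"
      by (metis inner_hardy2_def h2_inner_scale_left mult_zero_left zero_complex.sel(1))
  qed
qed (simp_all add: inner_hardy2_def norm_hardy2_def sgn_hardy2_def dist_hardy2_def
      uniformity_hardy2_def open_hardy2_def)

end

definition Hinf :: "(complex \<Rightarrow> complex) set" where
  "Hinf = {f. f holomorphic_on unit_disc \<and> bounded (f ` unit_disc)}"

definition bounded_Hinf_seq :: "(nat \<Rightarrow> complex \<Rightarrow> complex) \<Rightarrow> bool" where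
  "bounded_Hinf_seq \<phi> \<longleftrightarrow>
     (\<forall>n. \<phi> n \<in> Hinf) \<and> (\<exists>C. \<forall>n. \<forall>z\<in>unit_disc. cmod (\<phi> n z) \<le> C)"

text \<open>The power series of \<open>f\<close> at 0 is summed entrywise; it converges when the spectrum of \<open>M\<close>
  lies in the open unit disc, on which \<open>f\<close> is holomorphic.\<close>

definition mat_fun :: "(complex \<Rightarrow> complex) \<Rightarrow> complex mat \<Rightarrow> complex mat" where
  "mat_fun f M =
     mat (dim_row M) (dim_col M) (\<lambda>(i, j). \<Sum>k. taylor_coeff f k * (M ^\<^sub>m k) $$ (i, j))"

definition interpolating :: "(nat \<Rightarrow> complex mat) \<Rightarrow> bool" where
  "interpolating A \<longleftrightarrow>
     (\<forall>\<phi>. bounded_Hinf_seq \<phi> \<longrightarrow> (\<exists>\<psi>\<in>Hinf. \<forall>n. mat_fun \<psi> (A n) = mat_fun (\<phi> n) (A n)))"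

definition blaschke_factor :: "complex \<Rightarrow> complex \<Rightarrow> complex" where
  "blaschke_factor \<tau> z = (\<tau> - z) / (1 - cnj \<tau> * z)"

definition eigenvalue_order :: "complex mat \<Rightarrow> complex \<Rightarrow> nat" where
  "eigenvalue_order M ev = Max {k. \<exists>n_as. jordan_nf M n_as \<and> (k, ev) \<in> set n_as}"

lemma eigenvalue_order_eq:
  assumes "jordan_nf M n_as"
  shows "eigenvalue_order M ev = Max {k. (k, ev) \<in> set n_as}"
proof -
  have "set m_as = set n_as" if "jordan_nf M m_as" for m_as
    by (rule jordan_nf_unique[OF that assms])
  then have "{k. \<exists>m_as. jordan_nf M m_as \<and> (k, ev) \<in> set m_as} = {k. (k, ev) \<in> set n_as}"
    using assms by blast
  then show ?thesis
    by (simp only: eigenvalue_order_def)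
qed

definition mat_blaschke :: "complex mat \<Rightarrow> complex \<Rightarrow> complex" where
  "mat_blaschke M z = (\<Prod>ev\<in>spectrum M. blaschke_factor ev z ^ eigenvalue_order M ev)"

definition model_space :: "complex mat \<Rightarrow> hardy2 set" where
  "model_space M =
     {f. \<forall>g h. (\<forall>z\<in>unit_disc. h2_fun h z = mat_blaschke M z * h2_fun g z) \<longrightarrow> h2_inner f h = 0}"

text \<open>\<open>infdist k L\<close> is the distance from \<open>k\<close> to \<open>L\<close>. Since the infimum is a real number, this is
  meaningful only if \<open>K\<close> is nonzero.\<close>

definition subspace_sin :: "'a::real_inner set \<Rightarrow> 'a set \<Rightarrow> real" where
  "subspace_sin L K = (INF k\<in>{k \<in> K. norm k = 1}. infdist k L)"

definition strongly_separated :: "(nat \<Rightarrow> hardy2 set) \<Rightarrow> bool" where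
  "strongly_separated H \<longleftrightarrow>
     (INF n. subspace_sin (H n) (closure (h2_span (\<Union>j\<in>{j. j \<noteq> n}. H j)))) > 0"

end

theory Submission
  imports Defs
begin

text \<open>
  Every \<open>H\<^sub>n\<close> is the model space of a finite Blaschke product \<open>B\<^sub>n\<close>, and \<open>\<phi>(A\<^sub>n) = \<psi>(A\<^sub>n)\<close> holds iff
  \<open>B\<^sub>n\<close> divides \<open>\<phi> - \<psi>\<close>.

  If the sequence is interpolating, a category argument bounds the functions \<open>f\<^sub>n\<close> with \<open>f\<^sub>n \<equiv> 1\<close>
  modulo \<open>B\<^sub>n\<close> and \<open>f\<^sub>n \<equiv> 0\<close> modulo \<open>B\<^sub>j\<close> for \<open>j \<noteq> n\<close>. Pairing \<open>k - h\<close> with \<open>(1 - f\<^sub>n) k\<close>, for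
  \<open>h\<close> in \<open>H\<^sub>n\<close> and \<open>k\<close> in the span of the other spaces, bounds the angle from below.

  Conversely, separation gives \<open>|B\<^sub>n| + |\<Prod>\<^sub>j\<^sub>\<noteq>\<^sub>n B\<^sub>j| \<ge> c\<close> for all finite subfamilies of size \<open>N\<close>, and
  the maximum principle improves this to \<open>\<Prod> (1 + |B\<^sub>n|\<^sup>2) \<ge> \<kappa> 2\<^sup>N\<close>. Applying the Littlewood--Paley
  identity to \<open>f\<close> times all subproducts of the \<open>B\<^sub>n\<close> shows that \<open>\<Sum> |B\<^sub>n'|\<^sup>2\<close> is the density of a
  Carleson measure. Hence \<open>\<parallel>\<Sum> h\<^sub>n\<parallel>\<^sup>2\<close> and \<open>\<Sum> \<parallel>h\<^sub>n\<parallel>\<^sup>2\<close> are comparable for \<open>h\<^sub>n \<in> H\<^sub>n\<close>, the lower bound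
  following from the upper one by duality and the conjugation \<open>h \<mapsto> B \<cdot> cnj (z h)\<close> of a model space. So the
  operator acting as the adjoint of multiplication by \<open>\<phi>\<^sub>n\<close> on \<open>H\<^sub>n\<close> is bounded uniformly in \<open>N\<close>, and commutant
  lifting followed by a normal family argument yields the interpolating function.
\<close>

subsection \<open>Parseval's identity on circles\<close>

text \<open>Separation controls one product \<open>B n\<close> against one complementary product at
  a time, whereas an embedding for all \<open>|B n'|^2\<close> together must not lose a factor with
  each new space. Summing the energy of \<open>f\<close> over the \<open>2^N\<close> subproducts
  yields the factor \<open>2^N\<close> on the circle side, because every subproduct is unimodular
  there, and the factor \<open>\<Prod> (1 + |B n|^2)\<close> on the area side; the estimate is
  uniform in \<open>N\<close> once these two are comparable, and this dictates the form of the
  weight condition. All quantitative work is done with finitely many finite Blaschke products. These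
  and their model spaces are analytic across the circle, so boundary values are ordinary values, and
  constants independent of \<open>N\<close> survive the final limit. The constants are
  \<open>gap = \<delta> / (1 + \<delta>)\<close>, the weight \<open>\<kappa> = gap^2 / 4\<close>,
  the Carleson constant \<open>4 / \<kappa>\<close> and the Riesz constant
  \<open>64 / gap^6\<close>; data bounded by \<open>C\<close> are interpolated with bound
  \<open>riesz_const * C\<close>.\<close>

lemma taylor_coeff_sums:
  assumes "f holomorphic_on ball 0 R" "norm z < R"
  shows "(\<lambda>k. taylor_coeff f k * z ^ k) sums f z"
  using holomorphic_power_series[of f 0 R z] assms by (simp add: fps_expansion_def)

lemma taylor_coeff_eqI:
  assumes "f has_fps_expansion F"
  shows "taylor_coeff f k = fps_nth F k"
  using fps_nth_fps_expansion[OF assms] by (simp add: fps_expansion_def)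

lemma holomorphic_has_fps_expansion:
  assumes "f holomorphic_on ball 0 R" "R > 0"
  shows "f has_fps_expansion fps_expansion f 0"
  using has_fps_expansion_fps_expansion[OF _ _ assms(1)] assms(2) by auto

lemma taylor_coeff_cong:
  assumes "\<And>z. norm z < R \<Longrightarrow> f z = g z" "R > 0"
  shows "taylor_coeff f k = taylor_coeff g k"
proof -
  have "\<forall>\<^sub>F w in nhds 0. f w = g w"
    using assms by (intro eventually_nhds_in_open[of "ball 0 R", THEN eventually_mono]) auto
  then show ?thesis by (metis fps_expansion_cong)
qed

lemma taylor_uniform_limit:
  assumes "f holomorphic_on ball 0 R" "r < R" "R > 0"
  shows "uniform_limit (cball 0 r) (\<lambda>n z. \<Sum>k<n. taylor_coeff f k * z ^ k) f sequentially"
proof -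
  have "ereal R \<le> fps_conv_radius (fps_expansion f 0)"
    using conv_radius_fps_expansion[of f 0 "ereal R"] assms by simp
  then have "ereal r < conv_radius (fps_nth (fps_expansion f 0))"
    using assms unfolding fps_conv_radius_def by (meson ereal_less(2) less_ereal.simps(1) order_less_le_trans)
  from powser_uniform_limit[OF this, of 0]
  have "uniform_limit (cball 0 r) (\<lambda>n z. \<Sum>k<n. taylor_coeff f k * z ^ k)
      (\<lambda>z. \<Sum>k. taylor_coeff f k * z ^ k) sequentially"
    by simp
  then show ?thesis
    by (rule uniform_limit_cong'[THEN iffD1, rotated -1])
      (use taylor_coeff_sums[OF assms(1)] assms in \<open>auto simp: sums_iff\<close>)
qed

text \<open>Once the powers of \<open>Z\<close> are orthogonal under the weight \<open>w\<close>,
  integrating products of Taylor polynomials and passing to the uniform limit on radius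
  \<open>r < R\<close> gives a Parseval identity. A general box is used because the same argument
  serves the circle (one parameter, \<open>w = 1\<close>) and the area integral (three
  parameters).\<close>

lemma box_parseval:
  fixes Z :: "'a::euclidean_space \<Rightarrow> complex" and w :: "'a \<Rightarrow> real"
  assumes Z: "continuous_on (cbox a b) Z" and w: "continuous_on (cbox a b) w"
    and Zr: "\<And>x. x \<in> cbox a b \<Longrightarrow> norm (Z x) \<le> r" and r: "r < R" "R > 0"
    and f: "f holomorphic_on ball 0 R" and g: "g holomorphic_on ball 0 R"
    and mom: "\<And>j k. integral (cbox a b) (\<lambda>x. of_real (w x) * (Z x ^ j * cnj (Z x ^ k))) =
        (if j = k then m k else 0)"
  shows "(\<lambda>k. taylor_coeff f k * cnj (taylor_coeff g k) * m k) sums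
      integral (cbox a b) (\<lambda>x. of_real (w x) * (f (Z x) * cnj (g (Z x))))"
proof -
  define F where "F n z = (\<Sum>k<n. taylor_coeff f k * z ^ k)" for n z
  define G where "G n z = (\<Sum>k<n. taylor_coeff g k * z ^ k)" for n z
  have ZF: "uniform_limit (cbox a b) (\<lambda>n x. F n (Z x)) (\<lambda>x. f (Z x)) sequentially"
    using uniform_limit_compose'[OF taylor_uniform_limit[OF f r], of Z "cbox a b"] Zr
    by (auto simp: F_def)
  have "uniform_limit (cbox a b) (\<lambda>n x. G n (Z x)) (\<lambda>x. g (Z x)) sequentially"
    using uniform_limit_compose'[OF taylor_uniform_limit[OF g r], of Z "cbox a b"] Zr
    by (auto simp: G_def)
  then have ZG: "uniform_limit (cbox a b) (\<lambda>n x. cnj (G n (Z x))) (\<lambda>x. cnj (g (Z x))) sequentially"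
    unfolding uniform_limit_iff dist_norm by (simp flip: complex_cnj_diff)
  have sub: "Z ` cbox a b \<subseteq> ball 0 R"
    using Zr r by fastforce
  have cf: "continuous_on (cbox a b) (\<lambda>x. f (Z x))"
    using continuous_on_compose2[OF holomorphic_on_imp_continuous_on[OF f] Z sub] .
  have cg: "continuous_on (cbox a b) (\<lambda>x. cnj (g (Z x)))"
    using continuous_on_compose2[OF holomorphic_on_imp_continuous_on[OF g] Z sub]
    by (intro continuous_intros)
  have cw: "continuous_on (cbox a b) (\<lambda>x. complex_of_real (w x))"
    using w by (intro continuous_intros)
  have bd: "bounded (h ` cbox a b)" if "continuous_on (cbox a b) h" for h :: "'a \<Rightarrow> complex"
    using that compact_continuous_image compact_imp_bounded compact_cbox by blast
  have UL: "uniform_limit (cbox a b) (\<lambda>n x. of_real (w x) * (F n (Z x) * cnj (G n (Z x))))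
      (\<lambda>x. of_real (w x) * (f (Z x) * cnj (g (Z x)))) sequentially"
    by (intro uniform_lim_mult ZF ZG uniform_limit_const bd cf cg cw continuous_intros)
  have I: "integral (cbox a b) (\<lambda>x. of_real (w x) * (F n (Z x) * cnj (G n (Z x)))) =
     (\<Sum>k<n. taylor_coeff f k * cnj (taylor_coeff g k) * m k)" for n
  proof -
    have "integral (cbox a b) (\<lambda>x. of_real (w x) * (F n (Z x) * cnj (G n (Z x)))) =
      integral (cbox a b) (\<lambda>x. \<Sum>j<n. \<Sum>k<n. taylor_coeff f j * cnj (taylor_coeff g k) *
        (of_real (w x) * (Z x ^ j * cnj (Z x ^ k))))"
      unfolding F_def G_def cnj_sum sum_product
      by (intro integral_cong, simp only: sum_distrib_left, intro sum.cong refl) (simp add: mult_ac)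
    also have "\<dots> = (\<Sum>j<n. \<Sum>k<n. taylor_coeff f j * cnj (taylor_coeff g k) *
        integral (cbox a b) (\<lambda>x. (of_real (w x) * (Z x ^ j * cnj (Z x ^ k)))))"
    proof -
      have "(\<lambda>x. of_real (w x) * (Z x ^ j * cnj (Z x ^ k))) integrable_on cbox a b" for j k
        using Z w by (intro integrable_continuous continuous_intros)
      then have int: "(\<lambda>x. c * (of_real (w x) * (Z x ^ j * cnj (Z x ^ k)))) integrable_on cbox a b" for c j k
        by (rule integrable_on_mult_right)
      show ?thesis
        by (simp add: integral_sum integrable_sum int del: complex_cnj_power)
    qed
    also have "\<dots> = (\<Sum>j<n. \<Sum>k<n. if k = j then taylor_coeff f j * cnj (taylor_coeff g k) * m k else 0)"
      unfolding mom by (intro sum.cong refl) auto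
    also have "\<dots> = (\<Sum>k<n. taylor_coeff f k * cnj (taylor_coeff g k) * m k)"
      by (intro sum.cong refl) simp
    finally show ?thesis .
  qed
  have "continuous_on (cbox a b) (\<lambda>x. of_real (w x) * (F n (Z x) * cnj (G n (Z x))))" for n
    unfolding F_def G_def using Z w by (intro continuous_intros)
  from uniform_limit_integral_cbox[OF UL this] obtain I' J where
    "\<And>n. ((\<lambda>x. of_real (w x) * (F n (Z x) * cnj (G n (Z x)))) has_integral I' n) (cbox a b)"
    "((\<lambda>x. of_real (w x) * (f (Z x) * cnj (g (Z x)))) has_integral J) (cbox a b)"
    "(I' \<longlongrightarrow> J) sequentially"
    by auto
  then show ?thesis
    unfolding sums_def I[symmetric] by (metis (no_types, lifting) ext integral_unique)
qed

abbreviation ecirc :: "real \<Rightarrow> complex" where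
  "ecirc t \<equiv> cis (2 * pi * t)"

lemma integral_ecirc_power:
  "integral {0..1} (\<lambda>t. ecirc t ^ j * cnj (ecirc t ^ k)) = (if j = k then 1 else 0)"
proof (cases "j = k")
  case True
  have "ecirc t ^ j * cnj (ecirc t ^ j) = 1" for t
    by (subst complex_norm_square[symmetric]) (simp add: norm_power)
  then show ?thesis using True by simp
next
  case False
  \<comment> \<open>With this exponent the integrand is \<open>exp (c * t)\<close>, and its
    primitive takes equal values at 0 and 1 because \<open>c\<close> is an integer multiple of
    \<open>2 * pi * \<i>\<close>.\<close>
  define c :: complex where "c = 2 * pi * \<i> * (of_nat j - of_nat k)"
  have c0: "c \<noteq> 0" using False by (simp add: c_def)
  have eq: "ecirc t ^ j * cnj (ecirc t ^ k) = exp (c * of_real t)" for t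
    by (simp only: Complex.DeMoivre cis_cnj cis_mult) (simp add: cis_conv_exp c_def algebra_simps)
  have "((\<lambda>t. exp (c * of_real t)) has_integral (exp (c * of_real 1) / c - exp (c * of_real 0) / c)) {0..1}"
    using c0 by (intro fundamental_theorem_of_calculus)
      (auto intro!: derivative_eq_intros has_vector_derivative_real_field)
  moreover have "exp c = 1"
  proof -
    have "exp (of_int (2 * (int j - int k)) * (complex_of_real pi * \<i>)) = 1"
      using exp_integer_2pi[of "of_int (int j - int k)"] by (simp add: mult_ac)
    then show ?thesis by (simp add: c_def mult_ac)
  qed
  ultimately show ?thesis using False eq by (simp add: integral_unique)
qed

definition circle_mean :: "real \<Rightarrow> (complex \<Rightarrow> complex) \<Rightarrow> complex" where
  "circle_mean r F = integral {0..1} (\<lambda>t. F (of_real r * ecirc t))"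

lemma circle_parseval:
  assumes f: "f holomorphic_on ball 0 R" and g: "g holomorphic_on ball 0 R" and r: "0 \<le> r" "r < R"
  shows "(\<lambda>k. taylor_coeff f k * cnj (taylor_coeff g k) * of_real (r ^ (2 * k))) sums
     circle_mean r (\<lambda>z. f z * cnj (g z))"
proof -
  have "(\<lambda>k. taylor_coeff f k * cnj (taylor_coeff g k) * of_real (r ^ (2 * k))) sums
    integral (cbox 0 1) (\<lambda>t. of_real 1 *
      (f (of_real r * ecirc t) * cnj (g (of_real r * ecirc t))))"
  proof (rule box_parseval[where w = "\<lambda>_. 1" and r = r])
    fix j k
    have "integral {0..1} (\<lambda>t. of_real 1 * ((of_real r * ecirc t) ^ j * cnj ((of_real r * ecirc t) ^ k)))
      = integral {0..1} (\<lambda>t. of_real (r ^ (j + k)) * (ecirc t ^ j * cnj (ecirc t ^ k)))"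
      by (simp add: power_mult_distrib power_add mult_ac)
    also have "\<dots> = (if j = k then of_real (r ^ (2 * k)) else 0)"
      by (subst integral_mult_right) (simp only: integral_ecirc_power, simp add: mult_2)
    finally show "integral (cbox 0 1) (\<lambda>t. of_real 1 * ((of_real r * ecirc t) ^ j *
      cnj ((of_real r * ecirc t) ^ k))) = (if j = k then of_real (r ^ (2 * k)) else 0)"
      by simp
    show "continuous_on (cbox 0 1) (\<lambda>t. of_real r * ecirc t)"
      by (intro continuous_intros)
  qed (use assms in \<open>auto simp: norm_mult\<close>)
  then show ?thesis by (simp add: circle_mean_def)
qed

definition circle_sq :: "real \<Rightarrow> (complex \<Rightarrow> complex) \<Rightarrow> real" where
  "circle_sq r f = integral {0..1} (\<lambda>t. (cmod (f (of_real r * ecirc t)))\<^sup>2)"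

lemma circle_continuous:
  assumes "f holomorphic_on ball 0 R" "0 \<le> r" "r < R"
  shows "continuous_on {0..1} (\<lambda>t. f (of_real r * ecirc t))"
  by (rule continuous_on_compose2[OF holomorphic_on_imp_continuous_on[OF assms(1)]])
    (use assms in \<open>auto intro!: continuous_intros simp: norm_mult\<close>)

lemma circle_sq_sums:
  assumes f: "f holomorphic_on ball 0 R" and r: "0 \<le> r" "r < R"
  shows "(\<lambda>k. (cmod (taylor_coeff f k))\<^sup>2 * r ^ (2 * k)) sums circle_sq r f"
proof -
  have "(\<lambda>k. of_real ((cmod (taylor_coeff f k))\<^sup>2 * r ^ (2 * k))) sums
      circle_mean r (\<lambda>z. f z * cnj (f z))"
    using circle_parseval[OF f f r] by (simp only: of_real_mult complex_norm_square)
  also have "circle_mean r (\<lambda>z. f z * cnj (f z)) = integral {0..1} (\<lambda>t. complex_of_real ((cmod (f (of_real r * ecirc t)))\<^sup>2))"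
    unfolding circle_mean_def by (intro integral_cong) (simp only: complex_norm_square)
  also have "\<dots> = of_real (circle_sq r f)"
  proof -
    have "(\<lambda>t. (cmod (f (of_real r * ecirc t)))\<^sup>2) integrable_on {0..1}"
      by (intro integrable_continuous_real continuous_intros circle_continuous[OF assms])
    from integral_linear[OF this bounded_linear_of_real[where 'a = complex]] show ?thesis
      by (simp add: o_def circle_sq_def)
  qed
  finally show ?thesis
    by (simp only: sums_of_real_iff)
qed

lemma circle_sq_le:
  assumes f: "f holomorphic_on ball 0 R" and g: "g holomorphic_on ball 0 R" and r: "0 \<le> r" "r < R"
    and le: "\<And>z. norm z = r \<Longrightarrow> cmod (f z) \<le> C * cmod (g z)" and C: "C \<ge> 0"
  shows "circle_sq r f \<le> C\<^sup>2 * circle_sq r g"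
proof -
  have "circle_sq r f \<le> integral {0..1} (\<lambda>t. C\<^sup>2 * (cmod (g (of_real r * ecirc t)))\<^sup>2)"
    unfolding circle_sq_def
  proof (rule integral_le)
    show "(\<lambda>t. (cmod (f (of_real r * ecirc t)))\<^sup>2) integrable_on {0..1}"
      by (intro integrable_continuous_real continuous_intros circle_continuous[OF f r])
    show "(\<lambda>t. C\<^sup>2 * (cmod (g (of_real r * ecirc t)))\<^sup>2) integrable_on {0..1}"
      by (intro integrable_continuous_real continuous_intros circle_continuous[OF g r])
    show "(cmod (f (of_real r * ecirc t)))\<^sup>2 \<le> C\<^sup>2 * (cmod (g (of_real r * ecirc t)))\<^sup>2" for t
      using le[of "of_real r * ecirc t"] r
      by (subst power_mult_distrib[symmetric]) (intro power_mono, auto simp: norm_mult)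
  qed
  then show ?thesis by (simp add: circle_sq_def)
qed

subsection \<open>The Hardy space\<close>

abbreviation hcoeff :: "hardy2 \<Rightarrow> nat \<Rightarrow> complex" where
  "hcoeff f k \<equiv> taylor_coeff (h2_fun f) k"

lemma hcoeff_add [simp]: "hcoeff (f + g) k = hcoeff f k + hcoeff g k"
  by (simp add: plus_hardy2.rep_eq taylor_coeff_add h2_fun_holomorphic)

lemma hcoeff_scale [simp]: "hcoeff (h2_scale c f) k = c * hcoeff f k"
  by (simp add: h2_scale.rep_eq taylor_coeff_cmult h2_fun_holomorphic)

lemma hcoeff_diff [simp]: "hcoeff (f - g) k = hcoeff f k - hcoeff g k"
  unfolding minus_hardy2_def uminus_hardy2_def hcoeff_add hcoeff_scale by simp

lemma hcoeff_zero [simp]: "hcoeff 0 k = 0"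
  using hcoeff_diff[of 0 0 k] by simp

lemma hcoeff_sum [simp]: "hcoeff (\<Sum>i\<in>A. f i) k = (\<Sum>i\<in>A. hcoeff (f i) k)"
  by (induction A rule: infinite_finite_induct) simp_all

lemma hcoeff_eqI:
  assumes "\<And>k. hcoeff f k = hcoeff g k"
  shows "f = g"
proof -
  have "f - g = 0"
    using assms by (intro h2_eq_zero_if_coeffs) simp
  then show ?thesis by simp
qed

lemma h2_fun_add [simp]: "h2_fun (f + g) z = h2_fun f z + h2_fun g z"
  by (simp add: plus_hardy2.rep_eq)

lemma h2_fun_scale [simp]: "h2_fun (h2_scale c f) z = c * h2_fun f z"
  by (simp add: h2_scale.rep_eq)

lemma h2_fun_diff [simp]: "h2_fun (f - g) z = h2_fun f z - h2_fun g z"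
  unfolding minus_hardy2_def uminus_hardy2_def h2_fun_add h2_fun_scale by simp

lemma h2_fun_zero [simp]: "h2_fun 0 z = 0"
  by (simp add: zero_hardy2.rep_eq)

lemma h2_fun_sum [simp]: "h2_fun (\<Sum>i\<in>A. f i) z = (\<Sum>i\<in>A. h2_fun (f i) z)"
  by (induction A rule: infinite_finite_induct) simp_all

lemma h2_fun_eqI:
  assumes "\<And>z. norm z < 1 \<Longrightarrow> h2_fun f z = h2_fun g z"
  shows "f = g"
  by (metis assms h2_fun_inject ext h2_fun_outside mem_ball dist_0_norm)

lemma h2_fun_sums:
  assumes "norm z < 1"
  shows "(\<lambda>k. hcoeff f k * z ^ k) sums h2_fun f z"
  using taylor_coeff_sums[OF h2_fun_holomorphic] assms by auto

definition h2_of :: "(complex \<Rightarrow> complex) \<Rightarrow> hardy2" where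
  "h2_of f = Abs_hardy2 (\<lambda>z. if z \<in> unit_disc then f z else 0)"

lemma h2_of:
  assumes "f holomorphic_on unit_disc" "summable (\<lambda>k. (cmod (taylor_coeff f k))\<^sup>2)"
  shows h2_fun_h2_of: "\<And>z. norm z < 1 \<Longrightarrow> h2_fun (h2_of f) z = f z"
    and hcoeff_h2_of: "\<And>k. hcoeff (h2_of f) k = taylor_coeff f k"
proof -
  let ?g = "\<lambda>z. if z \<in> unit_disc then f z else 0"
  have tc: "taylor_coeff ?g k = taylor_coeff f k" for k
    by (rule taylor_coeff_cong[where R = 1]) auto
  have "?g holomorphic_on unit_disc"
    using assms(1) by (rule holomorphic_transform) auto
  then have *: "h2_fun (h2_of f) = ?g"
    unfolding h2_of_def by (intro Abs_hardy2_inverse) (use assms tc in auto)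
  show "h2_fun (h2_of f) z = f z" if "norm z < 1" for z
    using that by (simp add: *)
  show "hcoeff (h2_of f) k = taylor_coeff f k" for k
    unfolding * by (rule tc)
qed

text \<open>Square-summable coefficients are bounded, so their power series converges on the whole
  disc. This Riesz--Fischer direction supplies vectors known only through their coefficients, such
  as backward shifts and images under adjoints of multipliers.\<close>

lemma hardy2_of_coeffs:
  assumes "summable (\<lambda>k. (cmod (a k))\<^sup>2)"
  shows "\<exists>f. \<forall>k. hcoeff f k = a k"
proof -
  have "a \<longlonglongrightarrow> 0"
  proof -
    have "(\<lambda>k. sqrt ((cmod (a k))\<^sup>2)) \<longlonglongrightarrow> sqrt 0"
      by (intro tendsto_real_sqrt summable_LIMSEQ_zero assms)
    then show ?thesis
      by (simp add: tendsto_norm_zero_iff)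
  qed
  then obtain B where B: "\<And>k. norm (a k) \<le> B"
    by (metis Bseq_def convergentI convergent_imp_Bseq)
  have "1 \<le> conv_radius a"
  proof (rule conv_radius_geI_ex')
    fix r :: real assume r: "0 < r" "ereal r < 1"
    show "summable (\<lambda>n. a n * of_real r ^ n)"
    proof (rule summable_comparison_test')
      show "summable (\<lambda>n. B * r ^ n)"
        using r by (intro summable_mult summable_geometric) auto
      show "norm (a n * of_real r ^ n) \<le> B * r ^ n" for n
        using B[of n] r by (auto simp: norm_mult norm_power intro!: mult_right_mono)
    qed
  qed
  then have cr: "1 \<le> fps_conv_radius (Abs_fps a)"
    by (simp add: fps_conv_radius_def)
  let ?f = "eval_fps (Abs_fps a)"
  have hol: "?f holomorphic_on unit_disc"
  proof (rule holomorphic_on_eval_fps)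
    have "z \<in> eball 0 (fps_conv_radius (Abs_fps a))" if "norm z < 1" for z :: complex
      using that cr by (simp add: in_eball_iff) (meson ereal_less(3) less_ereal.simps(1) order_less_le_trans one_ereal_def)
    then show "unit_disc \<subseteq> eball 0 (fps_conv_radius (Abs_fps a))" by auto
  qed
  have "0 < fps_conv_radius (Abs_fps a)"
    using cr by (rule order_less_le_trans[rotated]) simp
  then have "taylor_coeff ?f k = a k" for k
    using taylor_coeff_eqI[OF eval_fps_has_fps_expansion] by simp
  then have "hcoeff (h2_of ?f) k = a k" for k
    using hcoeff_h2_of[OF hol] assms by simp
  then show ?thesis by blast
qed

lemma h2_norm_sq: "(norm f)\<^sup>2 = (\<Sum>k. (cmod (hcoeff f k))\<^sup>2)"
  unfolding norm_hardy2_def h2_inner_self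
  by (simp add: suminf_nonneg h2_fun_summable)

lemma h2_norm_sums: "(\<lambda>k. (cmod (hcoeff f k))\<^sup>2) sums (norm f)\<^sup>2"
  unfolding h2_norm_sq using h2_fun_summable by (rule summable_sums)

lemma h2_inner_self_norm: "h2_inner f f = of_real ((norm f)\<^sup>2)"
  unfolding h2_norm_sq h2_inner_self ..

lemma h2_inner_sums: "(\<lambda>k. hcoeff f k * cnj (hcoeff g k)) sums h2_inner f g"
  unfolding h2_inner_def using h2_inner_summable by (rule summable_sums)

lemma h2_inner_diff_left: "h2_inner (f - g) h = h2_inner f h - h2_inner g h"
  unfolding minus_hardy2_def uminus_hardy2_def h2_inner_add_left h2_inner_scale_left by simp

lemma h2_inner_add_right: "h2_inner h (f + g) = h2_inner h f + h2_inner h g"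
  by (metis complex_cnj_add h2_inner_add_left h2_inner_commute)

lemma h2_inner_scale_right: "h2_inner h (h2_scale c f) = cnj c * h2_inner h f"
  by (metis complex_cnj_mult h2_inner_scale_left h2_inner_commute)

lemma h2_inner_diff_right: "h2_inner h (f - g) = h2_inner h f - h2_inner h g"
  by (metis complex_cnj_diff h2_inner_diff_left h2_inner_commute)

lemma h2_inner_zero_left [simp]: "h2_inner 0 f = 0"
  using h2_inner_diff_left[of 0 0 f] by simp

lemma h2_inner_zero_right [simp]: "h2_inner f 0 = 0"
  using h2_inner_diff_right[of f 0 0] by simp

lemma h2_inner_sum_left: "h2_inner (\<Sum>i\<in>A. f i) h = (\<Sum>i\<in>A. h2_inner (f i) h)"
  by (induction A rule: infinite_finite_induct) (simp_all add: h2_inner_add_left)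

lemma h2_inner_sum_right: "h2_inner h (\<Sum>i\<in>A. f i) = (\<Sum>i\<in>A. h2_inner h (f i))"
  by (induction A rule: infinite_finite_induct) (simp_all add: h2_inner_add_right)

lemmas h2_inner_simps = h2_inner_add_left h2_inner_add_right h2_inner_diff_left h2_inner_diff_right
  h2_inner_scale_left h2_inner_scale_right

lemma norm_h2_scale [simp]: "norm (h2_scale c f) = cmod c * norm f"
proof -
  have "(norm (h2_scale c f))\<^sup>2 = (cmod c * norm f)\<^sup>2"
    unfolding h2_norm_sq power_mult_distrib hcoeff_scale norm_mult
    by (rule suminf_mult[OF h2_fun_summable])
  then show ?thesis
    using power2_eq_iff_nonneg[of "norm (h2_scale c f)" "cmod c * norm f"] by auto
qed

lemma h2_Cauchy_Schwarz: "cmod (h2_inner f g) \<le> norm f * norm g"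
proof (cases "h2_inner f g = 0")
  case False
  \<comment> \<open>Rotating \<open>f\<close> by the unimodular \<open>c\<close> makes the complex
    inner product real and nonnegative, so that the inequality for the underlying real inner product
    applies.\<close>
  define c where "c = cnj (sgn (h2_inner f g))"
  have c: "cmod c = 1" using False by (simp add: c_def norm_sgn)
  have "c * h2_inner f g = (h2_inner f g * cnj (h2_inner f g)) / of_real (cmod (h2_inner f g))"
    by (simp add: c_def sgn_eq)
  also have "\<dots> = of_real ((cmod (h2_inner f g))\<^sup>2) / of_real (cmod (h2_inner f g))"
    by (simp only: complex_norm_square)
  also have "\<dots> = of_real (cmod (h2_inner f g))"
    using False by (simp add: power2_eq_square)
  finally have "cmod (h2_inner f g) = Re (c * h2_inner f g)" by simp
  also have "\<dots> = inner (h2_scale c f) g"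
    by (simp add: inner_hardy2_def h2_inner_scale_left)
  also have "\<dots> \<le> norm (h2_scale c f) * norm g"
    by (rule norm_cauchy_schwarz)
  finally show ?thesis using c by simp
qed simp

lemma h2_norm_sq_diff:
  "(norm (f - g))\<^sup>2 = (norm f)\<^sup>2 + (norm g)\<^sup>2 - 2 * Re (h2_inner f g)"
  using dot_norm_neg[of f g] by (simp add: inner_hardy2_def field_simps)

lemma h2_norm_sq_add_orth:
  assumes "h2_inner f g = 0"
  shows "(norm (f + g))\<^sup>2 = (norm f)\<^sup>2 + (norm g)\<^sup>2"
  using dot_norm[of f g] assms by (simp add: inner_hardy2_def field_simps)

text \<open>Each partial sum of squared coefficients is a limit of partial sums damped by
  \<open>r ^ (2 * k)\<close>, and these lie below the circle means. Only radii near 1 are tested,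
  since a quotient by a Blaschke product is controlled only near the circle.\<close>

lemma summable_hardy_coeffI:
  assumes f: "f holomorphic_on unit_disc"
    and "r0 < 1" and bd: "\<And>r. r0 < r \<Longrightarrow> 0 \<le> r \<Longrightarrow> r < 1 \<Longrightarrow> circle_sq r f \<le> C"
  shows "summable (\<lambda>k. (cmod (taylor_coeff f k))\<^sup>2)"
    and "(\<Sum>k. (cmod (taylor_coeff f k))\<^sup>2) \<le> C"
proof -
  have fin: "(\<Sum>k<n. (cmod (taylor_coeff f k))\<^sup>2) \<le> C" for n
  proof -
    have "((\<lambda>r. \<Sum>k<n. (cmod (taylor_coeff f k))\<^sup>2 * r ^ (2 * k)) \<longlongrightarrow>
        (\<Sum>k<n. (cmod (taylor_coeff f k))\<^sup>2 * 1 ^ (2 * k))) (at_left (1 :: real))"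
      by (intro tendsto_intros)
    moreover have "\<forall>\<^sub>F r in at_left (1 :: real). (\<Sum>k<n. (cmod (taylor_coeff f k))\<^sup>2 * r ^ (2 * k)) \<le> C"
    proof (rule eventually_mono[OF eventually_at_left_real[of "max r0 0" 1]])
      fix r assume "r \<in> {max r0 0<..<1}"
      then have r: "r0 < r" "0 \<le> r" "r < 1" by auto
      have "(\<Sum>k<n. (cmod (taylor_coeff f k))\<^sup>2 * r ^ (2 * k)) \<le> circle_sq r f"
        using circle_sq_sums[OF f r(2,3)]
        by (metis (no_types, lifting) ext finite_lessThan mult_nonneg_nonneg r(2) sum_le_suminf sums_iff zero_le_power zero_le_power2)
      then show "(\<Sum>k<n. (cmod (taylor_coeff f k))\<^sup>2 * r ^ (2 * k)) \<le> C"
        using bd[OF r] by linarith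
    qed (use \<open>r0 < 1\<close> in auto)
    ultimately show ?thesis
      using tendsto_upperbound[of _ _ "at_left (1 :: real)" C] by simp
  qed
  show "summable (\<lambda>k. (cmod (taylor_coeff f k))\<^sup>2)"
    by (rule summableI_nonneg_bounded[OF _ fin]) simp
  then show "(\<Sum>k. (cmod (taylor_coeff f k))\<^sup>2) \<le> C"
    using fin by (intro suminf_le_const)
qed

lemma h2_ofI:
  assumes f: "f holomorphic_on unit_disc"
    and "r0 < 1" and bd: "\<And>r. r0 < r \<Longrightarrow> 0 \<le> r \<Longrightarrow> r < 1 \<Longrightarrow> circle_sq r f \<le> C\<^sup>2" and "0 \<le> C"
  shows "\<And>z. norm z < 1 \<Longrightarrow> h2_fun (h2_of f) z = f z" and "norm (h2_of f) \<le> C"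
proof -
  note * = summable_hardy_coeffI[OF f \<open>r0 < 1\<close> bd]
  show "\<And>z. norm z < 1 \<Longrightarrow> h2_fun (h2_of f) z = f z"
    using h2_fun_h2_of[OF f *(1)] .
  have "(norm (h2_of f))\<^sup>2 \<le> C\<^sup>2"
    using *(2) by (simp add: h2_norm_sq hcoeff_h2_of[OF f *(1)])
  then show "norm (h2_of f) \<le> C"
    using \<open>0 \<le> C\<close> by (rule power2_le_imp_le)
qed

lemma circle_sq_h2_le:
  assumes "0 \<le> r" "r < 1"
  shows "circle_sq r (h2_fun f) \<le> (norm f)\<^sup>2"
proof -
  have "(cmod (hcoeff f k))\<^sup>2 * r ^ (2 * k) \<le> (cmod (hcoeff f k))\<^sup>2" for k
    using assms by (intro mult_right_le_one_le power_le_one) auto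
  then show ?thesis
    using sums_le[OF _ circle_sq_sums[OF h2_fun_holomorphic assms] h2_norm_sums] by blast
qed

text \<open>A pointwise comparison on a thin annulus at the circle is enough for membership and for
  the norm. Valid on the whole disc it yields bounded multipliers, valid near the circle it yields
  division by Blaschke products.\<close>

lemma h2_of_mult_le:
  assumes g: "g holomorphic_on unit_disc"
    and "r0 < 1" and bd: "\<And>z. r0 < norm z \<Longrightarrow> norm z < 1 \<Longrightarrow> cmod (g z) \<le> C * cmod (h2_fun f z)" and "0 \<le> C"
  shows "\<And>z. norm z < 1 \<Longrightarrow> h2_fun (h2_of g) z = g z" and "norm (h2_of g) \<le> C * norm f"
proof -
  have "circle_sq r g \<le> (C * norm f)\<^sup>2" if r: "r0 < r" "0 \<le> r" "r < 1" for r
  proof -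
    have "circle_sq r g \<le> C\<^sup>2 * circle_sq r (h2_fun f)"
      using r bd \<open>0 \<le> C\<close> by (intro circle_sq_le[OF g h2_fun_holomorphic]) auto
    also have "\<dots> \<le> C\<^sup>2 * (norm f)\<^sup>2"
      using r by (intro mult_left_mono circle_sq_h2_le) auto
    finally show ?thesis by (simp add: power_mult_distrib)
  qed
  from h2_ofI[OF g \<open>r0 < 1\<close> this] show "\<And>z. norm z < 1 \<Longrightarrow> h2_fun (h2_of g) z = g z"
    "norm (h2_of g) \<le> C * norm f"
    using \<open>0 \<le> C\<close> by auto
qed

section \<open>Bounded multipliers, monomials and kernels\<close>

definition h2_mult :: "(complex \<Rightarrow> complex) \<Rightarrow> hardy2 \<Rightarrow> hardy2" where
  "h2_mult \<phi> f = h2_of (\<lambda>z. \<phi> z * h2_fun f z)"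

definition bounded_holo :: "(complex \<Rightarrow> complex) \<Rightarrow> real \<Rightarrow> bool" where
  "bounded_holo \<phi> C \<longleftrightarrow> \<phi> holomorphic_on unit_disc \<and> 0 \<le> C \<and> (\<forall>z\<in>unit_disc. cmod (\<phi> z) \<le> C)"

lemma h2_mult:
  assumes "bounded_holo \<phi> C"
  shows h2_fun_mult: "\<And>z. norm z < 1 \<Longrightarrow> h2_fun (h2_mult \<phi> f) z = \<phi> z * h2_fun f z"
    and norm_h2_mult_le: "norm (h2_mult \<phi> f) \<le> C * norm f"
proof -
  have h: "(\<lambda>z. \<phi> z * h2_fun f z) holomorphic_on unit_disc"
    using assms by (auto simp: bounded_holo_def intro!: holomorphic_intros h2_fun_holomorphic simp del: mem_ball)
  have "cmod (\<phi> z * h2_fun f z) \<le> C * cmod (h2_fun f z)" if "norm z < 1" for z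
    using assms that by (auto simp: bounded_holo_def norm_mult intro!: mult_right_mono)
  then show "\<And>z. norm z < 1 \<Longrightarrow> h2_fun (h2_mult \<phi> f) z = \<phi> z * h2_fun f z"
    "norm (h2_mult \<phi> f) \<le> C * norm f"
    using h2_of_mult_le[OF h, of 0 C f] assms unfolding h2_mult_def bounded_holo_def by auto
qed

lemma h2_mult_add:
  assumes "bounded_holo \<phi> C"
  shows "h2_mult \<phi> (f + g) = h2_mult \<phi> f + h2_mult \<phi> g"
  by (rule h2_fun_eqI) (simp add: h2_fun_mult[OF assms] algebra_simps)

lemma h2_mult_diff:
  assumes "bounded_holo \<phi> C"
  shows "h2_mult \<phi> (f - g) = h2_mult \<phi> f - h2_mult \<phi> g"
  by (rule h2_fun_eqI) (simp add: h2_fun_mult[OF assms] algebra_simps)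

lemma h2_mult_scale:
  assumes "bounded_holo \<phi> C"
  shows "h2_mult \<phi> (h2_scale c f) = h2_scale c (h2_mult \<phi> f)"
  by (rule h2_fun_eqI) (simp add: h2_fun_mult[OF assms] algebra_simps)

definition h2_power :: "nat \<Rightarrow> hardy2" where "h2_power n = h2_of (\<lambda>z. z ^ n)"

lemma taylor_coeff_power: "taylor_coeff (\<lambda>z. z ^ n) k = (if k = n then 1 else 0)"
  using taylor_coeff_eqI[OF has_fps_expansion_fps_X_power, of n k] by (simp add: fps_X_power_iff)

lemma h2_power:
  shows h2_fun_power: "\<And>z. norm z < 1 \<Longrightarrow> h2_fun (h2_power n) z = z ^ n"
    and hcoeff_power [simp]: "hcoeff (h2_power n) k = (if k = n then 1 else 0)"
proof -
  have s: "summable (\<lambda>k. (cmod (taylor_coeff (\<lambda>z. z ^ n) k))\<^sup>2)"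
    unfolding taylor_coeff_power by (rule summable_finite[of "{n}"]) auto
  have h: "(\<lambda>z. z ^ n) holomorphic_on unit_disc" by (intro holomorphic_intros)
  show "\<And>z. norm z < 1 \<Longrightarrow> h2_fun (h2_power n) z = z ^ n"
    using h2_fun_h2_of[OF h s] by (simp add: h2_power_def)
  show "hcoeff (h2_power n) k = (if k = n then 1 else 0)"
    using hcoeff_h2_of[OF h s] by (simp add: h2_power_def taylor_coeff_power)
qed

lemma h2_inner_power_right [simp]: "h2_inner f (h2_power n) = hcoeff f n"
proof -
  have "(\<lambda>k. hcoeff f k * cnj (hcoeff (h2_power n) k)) = (\<lambda>k. if k = n then hcoeff f k else 0)"
    by auto
  then show ?thesis
    using h2_inner_sums[of f "h2_power n"] sums_single[of n "\<lambda>k. hcoeff f k"]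
    by (metis (no_types, lifting) sums_unique2)
qed

lemma norm_h2_power [simp]: "norm (h2_power n) = 1"
proof -
  have "(norm (h2_power n))\<^sup>2 = 1"
    using h2_inner_self_norm[of "h2_power n"] by (metis h2_inner_power_right hcoeff_power of_real_eq_1_iff)
  then show ?thesis
    using norm_ge_zero[of "h2_power n"] unfolding power2_eq_1_iff by linarith
qed

text \<open>The Szego kernel; it reproduces the value at \<open>w\<close>, see
  \<open>h2_inner_kernel\<close>.\<close>

definition h2_kernel :: "complex \<Rightarrow> hardy2" where
  "h2_kernel w = h2_of (\<lambda>z. 1 / (1 - cnj w * z))"

lemma one_minus_cnj_mult_nonzero:
  assumes "norm w < 1" "norm z \<le> 1"
  shows "1 - cnj w * z \<noteq> 0"
proof
  assume "1 - cnj w * z = 0"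
  then have "cmod (cnj w * z) = 1" by (metis eq_iff_diff_eq_0 norm_one)
  moreover have "cmod (cnj w * z) < 1"
    using assms mult_left_le[of "cmod z" "cmod w"] by (simp add: norm_mult)
  ultimately show False by simp
qed

lemma h2_kernel:
  assumes w: "norm w < 1"
  shows h2_fun_kernel: "\<And>z. norm z < 1 \<Longrightarrow> h2_fun (h2_kernel w) z = 1 / (1 - cnj w * z)"
    and hcoeff_kernel: "\<And>k. hcoeff (h2_kernel w) k = cnj w ^ k"
proof -
  have h: "(\<lambda>z. 1 / (1 - cnj w * z)) holomorphic_on unit_disc"
    using one_minus_cnj_mult_nonzero[OF w] by (intro holomorphic_intros) auto
  have sm: "summable (\<lambda>k. (cmod (cnj w ^ k))\<^sup>2)"
  proof -
    have "(cmod w)\<^sup>2 < 1" using w by (simp add: abs_square_less_1)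
    then have "summable (\<lambda>k. ((cmod w)\<^sup>2) ^ k)" by (intro summable_geometric) auto
    then show ?thesis by (simp add: norm_power mult.commute flip: power_mult)
  qed
  obtain f where f: "\<And>k. hcoeff f k = cnj w ^ k"
    using hardy2_of_coeffs[OF sm] by blast
  have fe: "h2_fun f z = 1 / (1 - cnj w * z)" if "norm z < 1" for z
  proof -
    have "cmod (cnj w * z) < 1"
      using w that mult_left_le[of "cmod z" "cmod w"] by (simp add: norm_mult)
    then have "(\<lambda>k. (cnj w * z) ^ k) sums (1 / (1 - cnj w * z))"
      by (rule geometric_sums)
    then show ?thesis
      using h2_fun_sums[OF that, of f] f sums_unique2 by (simp add: power_mult_distrib)
  qed
  have tc: "taylor_coeff (\<lambda>z. 1 / (1 - cnj w * z)) k = cnj w ^ k" for k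
    using taylor_coeff_cong[of 1 "h2_fun f" "\<lambda>z. 1 / (1 - cnj w * z)" k] fe f by simp
  show "\<And>z. norm z < 1 \<Longrightarrow> h2_fun (h2_kernel w) z = 1 / (1 - cnj w * z)"
    unfolding h2_kernel_def by (rule h2_fun_h2_of[OF h]) (use tc sm in simp_all)
  show "\<And>k. hcoeff (h2_kernel w) k = cnj w ^ k"
    unfolding h2_kernel_def using tc sm by (subst hcoeff_h2_of[OF h]) simp_all
qed

lemma h2_inner_kernel:
  assumes "norm w < 1"
  shows "h2_inner f (h2_kernel w) = h2_fun f w"
  using h2_inner_sums[of f "h2_kernel w"] h2_fun_sums[OF assms, of f] sums_unique2
  by (simp add: hcoeff_kernel[OF assms])

lemma h2_kernel_nonzero: "norm w < 1 \<Longrightarrow> h2_kernel w \<noteq> 0"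
  using hcoeff_kernel[of w 0] by force

subsection \<open>Finite Blaschke products\<close>

definition blaschke_prod :: "complex list \<Rightarrow> complex \<Rightarrow> complex" where
  "blaschke_prod xs z = (\<Prod>x\<leftarrow>xs. blaschke_factor x z)"

lemma blaschke_prod_simps [simp]:
  "blaschke_prod [] z = 1"
  "blaschke_prod (x # xs) z = blaschke_factor x z * blaschke_prod xs z"
  "blaschke_prod (xs @ ys) z = blaschke_prod xs z * blaschke_prod ys z"
  by (simp_all add: blaschke_prod_def)

lemma analytic_blaschke_factor:
  assumes "norm x < 1"
  shows "blaschke_factor x analytic_on cball 0 1"
  unfolding blaschke_factor_def[abs_def]
  using one_minus_cnj_mult_nonzero[OF assms] by (intro analytic_intros) auto

lemma analytic_blaschke_prod:
  assumes "set xs \<subseteq> unit_disc"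
  shows "blaschke_prod xs analytic_on cball 0 1"
proof -
  have "blaschke_prod [] = (\<lambda>_. 1)" "\<And>x xs. blaschke_prod (x # xs) = (\<lambda>z. blaschke_factor x z * blaschke_prod xs z)"
    by auto
  then show ?thesis
    using assms by (induction xs) (auto intro!: analytic_intros analytic_blaschke_factor)
qed

lemma holomorphic_blaschke_prod:
  assumes "set xs \<subseteq> unit_disc"
  shows "blaschke_prod xs holomorphic_on unit_disc"
  using analytic_imp_holomorphic[OF analytic_on_subset[OF analytic_blaschke_prod[OF assms]]]
  by (simp add: ball_subset_cball)

section \<open>Modulus of Blaschke products in the disc and at the circle\<close>

lemma blaschke_factor_identity:
  assumes "1 - cnj x * z \<noteq> 0"
  shows "1 - (cmod (blaschke_factor x z))\<^sup>2 = (1 - (cmod x)\<^sup>2) * (1 - (cmod z)\<^sup>2) / (cmod (1 - cnj x * z))\<^sup>2"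
proof -
  have "(cmod (1 - cnj x * z))\<^sup>2 - (cmod (x - z))\<^sup>2 = (1 - (cmod x)\<^sup>2) * (1 - (cmod z)\<^sup>2)"
    unfolding cmod_power2 by (simp add: algebra_simps power2_eq_square)
  moreover have "(cmod (1 - cnj x * z))\<^sup>2 \<noteq> 0" using assms by simp
  ultimately show ?thesis
    by (simp add: blaschke_factor_def norm_divide power_divide field_simps)
qed

lemma blaschke_factor_norm:
  assumes "norm x < 1"
  shows blaschke_factor_norm_le: "norm z \<le> 1 \<Longrightarrow> cmod (blaschke_factor x z) \<le> 1"
    and blaschke_factor_norm_eq: "norm z = 1 \<Longrightarrow> cmod (blaschke_factor x z) = 1"
proof -
  show "cmod (blaschke_factor x z) \<le> 1" if "norm z \<le> 1"
  proof -
    have "0 \<le> (1 - (cmod x)\<^sup>2) * (1 - (cmod z)\<^sup>2) / (cmod (1 - cnj x * z))\<^sup>2"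
      using assms that by (intro divide_nonneg_nonneg mult_nonneg_nonneg) (auto simp: abs_square_le_1)
    then have "(cmod (blaschke_factor x z))\<^sup>2 \<le> 1"
      using blaschke_factor_identity[OF one_minus_cnj_mult_nonzero[OF assms that]] by linarith
    then show ?thesis by (simp add: abs_square_le_1)
  qed
  show "cmod (blaschke_factor x z) = 1" if "norm z = 1"
    using blaschke_factor_identity[OF one_minus_cnj_mult_nonzero[OF assms], of z] that
    by (simp add: abs_square_eq_1)
qed

lemma blaschke_prod_norm:
  assumes "set xs \<subseteq> unit_disc"
  shows blaschke_prod_norm_le: "norm z \<le> 1 \<Longrightarrow> cmod (blaschke_prod xs z) \<le> 1"
    and blaschke_prod_norm_eq: "norm z = 1 \<Longrightarrow> cmod (blaschke_prod xs z) = 1"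
  using assms by (induction xs) (auto simp: norm_mult blaschke_factor_norm_eq intro!: mult_le_one blaschke_factor_norm_le)

lemma bounded_holo_blaschke_prod:
  "set xs \<subseteq> unit_disc \<Longrightarrow> bounded_holo (blaschke_prod xs) 1"
  by (simp add: bounded_holo_def holomorphic_blaschke_prod blaschke_prod_norm_le)

lemma bounded_holo_blaschke_factor: "norm x < 1 \<Longrightarrow> bounded_holo (blaschke_factor x) 1"
proof -
  assume "norm x < 1"
  moreover have "blaschke_prod [x] = blaschke_factor x" by auto
  ultimately show ?thesis
    using bounded_holo_blaschke_prod[of "[x]"] by simp
qed

lemma blaschke_prod_near_circle:
  assumes xs: "set xs \<subseteq> unit_disc" and "0 < e"
  shows "\<exists>r0<1. 0 \<le> r0 \<and> (\<forall>z. r0 < norm z \<longrightarrow> norm z < 1 \<longrightarrow> 1 - e < cmod (blaschke_prod xs z))"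
proof -
  have "continuous_on (cball 0 1) (blaschke_prod xs)"
    using analytic_blaschke_prod[OF xs] by (intro holomorphic_on_imp_continuous_on analytic_imp_holomorphic)
  then have "uniformly_continuous_on (cball 0 1) (blaschke_prod xs)"
    by (intro compact_uniformly_continuous) auto
  then obtain d where d: "d > 0" "\<And>z z'. \<lbrakk>norm z \<le> 1; norm z' \<le> 1; dist z z' < d\<rbrakk> \<Longrightarrow>
      dist (blaschke_prod xs z) (blaschke_prod xs z') < e"
    using \<open>0 < e\<close> unfolding uniformly_continuous_on_def by (auto simp: dist_commute)
  show ?thesis
  proof (intro exI[of _ "max 0 (1 - d)"] conjI allI impI)
    fix z :: complex assume z: "max 0 (1 - d) < norm z" "norm z < 1"
    \<comment> \<open>The radial projection of \<open>z\<close> to the circle, where the product has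
      modulus 1.\<close>
    let ?u = "z / of_real (norm z)"
    have "z - ?u = ?u * of_real (norm z - 1)"
      using z by (simp add: field_simps)
    then have "dist z ?u = cmod ?u * \<bar>norm z - 1\<bar>"
      by (simp only: dist_norm norm_mult norm_of_real)
    moreover have "cmod ?u = 1" using z by (simp add: norm_divide)
    ultimately have "dist z ?u = 1 - norm z" using z by simp
    then have "dist z ?u < d" using z by simp
    then have "dist (blaschke_prod xs z) (blaschke_prod xs ?u) < e"
      using z by (intro d) (auto simp: norm_divide)
    moreover have "cmod (blaschke_prod xs ?u) = 1"
      using z by (intro blaschke_prod_norm_eq xs) (auto simp: norm_divide)
    ultimately show "1 - e < cmod (blaschke_prod xs z)"
      using norm_triangle_ineq2[of "blaschke_prod xs ?u" "blaschke_prod xs z"]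
      by (simp add: dist_norm norm_minus_commute)
  qed (use d in auto)
qed

text \<open>For the lower bound \<open>f\<close> is recovered by division: near the circle the
  product has modulus above \<open>1 - e\<close>, so dividing costs at most
  \<open>1 / (1 - e)\<close>, and \<open>e\<close> tends to 0.\<close>

lemma norm_h2_blaschke [simp]:
  assumes xs: "set xs \<subseteq> unit_disc"
  shows "norm (h2_mult (blaschke_prod xs) f) = norm f"
proof (rule antisym)
  show "norm (h2_mult (blaschke_prod xs) f) \<le> norm f"
    using norm_h2_mult_le[OF bounded_holo_blaschke_prod[OF xs], of f] by simp
  let ?g = "h2_mult (blaschke_prod xs) f"
  have "(1 - e) * norm f \<le> norm ?g" if e: "0 < e" "e < 1" for e
  proof -
    obtain r0 where r0: "r0 < 1" "\<And>z. r0 < norm z \<Longrightarrow> norm z < 1 \<Longrightarrow> 1 - e < cmod (blaschke_prod xs z)"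
      using blaschke_prod_near_circle[OF xs e(1)] by blast
    have bd: "cmod (h2_fun f z) \<le> (1 / (1 - e)) * cmod (h2_fun ?g z)" if "r0 < norm z" "norm z < 1" for z
    proof -
      have "(1 - e) * cmod (h2_fun f z) \<le> cmod (h2_fun ?g z)"
        using r0(2)[OF that] h2_fun_mult[OF bounded_holo_blaschke_prod[OF xs] that(2), of f]
        by (simp add: norm_mult mult_right_mono)
      then show ?thesis using e by (simp add: field_simps)
    qed
    have "norm (h2_of (h2_fun f)) \<le> (1 / (1 - e)) * norm ?g"
      using e by (intro h2_of_mult_le(2)[OF h2_fun_holomorphic r0(1) bd]) auto
    moreover have "h2_of (h2_fun f) = f"
      by (rule h2_fun_eqI) (simp add: h2_fun_h2_of h2_fun_holomorphic h2_fun_summable)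
    ultimately show ?thesis using e by (simp add: field_simps)
  qed
  then have "\<forall>\<^sub>F e in at_right (0::real). (1 - e) * norm f \<le> norm ?g"
    by (auto simp: eventually_at_right_field intro!: exI[of _ 1])
  moreover have "((\<lambda>e::real. (1 - e) * norm f) \<longlongrightarrow> (1 - 0) * norm f) (at_right 0)"
    by (intro tendsto_intros)
  ultimately show "norm f \<le> norm ?g"
    using tendsto_upperbound[of _ "(1 - 0) * norm f" "at_right (0::real)"] by simp
qed

text \<open>Polarisation: the isometry preserves real parts, and replacing \<open>g\<close> by
  \<open>\<i> * g\<close> turns the imaginary part into a real part.\<close>

lemma h2_inner_blaschke:
  assumes xs: "set xs \<subseteq> unit_disc"
  shows "h2_inner (h2_mult (blaschke_prod xs) f) (h2_mult (blaschke_prod xs) g) = h2_inner f g"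
proof -
  note bh = bounded_holo_blaschke_prod[OF xs]
  have re: "Re (h2_inner (h2_mult (blaschke_prod xs) f) (h2_mult (blaschke_prod xs) g)) = Re (h2_inner f g)" for f g
    using h2_norm_sq_diff[of "h2_mult (blaschke_prod xs) f" "h2_mult (blaschke_prod xs) g"]
      h2_norm_sq_diff[of f g]
    by (simp add: xs flip: h2_mult_diff[OF bh])
  show ?thesis
  proof (rule complex_eqI[OF re])
    show "Im (h2_inner (h2_mult (blaschke_prod xs) f) (h2_mult (blaschke_prod xs) g)) = Im (h2_inner f g)"
      using re[of f "h2_scale \<i> g"] by (simp add: h2_mult_scale[OF bh] h2_inner_scale_right)
  qed
qed

lemma h2_mult_append:
  assumes "set xs \<subseteq> unit_disc" "set ys \<subseteq> unit_disc"
  shows "h2_mult (blaschke_prod (xs @ ys)) f = h2_mult (blaschke_prod xs) (h2_mult (blaschke_prod ys) f)"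
  using assms by (intro h2_fun_eqI) (simp add: h2_fun_mult[OF bounded_holo_blaschke_prod])

lemma h2_mult_cons:
  assumes "norm x < 1" "set ys \<subseteq> unit_disc"
  shows "h2_mult (blaschke_prod (x # ys)) f = h2_mult (blaschke_prod [x]) (h2_mult (blaschke_prod ys) f)"
  using h2_mult_append[of "[x]" ys f] assms by simp

lemma h2_mult_append_commute:
  assumes "set xs \<subseteq> unit_disc" "set ys \<subseteq> unit_disc"
  shows "h2_mult (blaschke_prod (xs @ ys)) f = h2_mult (blaschke_prod ys) (h2_mult (blaschke_prod xs) f)"
  using assms by (intro h2_fun_eqI) (simp add: h2_fun_mult[OF bounded_holo_blaschke_prod])

lemma blaschke_prod_Nil: "blaschke_prod [] = (\<lambda>_. 1)"
  by auto

lemma h2_mult_1 [simp]: "h2_mult (\<lambda>_. 1) f = f"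
  by (intro h2_fun_eqI) (simp add: h2_fun_mult[of _ 1] bounded_holo_def)

text \<open>The quotient stays in the Hardy space because the product has modulus above 1/2 on an
  annulus at the circle, and membership is tested there.\<close>

lemma blaschke_prod_divide:
  assumes xs: "set xs \<subseteq> unit_disc" and g: "g holomorphic_on unit_disc"
    and eq: "\<And>z. norm z < 1 \<Longrightarrow> h2_fun f z = blaschke_prod xs z * g z"
  shows "\<And>z. norm z < 1 \<Longrightarrow> h2_fun (h2_of g) z = g z" and "f = h2_mult (blaschke_prod xs) (h2_of g)"
proof -
  obtain r0 where r0: "r0 < 1" "\<And>z. r0 < norm z \<Longrightarrow> norm z < 1 \<Longrightarrow> 1 - 1/2 < cmod (blaschke_prod xs z)"
    using blaschke_prod_near_circle[OF xs, of "1/2"] by auto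
  have bd: "cmod (g z) \<le> 2 * cmod (h2_fun f z)" if "r0 < norm z" "norm z < 1" for z
    using r0(2)[OF that] eq[OF that(2)] mult_right_mono[of 1 "2 * cmod (blaschke_prod xs z)" "cmod (g z)"]
    by (simp add: norm_mult)
  show *: "\<And>z. norm z < 1 \<Longrightarrow> h2_fun (h2_of g) z = g z"
    using h2_of_mult_le(1)[OF g r0(1) bd] by simp
  show "f = h2_mult (blaschke_prod xs) (h2_of g)"
    by (rule h2_fun_eqI) (simp add: h2_fun_mult[OF bounded_holo_blaschke_prod[OF xs]] * eq)
qed

text \<open>The maximum principle on circles close to the boundary, where the product has modulus
  above \<open>1 - e\<close>, bounds \<open>g\<close> by \<open>C / (1 - e)\<close>. That division
  does not increase the bound keeps the quotients in a normal family later.\<close>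

lemma bounded_divide_blaschke:
  assumes xs: "set xs \<subseteq> unit_disc" and g: "g holomorphic_on unit_disc"
    and eq: "\<And>z. norm z < 1 \<Longrightarrow> cmod (blaschke_prod xs z * g z) \<le> C" and z: "norm z < 1"
  shows "cmod (g z) \<le> C"
proof -
  have C: "0 \<le> C" using order_trans[OF norm_ge_zero eq[of 0]] by simp
  have "(1 - e) * cmod (g z) \<le> C" if e: "0 < e" "e < 1" for e
  proof -
    obtain r0 where r0: "r0 < 1" "\<And>z. r0 < norm z \<Longrightarrow> norm z < 1 \<Longrightarrow> 1 - e < cmod (blaschke_prod xs z)"
      using blaschke_prod_near_circle[OF xs e(1)] by blast
    obtain r where r: "max r0 (norm z) < r" "r < 1"
      using dense[of "max r0 (norm z)" 1] r0 z by auto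
    have "cmod (g z) \<le> C / (1 - e)"
    proof (rule maximum_modulus_frontier[of g "ball 0 r"])
      show "g holomorphic_on interior (ball 0 r)"
        using r by (intro holomorphic_on_subset[OF g]) auto
      have "continuous_on (cball 0 r) g"
        using r by (intro continuous_on_subset[OF holomorphic_on_imp_continuous_on[OF g]]) auto
      moreover have "0 < r" using r norm_ge_zero[of z] by linarith
      ultimately show "continuous_on (closure (ball 0 r)) g" by simp
      show "cmod (g w) \<le> C / (1 - e)" if "w \<in> frontier (ball 0 r)" for w
      proof -
        have w: "norm w = r" using that \<open>0 < r\<close> by simp
        have "(1 - e) * cmod (g w) \<le> cmod (blaschke_prod xs w * g w)"
          using r0(2)[of w] r w by (simp add: norm_mult mult_right_mono)
        also have "\<dots> \<le> C" using eq[of w] w r by simp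
        finally show ?thesis using e by (simp add: field_simps)
      qed
    qed (use r in auto)
    then show ?thesis using e by (simp add: field_simps)
  qed
  then have "\<forall>\<^sub>F e in at_right (0::real). (1 - e) * cmod (g z) \<le> C"
    by (auto simp: eventually_at_right_field intro!: exI[of _ 1])
  moreover have "((\<lambda>e::real. (1 - e) * cmod (g z)) \<longlongrightarrow> (1 - 0) * cmod (g z)) (at_right 0)"
    by (intro tendsto_intros)
  ultimately show ?thesis
    using tendsto_upperbound[of _ "(1 - 0) * cmod (g z)" "at_right (0::real)"] by simp
qed

lemma holomorphic_divide_blaschke_factor:
  assumes f: "f holomorphic_on unit_disc" and x: "norm x < 1" and fx: "f x = 0"
  shows "\<exists>g. g holomorphic_on unit_disc \<and> (\<forall>z\<in>unit_disc. f z = blaschke_factor x z * g z)"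
proof -
  define q where "q z = (if z = x then deriv f x else (f z - f x) / (z - x))" for z
  have q: "q holomorphic_on unit_disc"
    unfolding q_def[abs_def] by (rule pole_lemma[OF f]) (use x in simp)
  show ?thesis
  proof (intro exI[of _ "\<lambda>z. - (1 - cnj x * z) * q z"] conjI ballI)
    show "(\<lambda>z. - (1 - cnj x * z) * q z) holomorphic_on unit_disc"
      using q by (intro holomorphic_intros)
    fix z assume "z \<in> unit_disc"
    then have "1 - cnj x * z \<noteq> 0" using one_minus_cnj_mult_nonzero[OF x, of z] by simp
    then have "blaschke_factor x z * (1 - cnj x * z) = x - z"
      by (simp add: blaschke_factor_def)
    moreover have "f z = - (x - z) * q z" using fx by (simp add: q_def)
    ultimately show "f z = blaschke_factor x z * (- (1 - cnj x * z) * q z)"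
      by (metis mult.assoc mult_minus_left mult_minus_right)
  qed
qed

subsection \<open>Model spaces of finite Blaschke products\<close>

text \<open>The orthogonal complement of the multiples of the product with the given zeros. A list
  records multiplicities by repetition, and appending lists multiplies products, so that inductions
  run over one zero at a time.\<close>

definition bspace :: "complex list \<Rightarrow> hardy2 set" where
  "bspace xs = {f. \<forall>g. h2_inner f (h2_mult (blaschke_prod xs) g) = 0}"

lemma bspaceD: "f \<in> bspace xs \<Longrightarrow> h2_inner f (h2_mult (blaschke_prod xs) g) = 0"
  by (simp add: bspace_def)

lemma bspace_zero [simp]: "0 \<in> bspace xs"
  and bspace_add: "f \<in> bspace xs \<Longrightarrow> g \<in> bspace xs \<Longrightarrow> f + g \<in> bspace xs"
  and bspace_diff: "f \<in> bspace xs \<Longrightarrow> g \<in> bspace xs \<Longrightarrow> f - g \<in> bspace xs"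
  and bspace_scale: "f \<in> bspace xs \<Longrightarrow> h2_scale c f \<in> bspace xs"
  by (simp_all add: bspace_def h2_inner_simps)

lemma bspace_sum: "(\<And>i. i \<in> A \<Longrightarrow> f i \<in> bspace xs) \<Longrightarrow> (\<Sum>i\<in>A. f i) \<in> bspace xs"
  by (induction A rule: infinite_finite_induct) (auto intro: bspace_add)

lemma bspace_cong_mset:
  assumes "mset xs = mset ys"
  shows "bspace xs = bspace ys"
proof -
  have "blaschke_prod xs = blaschke_prod ys"
    unfolding blaschke_prod_def
    by (intro ext) (metis assms mset_map prod_mset_prod_list)
  then show ?thesis by (simp add: bspace_def)
qed

lemma bspace_mono:
  assumes "set xs \<subseteq> unit_disc" "set ys \<subseteq> unit_disc"
  shows bspace_mono1: "bspace xs \<subseteq> bspace (xs @ ys)" and bspace_mono2: "bspace ys \<subseteq> bspace (xs @ ys)"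
proof -
  show "bspace xs \<subseteq> bspace (xs @ ys)"
    by (auto simp: bspace_def h2_mult_append[OF assms])
  show "bspace ys \<subseteq> bspace (xs @ ys)"
    unfolding bspace_def h2_mult_append_commute[OF assms] by blast
qed

lemma bspace_Nil: "bspace [] = {0}"
proof -
  have "f = 0" if "f \<in> bspace []" for f
    using bspaceD[OF that, of f] h2_inner_self_norm[of f] by (simp add: blaschke_prod_Nil)
  then show ?thesis by auto
qed

lemma h2_inner_mult_left:
  assumes "set xs \<subseteq> unit_disc" "set ys \<subseteq> unit_disc"
  shows "h2_inner (h2_mult (blaschke_prod xs) f) (h2_mult (blaschke_prod (xs @ ys)) g) =
    h2_inner f (h2_mult (blaschke_prod ys) g)"
  using assms by (simp add: h2_mult_append h2_inner_blaschke)

lemma bspace_mult: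
  assumes "set xs \<subseteq> unit_disc" "set ys \<subseteq> unit_disc"
  shows "h2_mult (blaschke_prod xs) f \<in> bspace (xs @ ys) \<longleftrightarrow> f \<in> bspace ys"
  using assms by (simp add: bspace_def h2_inner_mult_left)

lemma bspace_mult':
  assumes "set xs \<subseteq> unit_disc" "set ys \<subseteq> unit_disc"
  shows "h2_mult (blaschke_prod ys) f \<in> bspace (xs @ ys) \<longleftrightarrow> f \<in> bspace xs"
  using bspace_mult[OF assms(2,1), of f] bspace_cong_mset[of "xs @ ys" "ys @ xs"] by simp

lemma h2_kernel_in_bspace:
  assumes "norm x < 1" "set xs \<subseteq> unit_disc" "x \<in> set xs"
  shows "h2_kernel x \<in> bspace xs"
proof -
  have "blaschke_prod xs x = 0"
    using assms(3) by (induction xs) (auto simp: blaschke_factor_def)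
  then have "h2_inner (h2_mult (blaschke_prod xs) g) (h2_kernel x) = 0" for g
    by (simp add: h2_inner_kernel[OF assms(1)] h2_fun_mult[OF bounded_holo_blaschke_prod[OF assms(2)]] assms(1))
  then show ?thesis
    unfolding bspace_def using h2_inner_commute[of "h2_kernel x"] by simp
qed

text \<open>The kernel takes the value \<open>1 / (1 - |x|^2)\<close> at its own point, so this
  multiple of it agrees with \<open>f\<close> at \<open>x\<close>, and the difference can be divided
  by the factor with zero \<open>x\<close>.\<close>

lemma bspace_single:
  assumes x: "norm x < 1"
  shows "\<exists>g. f = h2_scale (h2_fun f x * (1 - (cmod x)\<^sup>2)) (h2_kernel x) + h2_mult (blaschke_prod [x]) g"
proof -
  let ?k = "h2_scale (h2_fun f x * (1 - (cmod x)\<^sup>2)) (h2_kernel x)"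
  have "1 - (cmod x)\<^sup>2 \<noteq> 0" using x abs_square_eq_1[of "cmod x"] by auto
  moreover have "1 - cnj x * x = of_real (1 - (cmod x)\<^sup>2)"
    by (simp add: complex_norm_square mult.commute del: of_real_power)
  ultimately have "h2_fun (f - ?k) x = 0"
    by (simp add: h2_fun_kernel[OF x x] flip: of_real_power)
  then obtain g where g: "g holomorphic_on unit_disc" "\<forall>z\<in>unit_disc. h2_fun (f - ?k) z = blaschke_factor x z * g z"
    using holomorphic_divide_blaschke_factor[OF h2_fun_holomorphic x] by blast
  have "f - ?k = h2_mult (blaschke_prod [x]) (h2_of g)"
    by (rule blaschke_prod_divide(2)[OF _ g(1)]) (use x g(2) in auto)
  then show ?thesis by (metis add.commute diff_add_cancel)
qed

text \<open>The projection is built zero by zero: the kernel part is split off, the remaining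
  quotient is decomposed by induction, and its model part is multiplied back by the factor with zero
  \<open>x\<close>.\<close>

lemma bspace_decomp:
  assumes "set xs \<subseteq> unit_disc"
  shows "\<exists>k\<in>bspace xs. \<exists>g. f = k + h2_mult (blaschke_prod xs) g"
  using assms
proof (induction xs arbitrary: f)
  case Nil
  then show ?case by (intro bexI[of _ 0] exI[of _ f]) (auto simp: blaschke_prod_Nil)
next
  case (Cons x xs)
  then have x: "norm x < 1" and xs: "set xs \<subseteq> unit_disc" by auto
  obtain c g where g: "f = h2_scale c (h2_kernel x) + h2_mult (blaschke_prod [x]) g"
    using bspace_single[OF x, of f] by blast
  obtain k u where k: "k \<in> bspace xs" "g = k + h2_mult (blaschke_prod xs) u"
    using Cons.IH[OF xs] by blast
  have "h2_mult (blaschke_prod [x]) k \<in> bspace (x # xs)"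
    using bspace_mult[of "[x]" xs k] x xs k(1) by simp
  moreover have "h2_kernel x \<in> bspace (x # xs)"
    using x xs by (intro h2_kernel_in_bspace) auto
  ultimately have "h2_scale c (h2_kernel x) + h2_mult (blaschke_prod [x]) k \<in> bspace (x # xs)"
    by (intro bspace_add bspace_scale)
  moreover have "f = (h2_scale c (h2_kernel x) + h2_mult (blaschke_prod [x]) k) + h2_mult (blaschke_prod (x # xs)) u"
    using x xs unfolding g k(2) h2_mult_cons[OF x xs]
    by (subst h2_mult_add[OF bounded_holo_blaschke_prod]) (auto simp: add_ac)
  ultimately show ?case by blast
qed

lemma bspace_inter_mult:
  assumes "h2_mult (blaschke_prod xs) g \<in> bspace xs"
  shows "h2_mult (blaschke_prod xs) g = 0"
  using bspaceD[OF assms, of g] h2_inner_self_norm[of "h2_mult (blaschke_prod xs) g"] by simp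

text \<open>Turns agreement of two functionals on a model space into a congruence modulo the
  product.\<close>

lemma bspace_perp:
  assumes "set xs \<subseteq> unit_disc" and "\<And>k. k \<in> bspace xs \<Longrightarrow> h2_inner k f = 0"
  shows "\<exists>g. f = h2_mult (blaschke_prod xs) g"
proof -
  obtain k g where k: "k \<in> bspace xs" "f = k + h2_mult (blaschke_prod xs) g"
    using bspace_decomp[OF assms(1)] by blast
  have "h2_inner k k = 0"
    using assms(2)[OF k(1)] bspaceD[OF k(1), of g] by (simp add: k(2) h2_inner_simps)
  then have "k = 0" using h2_inner_self_norm[of k] by simp
  then show ?thesis using k by auto
qed

lemma bspace_Cons_decomp:
  assumes x: "norm x < 1" and xs: "set xs \<subseteq> unit_disc" and h: "h \<in> bspace (x # xs)"
  shows "\<exists>c. \<exists>k\<in>bspace xs. h = h2_scale c (h2_kernel x) + h2_mult (blaschke_prod [x]) k"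
proof -
  obtain c g where g: "h = h2_scale c (h2_kernel x) + h2_mult (blaschke_prod [x]) g"
    using bspace_single[OF x, of h] by blast
  have "h2_kernel x \<in> bspace (x # xs)"
    using x xs by (intro h2_kernel_in_bspace) auto
  then have "h - h2_scale c (h2_kernel x) \<in> bspace (x # xs)"
    using h by (intro bspace_diff bspace_scale)
  then have "h2_mult (blaschke_prod [x]) g \<in> bspace ([x] @ xs)"
    using g by simp
  then have "g \<in> bspace xs"
    using bspace_mult[of "[x]" xs g] x xs by simp
  then show ?thesis using g by blast
qed

text \<open>Together with \<open>bspace_Cons_decomp\<close> this gives both ways of adding a zero:
  in front, where the old space is multiplied by the new factor, and at the back, where the old
  space is kept and one vector orthogonal to it is added. One-step extensions rely on the second
  form.\<close>

lemma bspace_snoc_decomp: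
  assumes x: "norm x < 1" and xs: "set xs \<subseteq> unit_disc" and h: "h \<in> bspace (xs @ [x])"
  shows "\<exists>c. \<exists>k\<in>bspace xs. h = k + h2_scale c (h2_mult (blaschke_prod xs) (h2_kernel x))"
proof -
  obtain k g where k: "k \<in> bspace xs" "h = k + h2_mult (blaschke_prod xs) g"
    using bspace_decomp[OF xs] by blast
  have "k \<in> bspace (xs @ [x])"
    using k(1) bspace_mono1[of xs "[x]"] x xs by auto
  then have "h - k \<in> bspace (xs @ [x])"
    using h by (intro bspace_diff)
  then have "g \<in> bspace [x]"
    using k(2) bspace_mult[of xs "[x]" g] x xs by simp
  then obtain c k' where "k' \<in> bspace []" "g = h2_scale c (h2_kernel x) + h2_mult (blaschke_prod [x]) k'"
    using bspace_Cons_decomp[OF x, of "[]" g] by auto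
  moreover have "h2_mult (blaschke_prod [x]) 0 = 0"
  proof -
    have "norm (h2_mult (blaschke_prod [x]) 0) = norm (0 :: hardy2)"
      using x by (intro norm_h2_blaschke) auto
    then show ?thesis by simp
  qed
  ultimately have "g = h2_scale c (h2_kernel x)"
    by (simp add: bspace_Nil)
  then show ?thesis
    using k h2_mult_scale[OF bounded_holo_blaschke_prod[OF xs]] by auto
qed

text \<open>A dimension count in disguise: the dimension of a model space is the length of its list,
  so two spaces with trivial intersection fill the space of \<open>xs @ ys\<close>. In the induction
  each new zero \<open>y\<close> adds one direction on both sides, \<open>?e\<close> to the large
  space and \<open>?e'\<close> to the second summand.\<close>

lemma bspace_append_subset:
  assumes xs: "set xs \<subseteq> unit_disc" and ys: "set ys \<subseteq> unit_disc"
    and int: "bspace xs \<inter> bspace ys \<subseteq> {0}" and f: "f \<in> bspace (xs @ ys)"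
  shows "\<exists>u\<in>bspace xs. \<exists>v\<in>bspace ys. f = u + v"
  using ys int f
proof (induction ys arbitrary: f rule: rev_induct)
  case Nil
  then show ?case by (intro bexI[of _ f] bexI[of _ 0]) auto
next
  case (snoc y ys)
  then have y: "norm y < 1" and ys: "set ys \<subseteq> unit_disc" by auto
  have sub: "bspace ys \<subseteq> bspace (ys @ [y])" using y ys by (intro bspace_mono1) auto
  have IH: "\<exists>u\<in>bspace xs. \<exists>v\<in>bspace ys. f = u + v" if "f \<in> bspace (xs @ ys)" for f
    using snoc.IH[OF ys _ that] snoc.prems(2) sub by blast
  let ?e = "h2_mult (blaschke_prod (xs @ ys)) (h2_kernel y)"
  let ?e' = "h2_mult (blaschke_prod ys) (h2_kernel y)"
  have dec: "\<exists>c. \<exists>s\<in>bspace (xs @ ys). f = s + h2_scale c ?e" if "f \<in> bspace (xs @ ys @ [y])" for f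
    using bspace_snoc_decomp[of y "xs @ ys" f] y xs ys that by simp
  have "h2_kernel y \<in> bspace [y]" using y by (intro h2_kernel_in_bspace) auto
  then have e': "?e' \<in> bspace (ys @ [y])" using bspace_mult[of ys "[y]"] y ys by simp
  then have "?e' \<in> bspace (xs @ ys @ [y])" using bspace_mono2[of xs "ys @ [y]"] y xs ys by auto
  then obtain c s where s: "s \<in> bspace (xs @ ys)" "?e' = s + h2_scale c ?e" using dec by blast
  \<comment> \<open>If \<open>?e'\<close> had no component along \<open>?e\<close>, it would lie in
    the sum already obtained; the trivial intersection would then force it into
    \<open>bspace ys\<close>, which contains no nonzero multiple of its own product.\<close>
  have "c \<noteq> 0"
  proof
    assume "c = 0"
    then have "?e' \<in> bspace (xs @ ys)" using s by simp
    then obtain u v where uv: "u \<in> bspace xs" "v \<in> bspace ys" "?e' = u + v" using IH by blast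
    then have "u = ?e' - v" by simp
    then have "u \<in> bspace (ys @ [y])" using e' sub uv by (metis bspace_diff subsetD)
    then have "u = 0" using uv(1) snoc.prems(2) by auto
    then have "?e' \<in> bspace ys" using uv by simp
    then have "h2_kernel y = 0"
      using bspace_inter_mult norm_h2_blaschke[OF ys] by (metis norm_eq_zero)
    then show False using h2_kernel_nonzero[OF y] by simp
  qed
  obtain d t where t: "t \<in> bspace (xs @ ys)" "f = t + h2_scale d ?e" using dec[OF snoc.prems(3)[simplified]] by blast
  \<comment> \<open>As \<open>c\<close> is nonzero, the direction \<open>?e\<close> can be exchanged
    for \<open>?e'\<close> up to vectors of the old space.\<close>
  have "?e' - s = h2_scale c ?e"
    using s(2) by simp
  then have "h2_scale (d / c) (?e' - s) = h2_scale d ?e"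
    using \<open>c \<noteq> 0\<close> by simp
  then have f: "f = (t - h2_scale (d / c) s) + h2_scale (d / c) ?e'"
    unfolding t(2) by (simp add: h2.scale_right_diff_distrib algebra_simps)
  have "t - h2_scale (d / c) s \<in> bspace (xs @ ys)"
    by (intro bspace_diff bspace_scale s t)
  then obtain u v where uv: "u \<in> bspace xs" "v \<in> bspace ys" "t - h2_scale (d / c) s = u + v" using IH by blast
  have "v + h2_scale (d / c) ?e' \<in> bspace (ys @ [y])"
    using uv(2) sub e' by (intro bspace_add bspace_scale) auto
  then show ?case using f uv by (metis add.assoc)
qed

text \<open>On the circle the partner of \<open>h\<close> is \<open>B * cnj (z * h)\<close>; the
  equation is multiplied by \<open>z\<close>, which is unimodular there. Induction over the zeros
  shows that the partner is again analytic across the circle and stays in the model space.\<close>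

lemma bspace_conjugation:
  assumes "set xs \<subseteq> unit_disc" "h \<in> bspace xs"
  shows "\<exists>H G g. H analytic_on cball 0 1 \<and> G analytic_on cball 0 1 \<and> g \<in> bspace xs \<and>
    (\<forall>z\<in>unit_disc. h2_fun h z = H z) \<and> (\<forall>z\<in>unit_disc. h2_fun g z = G z) \<and>
    (\<forall>z. norm z = 1 \<longrightarrow> z * G z = blaschke_prod xs z * cnj (H z))"
  using assms
proof (induction xs arbitrary: h)
  case Nil
  then have "h = 0" by (simp add: bspace_Nil)
  then show ?case
    by (intro exI[of _ "\<lambda>_. 0"] exI[of _ 0]) (auto intro: analytic_intros)
next
  case (Cons x xs)
  then have x: "norm x < 1" and xs: "set xs \<subseteq> unit_disc" by auto
  obtain c k where k: "k \<in> bspace xs" "h = h2_scale c (h2_kernel x) + h2_mult (blaschke_prod [x]) k"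
    using bspace_Cons_decomp[OF x xs Cons.prems(2)] by blast
  obtain H G g where IH: "H analytic_on cball 0 1" "G analytic_on cball 0 1" "g \<in> bspace xs"
    "\<And>z. z\<in>unit_disc \<Longrightarrow> h2_fun k z = H z" "\<And>z. z\<in>unit_disc \<Longrightarrow> h2_fun g z = G z"
    "\<And>z. norm z = 1 \<Longrightarrow> z * G z = blaschke_prod xs z * cnj (H z)"
    using Cons.IH[OF xs k(1)] by blast
  note nz = one_minus_cnj_mult_nonzero[OF x]
  \<comment> \<open>On the circle \<open>b_x * cnj k_x = - z * k_x\<close>, so conjugation turns the
    kernel term \<open>c * k_x\<close> into \<open>- cnj c * B * k_x\<close> with \<open>B\<close>
    the product over \<open>xs\<close>; in the other term \<open>b_x * cnj b_x = 1\<close> leaves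
    the partner of \<open>k\<close>.\<close>
  let ?H = "\<lambda>z. c * (1 / (1 - cnj x * z)) + blaschke_factor x z * H z"
  let ?G = "\<lambda>z. - cnj c * (blaschke_prod xs z * (1 / (1 - cnj x * z))) + G z"
  let ?g = "h2_scale (- cnj c) (h2_mult (blaschke_prod xs) (h2_kernel x)) + g"
  show ?case
  proof (rule exI[of _ ?H], rule exI[of _ ?G], rule exI[of _ ?g], intro conjI ballI allI impI)
    show "?H analytic_on cball 0 1"
      using nz IH(1) analytic_blaschke_factor[OF x] by (intro analytic_intros) auto
    show "?G analytic_on cball 0 1"
      using nz IH(2) analytic_blaschke_prod[OF xs] by (intro analytic_intros) auto
    have "h2_kernel x \<in> bspace [x]" using x by (intro h2_kernel_in_bspace) auto
    then have "h2_mult (blaschke_prod xs) (h2_kernel x) \<in> bspace (x # xs)"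
      using bspace_mult'[of "[x]" xs] x xs by simp
    moreover have "g \<in> bspace (x # xs)"
      using bspace_mono2[of "[x]" xs] x xs IH(3) by auto
    ultimately show "?g \<in> bspace (x # xs)"
      by (intro bspace_add bspace_scale)
    show "h2_fun h z = ?H z" if "z \<in> unit_disc" for z
      using that IH(4) x unfolding k(2)
      by (simp add: h2_fun_kernel[OF x] h2_fun_mult[OF bounded_holo_blaschke_prod[of "[x]"]])
    show "h2_fun ?g z = ?G z" if "z \<in> unit_disc" for z
      using that IH(5) by (simp add: h2_fun_kernel[OF x] h2_fun_mult[OF bounded_holo_blaschke_prod[OF xs]])
    show "z * ?G z = blaschke_prod (x # xs) z * cnj (?H z)" if z: "norm z = 1" for z
    proof -
      have zz: "z * cnj z = 1" using z by (simp flip: complex_norm_square)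
      have bb: "blaschke_factor x z * cnj (blaschke_factor x z) = 1"
        using blaschke_factor_norm_eq[OF x z] by (simp flip: complex_norm_square)
      have nz1: "1 - cnj x * z \<noteq> 0" "1 - x * cnj z \<noteq> 0"
      proof -
        show "1 - cnj x * z \<noteq> 0" using nz[of z] z by simp
        then have "cnj (1 - cnj x * z) \<noteq> 0" by (simp only: complex_cnj_zero_iff not_False_eq_True)
        then show "1 - x * cnj z \<noteq> 0" by simp
      qed
      have "(x - z) = - z * (1 - x * cnj z)"
        using zz by (simp add: algebra_simps)
      then have "blaschke_factor x z * (1 / (1 - x * cnj z)) = - z / (1 - cnj x * z)"
        using nz1 by (simp add: blaschke_factor_def)
      moreover have "(b * B) * (c' * q + b' * h') = c' * B * (b * q) + (b * b') * (B * h')"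
        for b B c' q b' h' :: complex
        by (simp add: algebra_simps)
      moreover have "cnj (?H z) = cnj c * (1 / (1 - x * cnj z)) + cnj (blaschke_factor x z) * cnj (H z)"
        by simp
      ultimately have "blaschke_prod (x # xs) z * cnj (?H z) =
        cnj c * blaschke_prod xs z * (- z / (1 - cnj x * z)) + 1 * (z * G z)"
        unfolding bb[symmetric] IH(6)[OF z] blaschke_prod_simps by metis
      then show ?thesis
        by (simp add: algebra_simps)
    qed
  qed
qed

subsection \<open>Inner products on the unit circle\<close>

lemma analytic_cballE:
  assumes "f analytic_on cball 0 1"
  obtains R where "1 < R" "f holomorphic_on ball (0::complex) R"
proof -
  obtain T where T: "open T" "cball 0 1 \<subseteq> T" "f holomorphic_on T"
    using assms by (auto simp: analytic_on_holomorphic)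
  obtain e where "e > 0" "(\<Union>x\<in>cball 0 1. ball x e) \<subseteq> T"
    using compact_subset_open_imp_ball_epsilon_subset[OF compact_cball T(1,2)] by blast
  moreover have "ball (0::complex) (1 + e) \<subseteq> (\<Union>x\<in>cball 0 1. ball x e)"
  proof
    fix z :: complex assume z: "z \<in> ball 0 (1 + e)"
    show "z \<in> (\<Union>x\<in>cball 0 1. ball x e)"
    proof (cases "norm z \<le> 1")
      case True then show ?thesis using \<open>e > 0\<close> by force
    next
      case False
      have "z / of_real (norm z) - z = (z / of_real (norm z)) * of_real (1 - norm z)"
      proof -
        have "z \<noteq> 0" using False by auto
        then show ?thesis by (simp add: field_simps)
      qed
      then have "dist (z / of_real (norm z)) z = cmod (z / of_real (norm z)) * \<bar>1 - norm z\<bar>"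
        by (simp only: dist_norm norm_mult norm_of_real)
      moreover have "cmod (z / of_real (norm z)) = 1" using False by (auto simp: norm_divide)
      ultimately have "dist (z / of_real (norm z)) z = \<bar>1 - norm z\<bar>" by simp
      then show ?thesis using False z
        by (intro UN_I[of "z / of_real (norm z)"]) (auto simp: norm_divide)
    qed
  qed
  ultimately show ?thesis
    using that[of "1 + e"] T(3) holomorphic_on_subset by (meson less_add_same_cancel1 order_trans)
qed

lemma analytic_cballE2:
  assumes "f analytic_on cball 0 1" "g analytic_on cball 0 1"
  obtains R where "1 < R" "f holomorphic_on ball (0::complex) R" "g holomorphic_on ball (0::complex) R"
proof -
  obtain R1 where R1: "1 < R1" "f holomorphic_on ball (0::complex) R1" using analytic_cballE[OF assms(1)] .
  obtain R2 where R2: "1 < R2" "g holomorphic_on ball (0::complex) R2" using analytic_cballE[OF assms(2)] .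
  show ?thesis
    using R1 R2 by (intro that[of "min R1 R2"]) (auto intro: holomorphic_on_subset)
qed

lemma h2_of_analytic:
  assumes "f analytic_on cball 0 1"
  shows h2_fun_of_analytic: "\<And>z. norm z < 1 \<Longrightarrow> h2_fun (h2_of f) z = f z"
    and norm_h2_of_analytic: "(norm (h2_of f))\<^sup>2 = circle_sq 1 f"
proof -
  obtain R where R: "1 < R" "f holomorphic_on ball (0::complex) R" using analytic_cballE[OF assms] .
  have f: "f holomorphic_on unit_disc" using R by (auto intro: holomorphic_on_subset)
  have s: "(\<lambda>k. (cmod (taylor_coeff f k))\<^sup>2) sums circle_sq 1 f"
    using circle_sq_sums[OF R(2), of 1] R by simp
  then have sm: "summable (\<lambda>k. (cmod (taylor_coeff f k))\<^sup>2)" by (simp add: sums_iff)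
  show "\<And>z. norm z < 1 \<Longrightarrow> h2_fun (h2_of f) z = f z"
    using h2_fun_h2_of[OF f sm] .
  show "(norm (h2_of f))\<^sup>2 = circle_sq 1 f"
    using h2_norm_sums[of "h2_of f"] s unfolding hcoeff_h2_of[OF f sm] by (rule sums_unique2)
qed

lemma h2_of_eqI:
  assumes "\<And>z. norm z < 1 \<Longrightarrow> h2_fun h z = f z"
  shows "h2_of f = h"
proof -
  have "(\<lambda>z. if z \<in> unit_disc then f z else 0) = h2_fun h"
    using assms h2_fun_outside[of _ h] by fastforce
  then show ?thesis by (simp add: h2_of_def h2_fun_inverse)
qed

lemma h2_inner_circle:
  assumes F: "F analytic_on cball 0 1" "\<And>z. z \<in> unit_disc \<Longrightarrow> h2_fun f z = F z"
    and G: "G analytic_on cball 0 1" "\<And>z. z \<in> unit_disc \<Longrightarrow> h2_fun g z = G z"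
  shows "h2_inner f g = circle_mean 1 (\<lambda>z. F z * cnj (G z))"
proof -
  obtain R where R: "1 < R" "F holomorphic_on ball (0::complex) R" "G holomorphic_on ball (0::complex) R"
    using analytic_cballE2[OF F(1) G(1)] .
  have "hcoeff f k = taylor_coeff F k" "hcoeff g k = taylor_coeff G k" for k
    using F(2) G(2) by (auto intro!: taylor_coeff_cong[where R = 1])
  then have "(\<lambda>k. hcoeff f k * cnj (hcoeff g k)) sums circle_mean 1 (\<lambda>z. F z * cnj (G z))"
    using circle_parseval[OF R(2,3), of 1] R(1) by simp
  then show ?thesis using h2_inner_sums sums_unique2 by blast
qed

lemma h2_norm_circle:
  assumes F: "F analytic_on cball 0 1" "\<And>z. z \<in> unit_disc \<Longrightarrow> h2_fun f z = F z"
  shows "(norm f)\<^sup>2 = circle_sq 1 F"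
  using norm_h2_of_analytic[OF F(1)] h2_of_eqI[of f F] F(2) by simp

lemma circle_mean_cong:
  assumes "\<And>z. norm z = 1 \<Longrightarrow> F z = G z"
  shows "circle_mean 1 F = circle_mean 1 G"
  unfolding circle_mean_def using assms by (intro integral_cong) simp

lemma circle_sq_cong:
  assumes "\<And>z. norm z = 1 \<Longrightarrow> cmod (F z) = cmod (G z)"
  shows "circle_sq 1 F = circle_sq 1 G"
  unfolding circle_sq_def using assms by (intro integral_cong) simp

subsection \<open>Littlewood--Paley identity\<close>

text \<open>If \<open>u\<close> and \<open>v\<close> have density \<open>2s\<close> on \<open>[0, 1]\<close>, then \<open>(u v)\<^sup>2\<close> has density
  \<open>- ln s\<close>: this area integral is the usual one with weight \<open>ln (1 / |z|\<^sup>2)\<close>, but with a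
  continuous integrand.\<close>

definition area_point :: "real \<times> real \<times> real \<Rightarrow> complex" where
  "area_point p = of_real (fst p * fst (snd p)) * ecirc (snd (snd p))"

definition area_weight :: "real \<times> real \<times> real \<Rightarrow> real" where
  "area_weight p = 4 * fst p * fst (snd p)"

abbreviation unit_box :: "(real \<times> real \<times> real) set" where
  "unit_box \<equiv> cbox (0, 0, 0) (1, 1, 1)"

definition area :: "(complex \<Rightarrow> 'b::banach) \<Rightarrow> 'b" where
  "area F = integral unit_box (\<lambda>p. area_weight p *\<^sub>R F (area_point p))"

lemma unit_box_iff: "p \<in> unit_box \<longleftrightarrow> fst p \<in> {0..1} \<and> fst (snd p) \<in> {0..1} \<and> snd (snd p) \<in> {0..1}"
  by (cases p) (auto simp: cbox_Pair_eq)

lemma area_weight_nonneg: "p \<in> unit_box \<Longrightarrow> 0 \<le> area_weight p"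
  by (auto simp: unit_box_iff area_weight_def)

lemma area_point_le: "p \<in> unit_box \<Longrightarrow> norm (area_point p) \<le> 1"
  by (auto simp: unit_box_iff area_point_def norm_mult intro!: mult_le_one)

lemma continuous_area_point: "continuous_on S area_point"
  unfolding area_point_def[abs_def] by (intro continuous_intros)

lemma continuous_area_weight: "continuous_on S area_weight"
  unfolding area_weight_def[abs_def] by (intro continuous_intros)

lemma area_integrable:
  fixes F :: "complex \<Rightarrow> 'b::banach"
  assumes "continuous_on (cball 0 1) F"
  shows "(\<lambda>p. area_weight p *\<^sub>R F (area_point p)) integrable_on unit_box"
proof -
  have "continuous_on unit_box (\<lambda>p. F (area_point p))"
    by (rule continuous_on_compose2[OF assms continuous_area_point]) (use area_point_le in auto)
  then show ?thesis
    by (intro integrable_continuous continuous_intros continuous_area_weight)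
qed

lemma area_add:
  assumes "continuous_on (cball 0 1) F" "continuous_on (cball 0 1) G"
  shows "area (\<lambda>z. F z + G z) = area F + area G"
  unfolding area_def scaleR_add_right
  by (rule integral_add[OF area_integrable[OF assms(1)] area_integrable[OF assms(2)]])

lemma area_cmult: "area (\<lambda>z. c * F z) = c * area (F :: complex \<Rightarrow> real)"
  unfolding area_def integral_mult_right[symmetric] by (simp add: mult_ac)

lemma area_sum:
  assumes "finite A" "\<And>i. i \<in> A \<Longrightarrow> continuous_on (cball 0 1) (F i)"
  shows "area (\<lambda>z. \<Sum>i\<in>A. F i z) = (\<Sum>i\<in>A. area (F i))"
  unfolding area_def scaleR_sum_right
  by (rule integral_sum) (use assms area_integrable in auto)

lemma area_mono:
  fixes F G :: "complex \<Rightarrow> real"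
  assumes "continuous_on (cball 0 1) F" "continuous_on (cball 0 1) G"
    and "\<And>z. norm z \<le> 1 \<Longrightarrow> F z \<le> G z"
  shows "area F \<le> area G"
  unfolding area_def
  by (rule integral_le[OF area_integrable[OF assms(1)] area_integrable[OF assms(2)]])
    (use assms(3) area_point_le area_weight_nonneg in \<open>auto intro!: mult_left_mono\<close>)

lemma norm_area_le:
  assumes "continuous_on (cball 0 1) F"
  shows "norm (area F) \<le> area (\<lambda>z. norm (F z))"
  unfolding area_def
proof (rule integral_norm_bound_integral[OF area_integrable[OF assms] area_integrable])
  show "norm (area_weight p *\<^sub>R F (area_point p)) \<le> area_weight p *\<^sub>R norm (F (area_point p))"
    if "p \<in> unit_box" for p
    using area_weight_nonneg[OF that] by simp
qed (use assms in \<open>intro continuous_intros\<close>)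

lemma integral_odd_power: "integral {0..1} (\<lambda>u::real. 2 * u ^ (2 * k + 1)) = 1 / (k + 1)"
proof -
  have "((\<lambda>u. u ^ Suc (2 * k + 1) / (real k + 1)) has_real_derivative 2 * u ^ (2 * k + 1)) (at u within {0..1})" for u :: real
  proof -
    have "real (Suc (2 * k + 1)) * v / (real k + 1) = 2 * v" for v
      by (simp add: field_simps)
    then have "real (Suc (2 * k + 1)) * u ^ (Suc (2 * k + 1) - Suc 0) / (real k + 1) = 2 * u ^ (2 * k + 1)"
      by (simp only: diff_Suc_Suc diff_zero)
    then show ?thesis
      using DERIV_cdivide[OF DERIV_pow[of "Suc (2 * k + 1)" u "{0..1}"], of "real k + 1"] by metis
  qed
  then have "((\<lambda>u. 2 * u ^ (2 * k + 1)) has_integral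
      (1 ^ Suc (2 * k + 1) / (real k + 1) - 0 ^ Suc (2 * k + 1) / (real k + 1))) {0..1::real}"
    by (intro fundamental_theorem_of_calculus)
      (simp_all add: has_real_derivative_iff_has_vector_derivative)
  from integral_unique[OF this] show ?thesis by simp
qed

text \<open>The \<open>u\<close>-integral and the \<open>v\<close>-integral contribute
  \<open>1 / (k + 1)\<close> each. Their product cancels the two factors \<open>k + 1\<close> that
  differentiation puts on a pair of coefficients.\<close>

lemma area_moment:
  "integral unit_box (\<lambda>p. of_real (area_weight p) * (area_point p ^ j * cnj (area_point p ^ k))) =
    (if j = k then of_real (1 / (real k + 1)\<^sup>2) else 0)"
proof -
  let ?f = "\<lambda>p. of_real (area_weight p) * (area_point p ^ j * cnj (area_point p ^ k))"
  let ?w = "\<lambda>u::real. of_real (2 * u ^ (j + k + 1)) :: complex"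
  have eq: "?f (u, v, t) = (?w u * ?w v) * (ecirc t ^ j * cnj (ecirc t ^ k))" for u v t
    by (simp add: area_weight_def area_point_def power_mult_distrib power_add mult_ac)
  have c1: "continuous_on (cbox (0, 0, 0) (1, 1, 1)) ?f"
    by (intro continuous_intros continuous_area_point continuous_area_weight)
  have c2: "continuous_on (cbox (0, 0) (1, 1)) (\<lambda>y. ?f (u, y))" for u
    unfolding area_point_def area_weight_def by (intro continuous_intros)
  have inner: "integral {0..1} (\<lambda>t. ?f (u, v, t)) = (?w u * ?w v) * (if j = k then 1 else 0)" for u v
    by (simp only: eq integral_mult_right integral_ecirc_power)
  let ?d = "if j = k then 1 else 0 :: complex"
  have "integral unit_box ?f = integral (cbox 0 1) (\<lambda>u. integral (cbox 0 1) (\<lambda>v. integral (cbox 0 1) (\<lambda>t. ?f (u, v, t))))"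
    using integral_prod_continuous[OF c1] integral_prod_continuous[OF c2] by simp
  also have "\<dots> = integral {0..1} (\<lambda>u. integral {0..1} (\<lambda>v. (?w u * ?w v) * ?d))"
    by (simp only: inner box_real)
  also have "\<dots> = integral {0..1} (\<lambda>u. ?w u * (integral {0..1} ?w * ?d))"
    by (simp only: mult.assoc integral_mult_right integral_mult_left)
  also have "\<dots> = integral {0..1} ?w * (integral {0..1} ?w * ?d)"
    by (rule integral_mult_left)
  also have "\<dots> = (if j = k then of_real (1 / (real k + 1)\<^sup>2) else 0)"
  proof (cases "j = k")
    case True
    have "integral {0..1} ?w = of_real (1 / (real k + 1))"
    proof -
      have "(\<lambda>u. 2 * u ^ (2 * k + 1)) integrable_on {0..1::real}"
        by (intro integrable_continuous_real continuous_intros)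
      from integral_linear[OF this bounded_linear_of_real[where 'a = complex]]
      have "integral {0..1} (\<lambda>u. complex_of_real (2 * u ^ (2 * k + 1))) = of_real (1 / (real k + 1))"
        unfolding integral_odd_power o_def by simp
      moreover have "j + k = 2 * k" using True by simp
      ultimately show ?thesis by (simp only:)
    qed
    then show ?thesis using True by (simp add: power2_eq_square)
  qed simp
  finally show ?thesis .
qed

lemma taylor_coeff_deriv:
  assumes "f holomorphic_on ball 0 R" "R > 0"
  shows "taylor_coeff (deriv f) k = of_nat (k + 1) * taylor_coeff f (k + 1)"
  using taylor_coeff_eqI[OF has_fps_expansion_deriv[OF holomorphic_has_fps_expansion[OF assms]], of k]
  by simp

text \<open>The polarised Littlewood--Paley identity. Differentiation shifts the coefficients by
  one, so the area term accounts for all of them except the constant one.\<close>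

lemma area_pairing:
  assumes F: "F analytic_on cball 0 1" and G: "G analytic_on cball 0 1"
  shows "circle_mean 1 (\<lambda>z. F z * cnj (G z)) = F 0 * cnj (G 0) + area (\<lambda>z. deriv F z * cnj (deriv G z))"
proof -
  obtain R where R: "1 < R" "F holomorphic_on ball (0::complex) R" "G holomorphic_on ball (0::complex) R"
    using analytic_cballE2[OF F G] .
  have "(\<lambda>k. taylor_coeff (deriv F) k * cnj (taylor_coeff (deriv G) k) * of_real (1 / (real k + 1)\<^sup>2)) sums
    integral unit_box (\<lambda>p. of_real (area_weight p) * (deriv F (area_point p) * cnj (deriv G (area_point p))))"
    by (rule box_parseval[where r = 1 and R = R])
      (use R area_point_le area_moment in \<open>auto intro!: continuous_area_point continuous_area_weight holomorphic_deriv simp del: complex_cnj_power\<close>)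
  also have "(\<lambda>k. taylor_coeff (deriv F) k * cnj (taylor_coeff (deriv G) k) * of_real (1 / (real k + 1)\<^sup>2)) =
    (\<lambda>k. taylor_coeff F (Suc k) * cnj (taylor_coeff G (Suc k)))"
  proof
    fix k
    have "of_nat (k + 1) \<noteq> (0::complex)" by (simp only: of_nat_eq_0_iff)
    moreover have "of_real (1 / (real k + 1)\<^sup>2) = 1 / (of_nat (k + 1) * of_nat (k + 1) :: complex)"
      by (simp add: power2_eq_square add.commute)
    moreover have "taylor_coeff (deriv F) k = of_nat (k + 1) * taylor_coeff F (k + 1)"
      "taylor_coeff (deriv G) k = of_nat (k + 1) * taylor_coeff G (k + 1)"
      using R taylor_coeff_deriv[of _ R k] by auto
    ultimately show "taylor_coeff (deriv F) k * cnj (taylor_coeff (deriv G) k) * of_real (1 / (real k + 1)\<^sup>2) =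
      taylor_coeff F (Suc k) * cnj (taylor_coeff G (Suc k))"
      by (simp del: of_nat_Suc of_nat_add add: field_simps)
  qed
  also have "integral unit_box (\<lambda>p. of_real (area_weight p) * (deriv F (area_point p) * cnj (deriv G (area_point p)))) =
    area (\<lambda>z. deriv F z * cnj (deriv G z))"
    by (simp add: area_def scaleR_conv_of_real)
  finally have "(\<lambda>k. taylor_coeff F k * cnj (taylor_coeff G k)) sums
      (area (\<lambda>z. deriv F z * cnj (deriv G z)) + taylor_coeff F 0 * cnj (taylor_coeff G 0))"
    by (rule sums_Suc)
  moreover have "(\<lambda>k. taylor_coeff F k * cnj (taylor_coeff G k)) sums circle_mean 1 (\<lambda>z. F z * cnj (G z))"
    using circle_parseval[OF R(2,3), of 1] R(1) by simp
  ultimately show ?thesis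
    using sums_unique2 by (fastforce simp: fps_expansion_def add.commute)
qed

lemma continuous_analytic [continuous_intros]:
  "f analytic_on cball 0 1 \<Longrightarrow> continuous_on (cball 0 1) f"
  by (intro holomorphic_on_imp_continuous_on analytic_imp_holomorphic)

lemma area_deriv_le:
  assumes F: "F analytic_on cball 0 1"
  shows "area (\<lambda>z. (cmod (deriv F z))\<^sup>2) \<le> circle_sq 1 F"
proof -
  have h: "h2_fun (h2_of F) z = F z" if "z \<in> unit_disc" for z
    using h2_fun_of_analytic[OF F] that by simp
  have "of_real (circle_sq 1 F) = circle_mean 1 (\<lambda>z. F z * cnj (F z))"
    using h2_inner_circle[OF F h F h] h2_inner_self_norm[of "h2_of F"] norm_h2_of_analytic[OF F] by simp
  also have "\<dots> = F 0 * cnj (F 0) + area (\<lambda>z. deriv F z * cnj (deriv F z))"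
    by (rule area_pairing[OF F F])
  also have "area (\<lambda>z. deriv F z * cnj (deriv F z)) = area (\<lambda>z. complex_of_real ((cmod (deriv F z))\<^sup>2))"
    by (simp only: complex_norm_square)
  also have "\<dots> = of_real (area (\<lambda>z. (cmod (deriv F z))\<^sup>2))"
  proof -
    have "continuous_on (cball 0 1) (\<lambda>z. (cmod (deriv F z))\<^sup>2)"
      by (intro continuous_intros analytic_deriv F)
    from integral_linear[OF area_integrable[OF this] bounded_linear_of_real[where 'a = complex]]
    show ?thesis by (simp add: area_def o_def scaleR_conv_of_real)
  qed
  also have "F 0 * cnj (F 0) = of_real ((cmod (F 0))\<^sup>2)"
    by (simp only: complex_norm_square)
  finally have "circle_sq 1 F = (cmod (F 0))\<^sup>2 + area (\<lambda>z. (cmod (deriv F z))\<^sup>2)"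
    by (simp only: of_real_eq_iff flip: of_real_add)
  then show ?thesis by simp
qed

subsection \<open>A Carleson embedding\<close>

text \<open>For a list of values \<open>(b z, b' z)\<close>, \<open>product_energy\<close> is the sum of \<open>|(b\<^sub>S f)'|\<^sup>2\<close> over all
  subproducts \<open>b\<^sub>S\<close>, where \<open>V = f z\<close> and \<open>D = f' z\<close>.\<close>

fun product_energy :: "(complex \<times> complex) list \<Rightarrow> complex \<Rightarrow> complex \<Rightarrow> real" where
  "product_energy [] V D = (cmod D)\<^sup>2"
| "product_energy ((b, b') # ps) V D = product_energy ps V D + product_energy ps (b * V) (b * D + b' * V)"

text \<open>The ratio of the energy at \<open>V = 0\<close> to \<open>|D|^2\<close>.\<close>

definition product_weight :: "(complex \<times> complex) list \<Rightarrow> real" where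
  "product_weight ps = (\<Prod>(b, b')\<leftarrow>ps. 1 + (cmod b)\<^sup>2)"

lemma product_weight_simps [simp]:
  "product_weight [] = 1"
  "product_weight ((b, b') # ps) = (1 + (cmod b)\<^sup>2) * product_weight ps"
  by (simp_all add: product_weight_def)

lemma product_weight_nonneg: "0 \<le> product_weight ps"
  by (induction ps) auto

text \<open>Completing the square: the left side is quadratic in \<open>D\<close> with leading
  coefficient \<open>1 + |b|^2\<close>. Squared moduli are written as \<open>w * cnj w\<close>,
  which makes the claim an algebraic identity over the complex numbers.\<close>

lemma energy_step:
  "(cmod D)\<^sup>2 + (cmod (b * D + b' * V))\<^sup>2 =
    (1 + (cmod b)\<^sup>2) * ((cmod (D + cnj b * b' / of_real (1 + (cmod b)\<^sup>2) * V))\<^sup>2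
      + (cmod b')\<^sup>2 / (1 + (cmod b)\<^sup>2)\<^sup>2 * (cmod V)\<^sup>2)"
proof -
  let ?s = "1 + (cmod b)\<^sup>2"
  have s: "?s > 0" by (simp add: add_pos_nonneg)
  have "complex_of_real ((cmod D)\<^sup>2 + (cmod (b * D + b' * V))\<^sup>2) = complex_of_real
    (?s * ((cmod (D + cnj b * b' / of_real ?s * V))\<^sup>2 + (cmod b')\<^sup>2 / ?s\<^sup>2 * (cmod V)\<^sup>2))"
  proof -
    define S where "S = complex_of_real ?s"
    have S: "S \<noteq> 0" "cnj S = S" using s
      by (auto simp: S_def simp del: of_real_add)
    have S': "b * cnj b = S - 1"
      unfolding complex_norm_square[symmetric] S_def by simp
    have l: "complex_of_real ((cmod D)\<^sup>2 + (cmod (b * D + b' * V))\<^sup>2) =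
      D * cnj D + (b * D + b' * V) * cnj (b * D + b' * V)"
      by (simp only: of_real_add complex_norm_square)
    have r: "complex_of_real (?s * ((cmod (D + cnj b * b' / S * V))\<^sup>2 + (cmod b')\<^sup>2 / ?s\<^sup>2 * (cmod V)\<^sup>2)) =
      S * ((D + cnj b * b' / S * V) * cnj (D + cnj b * b' / S * V) + (b' * cnj b') / (S * S) * (V * cnj V))"
      unfolding of_real_mult of_real_add of_real_divide complex_norm_square power2_eq_square[of ?s]
      unfolding of_real_mult[of ?s] S_def by (simp only: of_real_add complex_norm_square)
    have "S * ((D + cnj b * b' / S * V) * cnj (D + cnj b * b' / S * V) + (b' * cnj b') / (S * S) * (V * cnj V))
      = S * D * cnj D + cnj b * b' * V * cnj D + b * cnj b' * cnj V * D
        + ((b * cnj b) + 1) * b' * cnj b' * V * cnj V / S"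
      using S(1) by (simp add: S(2) field_simps)
    also have "\<dots> = (b * cnj b + 1) * D * cnj D + cnj b * b' * V * cnj D + b * cnj b' * cnj V * D + b' * cnj b' * V * cnj V"
      using S(1) by (simp add: S')
    also have "\<dots> = D * cnj D + (b * D + b' * V) * cnj (b * D + b' * V)"
      by (simp add: algebra_simps)
    finally show ?thesis unfolding l S_def[symmetric] r by simp
  qed
  then show ?thesis by (simp only: of_real_eq_iff)
qed

text \<open>Both halves of the recursion have the same completed-square form with the same shift
  \<open>c\<close>, since \<open>b * D + b' * V + c * (b * V) = b * (D + c * V) + b' * V\<close>;
  applying \<open>energy_step\<close> to \<open>D + c * V\<close> merges them. The shift is left
  existential because only the sign of the square is used afterwards.\<close>

lemma product_energy_eq:
  "\<exists>c. \<forall>V D. product_energy ps V D = product_weight ps *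
    ((cmod (D + c * V))\<^sup>2 + (\<Sum>(b, b')\<leftarrow>ps. (cmod b')\<^sup>2 / (1 + (cmod b)\<^sup>2)\<^sup>2) * (cmod V)\<^sup>2)"
proof (induction ps)
  case Nil
  show ?case by (intro exI[of _ 0]) simp
next
  case (Cons p ps)
  obtain b b' where p: "p = (b, b')" by (cases p)
  let ?K = "\<Sum>(b, b')\<leftarrow>ps. (cmod b')\<^sup>2 / (1 + (cmod b)\<^sup>2)\<^sup>2"
  obtain c where c: "\<And>V D. product_energy ps V D = product_weight ps *
    ((cmod (D + c * V))\<^sup>2 + ?K * (cmod V)\<^sup>2)"
    using Cons.IH by blast
  let ?c = "c + cnj b * b' / of_real (1 + (cmod b)\<^sup>2)"
  show ?case
  proof (intro exI[of _ ?c] allI)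
    fix V D
    have "product_energy (p # ps) V D = product_weight ps *
      (((cmod (D + c * V))\<^sup>2 + (cmod (b * (D + c * V) + b' * V))\<^sup>2) + ?K * (1 + (cmod b)\<^sup>2) * (cmod V)\<^sup>2)"
      unfolding p product_energy.simps c
      by (simp add: algebra_simps norm_mult power_mult_distrib)
    also have "\<dots> = product_weight (p # ps) *
       ((cmod (D + ?c * V))\<^sup>2 + (\<Sum>(b, b')\<leftarrow>p # ps. (cmod b')\<^sup>2 / (1 + (cmod b)\<^sup>2)\<^sup>2) * (cmod V)\<^sup>2)"
      unfolding energy_step p by (simp add: algebra_simps)
    finally show "product_energy (p # ps) V D = product_weight (p # ps) *
       ((cmod (D + ?c * V))\<^sup>2 + (\<Sum>(b, b')\<leftarrow>p # ps. (cmod b')\<^sup>2 / (1 + (cmod b)\<^sup>2)\<^sup>2) * (cmod V)\<^sup>2)" .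
  qed
qed

text \<open>The completed square is dropped, and \<open>|b| \<le> 1\<close> makes each denominator
  at most 4.\<close>

lemma product_energy_ge:
  assumes "\<And>b b'. (b, b') \<in> set ps \<Longrightarrow> cmod b \<le> 1"
  shows "product_weight ps / 4 * ((cmod V)\<^sup>2 * (\<Sum>(b, b')\<leftarrow>ps. (cmod b')\<^sup>2)) \<le> product_energy ps V D"
proof -
  let ?K = "\<Sum>(b, b')\<leftarrow>ps. (cmod b')\<^sup>2 / (1 + (cmod b)\<^sup>2)\<^sup>2"
  obtain c where c: "product_energy ps V D = product_weight ps * ((cmod (D + c * V))\<^sup>2 + ?K * (cmod V)\<^sup>2)"
    using product_energy_eq by blast
  have "(\<Sum>(b, b')\<leftarrow>ps. (cmod b')\<^sup>2) / 4 \<le> ?K"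
    using assms
  proof (induction ps)
    case (Cons p ps)
    obtain b b' where p: "p = (b, b')" by (cases p)
    have "(1 + (cmod b)\<^sup>2)\<^sup>2 \<le> 2\<^sup>2"
      using Cons.prems[of b b'] p by (intro power_mono) (auto simp: abs_square_le_1)
    then have "(cmod b')\<^sup>2 / 4 \<le> (cmod b')\<^sup>2 / (1 + (cmod b)\<^sup>2)\<^sup>2"
      using add_pos_nonneg[of 1 "(cmod b)\<^sup>2"] by (intro divide_left_mono) auto
    moreover have "(\<Sum>(b, b')\<leftarrow>ps. (cmod b')\<^sup>2) / 4 \<le> (\<Sum>(b, b')\<leftarrow>ps. (cmod b')\<^sup>2 / (1 + (cmod b)\<^sup>2)\<^sup>2)"
      using Cons.prems by (intro Cons.IH) auto
    moreover have "(\<Sum>(b, b')\<leftarrow>p # ps. (cmod b')\<^sup>2) / 4 = (cmod b')\<^sup>2 / 4 + (\<Sum>(b, b')\<leftarrow>ps. (cmod b')\<^sup>2) / 4"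
      by (simp add: p add_divide_distrib)
    ultimately show ?case
      using add_mono by (simp only: p list.map sum_list.Cons prod.case)
  qed simp
  then have "(\<Sum>(b, b')\<leftarrow>ps. (cmod b')\<^sup>2) / 4 * (cmod V)\<^sup>2 \<le> (cmod (D + c * V))\<^sup>2 + ?K * (cmod V)\<^sup>2"
    using mult_right_mono[of _ ?K "(cmod V)\<^sup>2"] by (smt (verit) zero_le_power2)
  then show ?thesis
    unfolding c using mult_left_mono[OF _ product_weight_nonneg[of ps]] by (fastforce simp: mult_ac)
qed

lemma continuous_product_energy:
  assumes "continuous_on S V" "continuous_on S D"
    and "\<And>b. b \<in> set bs \<Longrightarrow> continuous_on S b \<and> continuous_on S (deriv b)"
  shows "continuous_on S (\<lambda>z. product_energy (map (\<lambda>b. (b z, deriv b z)) bs) (V z) (D z))"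
  using assms
proof (induction bs arbitrary: V D)
  case (Cons b bs)
  have "continuous_on S (\<lambda>z. b z * V z)" "continuous_on S (\<lambda>z. b z * D z + deriv b z * V z)"
    using Cons.prems by (auto intro!: continuous_intros)
  from Cons.IH[OF this] Cons.IH[OF Cons.prems(1,2)] Cons.prems(3) show ?case
    by (auto intro!: continuous_intros)
qed (auto intro!: continuous_intros)

text \<open>Every subproduct is unimodular on the circle, so each of the
  \<open>2 ^ length bs\<close> functions in the energy has the circle norm of \<open>f\<close>, and
  the Littlewood--Paley bound applies to each.\<close>

lemma area_product_energy_le:
  assumes "\<And>b. b \<in> set bs \<Longrightarrow> b analytic_on cball 0 1 \<and> (\<forall>z. norm z = 1 \<longrightarrow> cmod (b z) = 1)"
    and "f analytic_on cball 0 1"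
  shows "area (\<lambda>z. product_energy (map (\<lambda>b. (b z, deriv b z)) bs) (f z) (deriv f z)) \<le>
    2 ^ length bs * circle_sq 1 f"
  using assms
proof (induction bs arbitrary: f)
  case Nil
  then show ?case using area_deriv_le by simp
next
  case (Cons b bs)
  note f = Cons.prems(2)
  have b: "b analytic_on cball 0 1" "\<And>z. norm z = 1 \<Longrightarrow> cmod (b z) = 1"
    using Cons.prems(1)[of b] by auto
  have bs: "\<And>b. b \<in> set bs \<Longrightarrow> b analytic_on cball 0 1 \<and> (\<forall>z. norm z = 1 \<longrightarrow> cmod (b z) = 1)"
    using Cons.prems(1) by auto
  have bf: "(\<lambda>z. b z * f z) analytic_on cball 0 1"
    using b f by (intro analytic_intros)
  have d: "deriv (\<lambda>z. b z * f z) z = b z * deriv f z + deriv b z * f z" if "norm z \<le> 1" for z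
    using b(1) f that by (subst deriv_mult) (auto simp: analytic_on_imp_differentiable_at algebra_simps)
  let ?P = "\<lambda>f z. product_energy (map (\<lambda>b. (b z, deriv b z)) bs) (f z) (deriv f z)"
  have c: "continuous_on (cball 0 1) (?P g)" if "g analytic_on cball 0 1" for g
    using that bs by (intro continuous_product_energy) (auto intro!: continuous_intros analytic_deriv)
  have "area (\<lambda>z. product_energy (map (\<lambda>b. (b z, deriv b z)) (b # bs)) (f z) (deriv f z)) =
    area (\<lambda>z. ?P f z + ?P (\<lambda>z. b z * f z) z)"
    unfolding area_def using d area_point_le by (intro integral_cong) simp
  also have "\<dots> = area (?P f) + area (?P (\<lambda>z. b z * f z))"
    by (rule area_add[OF c[OF f] c[OF bf]])
  also have "\<dots> \<le> 2 ^ length bs * circle_sq 1 f + 2 ^ length bs * circle_sq 1 (\<lambda>z. b z * f z)"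
    by (rule add_mono[OF Cons.IH[OF bs f] Cons.IH[OF bs bf]])
  also have "circle_sq 1 (\<lambda>z. b z * f z) = circle_sq 1 f"
    by (rule circle_sq_cong) (simp add: norm_mult b)
  also have "2 ^ length bs * circle_sq 1 f + 2 ^ length bs * circle_sq 1 f = 2 ^ length (b # bs) * circle_sq 1 f"
    by simp
  finally show ?case .
qed

text \<open>The energy is at least \<open>k * 2^N / 4\<close> times the integrand, and its integral
  is at most \<open>2^N\<close> times the squared circle norm of \<open>f\<close>. The powers of 2
  cancel, and the constant does not depend on the number \<open>N\<close> of functions.\<close>

lemma carleson_embedding:
  assumes bs: "\<And>b. b \<in> set bs \<Longrightarrow> b analytic_on cball 0 1 \<and> (\<forall>z. norm z = 1 \<longrightarrow> cmod (b z) = 1) \<and>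
      (\<forall>z. norm z \<le> 1 \<longrightarrow> cmod (b z) \<le> 1)"
    and f: "f analytic_on cball 0 1" and k: "0 < k"
    and W: "\<And>z. norm z \<le> 1 \<Longrightarrow> k * 2 ^ length bs \<le> (\<Prod>b\<leftarrow>bs. 1 + (cmod (b z))\<^sup>2)"
  shows "area (\<lambda>z. (cmod (f z))\<^sup>2 * (\<Sum>b\<leftarrow>bs. (cmod (deriv b z))\<^sup>2)) \<le> 4 / k * circle_sq 1 f"
proof -
  let ?N = "2 ^ length bs :: real"
  let ?F = "\<lambda>z. (cmod (f z))\<^sup>2 * (\<Sum>b\<leftarrow>bs. (cmod (deriv b z))\<^sup>2)"
  let ?ps = "\<lambda>z. map (\<lambda>b. (b z, deriv b z)) bs"
  have csum: "continuous_on (cball 0 1) (\<lambda>z. \<Sum>b\<leftarrow>bs. (cmod (deriv b z))\<^sup>2)"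
    using bs by (induction bs) (auto intro!: continuous_intros analytic_deriv)
  then have cF: "continuous_on (cball 0 1) ?F"
    using f by (intro continuous_intros)
  have cE: "continuous_on (cball 0 1) (\<lambda>z. product_energy (?ps z) (f z) (deriv f z))"
    using bs f by (intro continuous_product_energy) (auto intro!: continuous_intros analytic_deriv)
  have "k * ?N / 4 * area ?F = area (\<lambda>z. k * ?N / 4 * ?F z)"
    by (rule area_cmult[symmetric])
  also have "\<dots> \<le> area (\<lambda>z. product_energy (?ps z) (f z) (deriv f z))"
  proof (rule area_mono[OF _ cE])
    show "continuous_on (cball 0 1) (\<lambda>z. k * ?N / 4 * ?F z)"
      by (intro continuous_on_mult[OF continuous_on_const cF])
    fix z :: complex assume z: "norm z \<le> 1"
    have "0 \<le> ?F z" by (intro mult_nonneg_nonneg sum_list_nonneg) auto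
    moreover have "product_weight (?ps z) = (\<Prod>b\<leftarrow>bs. 1 + (cmod (b z))\<^sup>2)"
      by (simp add: product_weight_def o_def)
    ultimately have "k * ?N / 4 * ?F z \<le> product_weight (?ps z) / 4 * ?F z"
      using W[OF z] by (intro mult_right_mono) auto
    also have "\<dots> \<le> product_energy (?ps z) (f z) (deriv f z)"
      using product_energy_ge[of "?ps z" "f z" "deriv f z"] bs z by (auto simp: o_def)
    finally show "k * ?N / 4 * ?F z \<le> product_energy (?ps z) (f z) (deriv f z)" .
  qed
  also have "\<dots> \<le> ?N * circle_sq 1 f"
    using bs f by (intro area_product_energy_le) auto
  finally have "?N * (k / 4 * area ?F) \<le> ?N * circle_sq 1 f" by (simp add: mult_ac)
  then have "k / 4 * area ?F \<le> circle_sq 1 f"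
    by (rule mult_left_le_imp_le) simp
  then show ?thesis using k by (simp add: field_simps)
qed

subsection \<open>Riesz bounds for finitely many model spaces\<close>

lemma mset_concat_remove1:
  assumes "x \<in> set L"
  shows "mset (concat (map f L)) = mset (f x @ concat (map f (remove1 x L)))"
  using sum_list_map_remove1[OF assms, of "\<lambda>x. mset (f x)"] by (simp add: mset_concat o_def)

lemma blaschke_prod_mset: "mset xs = mset ys \<Longrightarrow> blaschke_prod xs = blaschke_prod ys"
  unfolding blaschke_prod_def by (intro ext) (metis mset_map prod_mset_prod_list)

lemma cmod_sum_power2_le:
  "(\<Sum>i\<in>A. p i * q i)\<^sup>2 \<le> (\<Sum>i\<in>A. (p i)\<^sup>2) * (\<Sum>i\<in>A. (q i :: real)\<^sup>2)"
  by (rule Cauchy_Schwarz_ineq_sum)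

lemma unit_cnj: "cmod z = 1 \<Longrightarrow> z * cnj z = 1"
  by (simp flip: complex_norm_square)

text \<open>\<open>H\<close> and \<open>G\<close> are the extensions of \<open>h\<close> and
  \<open>g\<close> across the circle, and \<open>g\<close> is the conjugate
  \<open>B * cnj (z * h)\<close> of \<open>h\<close>.\<close>

definition conjugate_pair ::
  "complex list \<Rightarrow> hardy2 \<Rightarrow> (complex \<Rightarrow> complex) \<Rightarrow> hardy2 \<Rightarrow> (complex \<Rightarrow> complex) \<Rightarrow> bool" where
  "conjugate_pair xs h H g G \<longleftrightarrow> g \<in> bspace xs \<and>
    H analytic_on cball 0 1 \<and> (\<forall>z\<in>unit_disc. h2_fun h z = H z) \<and>
    G analytic_on cball 0 1 \<and> (\<forall>z\<in>unit_disc. h2_fun g z = G z) \<and>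
    (\<forall>z. norm z = 1 \<longrightarrow> z * G z = blaschke_prod xs z * cnj (H z))"

lemma conjugate_pair_exists:
  assumes "set xs \<subseteq> unit_disc" "h \<in> bspace xs"
  shows "\<exists>H g G. conjugate_pair xs h H g G"
  using bspace_conjugation[OF assms] unfolding conjugate_pair_def by blast

text \<open>Every factor in \<open>weight\<close> is at most 2 on the closed disc, so
  \<open>2 ^ N\<close> is the largest value the product can have and \<open>\<kappa>\<close>
  measures the loss; it will be supplied with a value independent of \<open>N\<close>.\<close>

locale blaschke_family =
  fixes xs :: "nat \<Rightarrow> complex list" and N :: nat and \<kappa> :: real
  assumes xs: "\<And>n. set (xs n) \<subseteq> unit_disc" and \<kappa>: "0 < \<kappa>"
    and weight: "\<And>z. norm z \<le> 1 \<Longrightarrow> \<kappa> * 2 ^ N \<le> (\<Prod>n<N. 1 + (cmod (blaschke_prod (xs n) z))\<^sup>2)"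
begin

abbreviation B :: "nat \<Rightarrow> complex \<Rightarrow> complex" where "B n \<equiv> blaschke_prod (xs n)"

definition carleson_const :: real where "carleson_const = 4 / \<kappa>"

lemma carleson_pos: "0 < carleson_const"
  using \<kappa> by (simp add: carleson_const_def)

lemma B_analytic: "B n analytic_on cball 0 1"
  by (rule analytic_blaschke_prod[OF xs])

lemma carleson:
  assumes "f analytic_on cball 0 1"
  shows "area (\<lambda>z. (cmod (f z))\<^sup>2 * (\<Sum>n<N. (cmod (deriv (B n) z))\<^sup>2)) \<le> carleson_const * circle_sq 1 f"
proof -
  let ?bs = "map B [0..<N]"
  have "area (\<lambda>z. (cmod (f z))\<^sup>2 * (\<Sum>b\<leftarrow>?bs. (cmod (deriv b z))\<^sup>2)) \<le> 4 / \<kappa> * circle_sq 1 f"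
  proof (rule carleson_embedding[OF _ assms \<kappa>])
    show "\<kappa> * 2 ^ length ?bs \<le> (\<Prod>b\<leftarrow>?bs. 1 + (cmod (b z))\<^sup>2)" if "norm z \<le> 1" for z
      using weight[OF that] prod.distinct_set_conv_list[of "[0..<N]" "\<lambda>n. 1 + (cmod (B n z))\<^sup>2"]
      by (simp add: o_def atLeast0LessThan)
  qed (use xs B_analytic blaschke_prod_norm_eq blaschke_prod_norm_le in auto)
  then show ?thesis
    by (simp add: o_def interv_sum_list_conv_sum_set_nat atLeast0LessThan carleson_const_def)
qed

text \<open>On the circle \<open>cnj (h n) = G n \<cdot> cnj (B n)\<close>, so \<open>\<langle>f, h n\<rangle>\<close> is the area integral of
  \<open>(f \<cdot> G n)' \<cdot> cnj (B n)'\<close>, which the Carleson embedding controls.\<close>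

lemma riesz_upper:
  assumes h: "\<And>n. n < N \<Longrightarrow> h n \<in> bspace (xs n)"
  shows "(norm (\<Sum>n<N. h n))\<^sup>2 \<le> 4 * carleson_const * (\<Sum>n<N. (norm (h n))\<^sup>2)"
proof -
  let ?E = carleson_const
  have "\<exists>H g G. n < N \<longrightarrow> conjugate_pair (xs n) (h n) H g G" for n
    using conjugate_pair_exists[OF xs h] by blast
  then obtain H g G0 where HG0: "\<And>n. n < N \<Longrightarrow> conjugate_pair (xs n) (h n) (H n) (g n) (G0 n)"
    by metis
  then have H: "\<And>n. n < N \<Longrightarrow> H n analytic_on cball 0 1"
    and G0: "\<And>n. n < N \<Longrightarrow> G0 n analytic_on cball 0 1"
    and hH: "\<And>n z. n < N \<Longrightarrow> z \<in> unit_disc \<Longrightarrow> h2_fun (h n) z = H n z"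
    and HG: "\<And>n z. n < N \<Longrightarrow> norm z = 1 \<Longrightarrow> z * G0 n z = B n z * cnj (H n z)"
    unfolding conjugate_pair_def by blast+
  define G where "G n z = z * G0 n z" for n z
  define F where "F z = (\<Sum>n<N. H n z)" for z
  define f where "f = (\<Sum>n<N. h n)"
  have G: "G n analytic_on cball 0 1" if "n < N" for n
    unfolding G_def[abs_def] using G0[OF that] by (intro analytic_intros)
  have F: "F analytic_on cball 0 1"
    unfolding F_def[abs_def] using H by (intro analytic_intros) auto
  have fF: "h2_fun f z = F z" if "z \<in> unit_disc" for z
    using hH that by (simp add: f_def F_def)
  have nf: "(norm f)\<^sup>2 = circle_sq 1 F" using h2_norm_circle[OF F fF] .
  have nh: "(norm (h n))\<^sup>2 = circle_sq 1 (G n)" if n: "n < N" for n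
  proof -
    have "circle_sq 1 (G n) = circle_sq 1 (H n)"
      using HG[OF n] blaschke_prod_norm_eq[OF xs] by (intro circle_sq_cong) (simp add: G_def norm_mult)
    then show ?thesis using h2_norm_circle[OF H[OF n] hH[OF n]] by simp
  qed
  \<comment> \<open>The product rule splits the derivative of \<open>F * G n\<close> into two terms;
    \<open>T n\<close> bounds both after multiplication by the derivative of
    \<open>B n\<close>.\<close>
  define T where "T n z = cmod (deriv F z) * (cmod (G n z) * cmod (deriv (B n) z))
      + cmod (F z) * cmod (deriv (G n) z) * cmod (deriv (B n) z)" for n z
  have cT: "continuous_on (cball 0 1) (T n)" if n: "n < N" for n
    unfolding T_def[abs_def] by (intro continuous_intros analytic_deriv F G[OF n] B_analytic)
  have inner_le: "Re (h2_inner f (h n)) \<le> area (T n)" if n: "n < N" for n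
  proof -
    have FG: "(\<lambda>z. F z * G n z) analytic_on cball 0 1"
      using F G[OF n] by (intro analytic_intros)
    have "h2_inner f (h n) = circle_mean 1 (\<lambda>z. F z * cnj (H n z))"
      by (rule h2_inner_circle[OF F fF H[OF n] hH[OF n]])
    also have "\<dots> = circle_mean 1 (\<lambda>z. (F z * G n z) * cnj (B n z))"
    proof (rule circle_mean_cong)
      fix z :: complex assume z: "norm z = 1"
      have "G n z * cnj (B n z) = (B n z * cnj (B n z)) * cnj (H n z)"
        using HG[OF n z] by (simp add: G_def)
      then show "F z * cnj (H n z) = (F z * G n z) * cnj (B n z)"
        using unit_cnj[OF blaschke_prod_norm_eq[OF xs z]] by simp
    qed
    \<comment> \<open>\<open>G n\<close> carries a factor \<open>z\<close>, so the values at 0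
      contribute nothing to the pairing.\<close>
    also have "\<dots> = area (\<lambda>z. deriv (\<lambda>z. F z * G n z) z * cnj (deriv (B n) z))"
      using area_pairing[OF FG B_analytic] by (simp add: G_def)
    finally have "cmod (h2_inner f (h n)) \<le> area (\<lambda>z. cmod (deriv (\<lambda>z. F z * G n z) z * cnj (deriv (B n) z)))"
      by (simp only:) (intro norm_area_le continuous_intros analytic_deriv FG B_analytic)
    also have "\<dots> \<le> area (T n)"
    proof (rule area_mono[OF _ cT[OF n]])
      show "continuous_on (cball 0 1) (\<lambda>z. cmod (deriv (\<lambda>z. F z * G n z) z * cnj (deriv (B n) z)))"
        by (intro continuous_intros analytic_deriv FG B_analytic)
      fix z :: complex assume z: "norm z \<le> 1"
      have "deriv (\<lambda>z. F z * G n z) z = F z * deriv (G n) z + deriv F z * G n z"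
        using F G[OF n] z by (intro deriv_mult) (auto simp: analytic_on_imp_differentiable_at)
      then have "cmod (deriv (\<lambda>z. F z * G n z) z) \<le> cmod (F z) * cmod (deriv (G n) z) + cmod (deriv F z) * cmod (G n z)"
        by (metis norm_mult norm_triangle_ineq)
      then show "cmod (deriv (\<lambda>z. F z * G n z) z * cnj (deriv (B n) z)) \<le> T n z"
        using mult_right_mono[of _ _ "cmod (deriv (B n) z)"]
        unfolding T_def norm_mult complex_mod_cnj by (fastforce simp: algebra_simps)
    qed
    finally show ?thesis using complex_Re_le_cmod order_trans by blast
  qed
  define Q where "Q z = (\<Sum>n<N. (cmod (deriv (B n) z))\<^sup>2)" for z
  have cQ: "continuous_on (cball 0 1) Q"
    unfolding Q_def[abs_def] by (intro continuous_intros analytic_deriv B_analytic)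
  \<comment> \<open>The weights in the arithmetic-geometric inequality are chosen so that
    \<open>U1\<close> and \<open>U3\<close> each cost a quarter of the squared norm of
    \<open>f\<close>, \<open>U3\<close> through the Carleson embedding; their sum, one half, is
    absorbed by the left side. \<open>U2\<close> and \<open>U4\<close> carry the norms of the
    \<open>h n\<close>.\<close>
  define U1 where "U1 z = 1 / 4 * (cmod (deriv F z))\<^sup>2" for z
  define U2 where "U2 n z = (cmod (G n z))\<^sup>2 * Q z" for n z
  define U3 where "U3 z = 1 / (4 * ?E) * ((cmod (F z))\<^sup>2 * Q z)" for z
  define U4 where "U4 n z = ?E * (cmod (deriv (G n) z))\<^sup>2" for n z
  have cU: "continuous_on (cball 0 1) U1" "continuous_on (cball 0 1) U3"
    "n < N \<Longrightarrow> continuous_on (cball 0 1) (U2 n)" "n < N \<Longrightarrow> continuous_on (cball 0 1) (U4 n)" for n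
    unfolding U1_def[abs_def] U2_def[abs_def] U3_def[abs_def] U4_def[abs_def]
    by (intro continuous_intros analytic_deriv F G cQ; assumption)+
  have "(norm f)\<^sup>2 = Re (h2_inner f f)" using h2_inner_self_norm[of f] by simp
  also have "\<dots> = (\<Sum>n<N. Re (h2_inner f (h n)))"
    by (subst (2) f_def) (simp add: h2_inner_sum_right)
  also have "\<dots> \<le> (\<Sum>n<N. area (T n))"
    using inner_le by (intro sum_mono) auto
  also have "\<dots> = area (\<lambda>z. \<Sum>n<N. T n z)"
    using cT by (intro area_sum[symmetric]) auto
  also have "\<dots> \<le> area (\<lambda>z. (U1 z + (\<Sum>n<N. U2 n z)) + (U3 z + (\<Sum>n<N. U4 n z)))"
  proof (rule area_mono)
    fix z :: complex
    let ?p = "\<lambda>n. cmod (G n z)" and ?q = "\<lambda>n. cmod (deriv (B n) z)" and ?r = "\<lambda>n. cmod (deriv (G n) z)"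
    let ?A = "cmod (deriv F z)" and ?S = "\<Sum>n<N. cmod (G n z) * cmod (deriv (B n) z)"
    have "0 \<le> (?A / 2 - ?S)\<^sup>2" by simp
    then have "?A * ?S \<le> ?A\<^sup>2 / 4 + ?S\<^sup>2"
      by (simp add: power2_eq_square algebra_simps)
    also have "?S\<^sup>2 \<le> (\<Sum>n<N. (?p n)\<^sup>2) * (\<Sum>n<N. (?q n)\<^sup>2)"
      by (rule cmod_sum_power2_le)
    finally have 1: "?A * ?S \<le> U1 z + (\<Sum>n<N. U2 n z)"
      by (simp add: U1_def U2_def Q_def flip: sum_distrib_right)
    have 2: "cmod (F z) * ?r n * ?q n \<le> 1 / (4 * ?E) * ((cmod (F z))\<^sup>2 * (?q n)\<^sup>2) + U4 n z" for n
    proof -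
      have "0 \<le> 1 / (4 * ?E) * (cmod (F z) * ?q n - 2 * ?E * ?r n)\<^sup>2"
        using carleson_pos by simp
      also have "\<dots> = 1 / (4 * ?E) * ((cmod (F z))\<^sup>2 * (?q n)\<^sup>2) + U4 n z - cmod (F z) * ?r n * ?q n"
        using carleson_pos by (simp add: U4_def power2_eq_square field_simps)
      finally show ?thesis by simp
    qed
    have "(\<Sum>n<N. T n z) = ?A * ?S + (\<Sum>n<N. cmod (F z) * ?r n * ?q n)"
      by (simp add: T_def sum.distrib sum_distrib_left)
    also have "\<dots> \<le> (U1 z + (\<Sum>n<N. U2 n z)) +
        (\<Sum>n<N. 1 / (4 * ?E) * ((cmod (F z))\<^sup>2 * (?q n)\<^sup>2) + U4 n z)"
      by (intro add_mono 1 sum_mono 2)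
    also have "\<dots> = (U1 z + (\<Sum>n<N. U2 n z)) + (U3 z + (\<Sum>n<N. U4 n z))"
      unfolding U3_def Q_def by (simp add: sum.distrib sum_distrib_left)
    finally show "(\<Sum>n<N. T n z) \<le> (U1 z + (\<Sum>n<N. U2 n z)) + (U3 z + (\<Sum>n<N. U4 n z))" .
  qed (auto intro!: continuous_intros cT cU)
  also have "\<dots> = (area U1 + (\<Sum>n<N. area (U2 n))) + (area U3 + (\<Sum>n<N. area (U4 n)))"
    using cU by (subst area_add area_sum; (auto intro!: continuous_intros)?)+
  also have "\<dots> \<le> (1 / 4 * (norm f)\<^sup>2 + (\<Sum>n<N. ?E * (norm (h n))\<^sup>2)) +
      (1 / 4 * (norm f)\<^sup>2 + (\<Sum>n<N. ?E * (norm (h n))\<^sup>2))"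
  proof (intro add_mono sum_mono)
    show "area U1 \<le> 1 / 4 * (norm f)\<^sup>2"
      unfolding U1_def[abs_def] area_cmult nf using area_deriv_le[OF F] by simp
    have "area U3 \<le> 1 / (4 * ?E) * (?E * (norm f)\<^sup>2)"
      unfolding U3_def[abs_def] area_cmult nf Q_def using carleson[OF F] carleson_pos
      by (intro mult_left_mono) auto
    then show "area U3 \<le> 1 / 4 * (norm f)\<^sup>2" using carleson_pos by simp
    fix n assume "n \<in> {..<N}"
    then have n: "n < N" by simp
    show "area (U2 n) \<le> ?E * (norm (h n))\<^sup>2"
      unfolding U2_def[abs_def] Q_def nh[OF n] by (rule carleson[OF G[OF n]])
    show "area (U4 n) \<le> ?E * (norm (h n))\<^sup>2"
      unfolding U4_def[abs_def] area_cmult nh[OF n] using area_deriv_le[OF G[OF n]] carleson_pos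
      by (intro mult_left_mono) auto
  qed
  finally have "(norm f)\<^sup>2 \<le> 1 / 2 * (norm f)\<^sup>2 + 2 * (?E * (\<Sum>n<N. (norm (h n))\<^sup>2))"
    by (simp add: sum_distrib_left)
  then show ?thesis by (simp add: f_def)
qed

section \<open>The lower Riesz bound\<close>

definition rest :: "nat \<Rightarrow> complex list" where
  "rest n = concat (map xs (remove1 n [0..<N]))"

definition all_zeros :: "complex list" where
  "all_zeros = concat (map xs [0..<N])"

lemma rest_disc: "set (rest n) \<subseteq> unit_disc" and all_zeros_disc: "set all_zeros \<subseteq> unit_disc"
  using xs set_remove1_subset[of n "[0..<N]"] by (fastforce simp: rest_def all_zeros_def)+

lemma mset_all_zeros: "n < N \<Longrightarrow> mset all_zeros = mset (xs n @ rest n)"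
  unfolding all_zeros_def rest_def by (rule mset_concat_remove1) simp

text \<open>For \<open>n \<noteq> m\<close> the zeros \<open>xs n\<close> are among those of
  \<open>rest m\<close>, so the right-hand vector is a multiple of the product over
  \<open>xs n\<close>.\<close>

lemma bspace_perp_rest:
  assumes "n < N" "m < N" "n \<noteq> m" "h \<in> bspace (xs n)"
  shows "h2_inner h (h2_mult (blaschke_prod (rest m)) y) = 0"
proof -
  let ?L = "concat (map xs (remove1 n (remove1 m [0..<N])))"
  have "n \<in> set (remove1 m [0..<N])" using assms by simp
  then have "mset (rest m) = mset (xs n @ ?L)"
    unfolding rest_def by (rule mset_concat_remove1)
  then have "blaschke_prod (rest m) = blaschke_prod (xs n @ ?L)" by (rule blaschke_prod_mset)
  moreover have "set ?L \<subseteq> unit_disc"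
    using xs by auto
  ultimately show ?thesis
    using bspaceD[OF assms(4)] by (simp add: h2_mult_append[OF xs])
qed

text \<open>The sum is paired with \<open>\<Sum>n<N. blaschke_prod (rest n) \<cdot> y n\<close>. On the circle
  \<open>blaschke_prod (rest n)\<close> is \<open>cnj (B n)\<close> up to a common unimodular factor, so this vector has the
  norm of the sum of the conjugates of the \<open>y n\<close>.\<close>

lemma riesz_lower:
  assumes h: "\<And>n. n < N \<Longrightarrow> h n \<in> bspace (xs n)" and c: "0 \<le> c"
    and y: "\<And>n. n < N \<Longrightarrow> y n \<in> bspace (xs n)" "\<And>n. n < N \<Longrightarrow> norm (y n) \<le> norm (h n)"
    and sep: "\<And>n. n < N \<Longrightarrow> c * (norm (h n))\<^sup>2 \<le> Re (h2_inner (h n) (h2_mult (blaschke_prod (rest n)) (y n)))"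
  shows "c\<^sup>2 * (\<Sum>n<N. (norm (h n))\<^sup>2) \<le> 4 * carleson_const * (norm (\<Sum>n<N. h n))\<^sup>2"
proof -
  let ?E = carleson_const
  let ?S = "\<Sum>n<N. (norm (h n))\<^sup>2"
  define f where "f = (\<Sum>n<N. h n)"
  define w where "w = (\<Sum>m<N. h2_mult (blaschke_prod (rest m)) (y m))"
  have "\<exists>H g G. n < N \<longrightarrow> conjugate_pair (xs n) (y n) H g G" for n
    using conjugate_pair_exists[OF xs y(1)] by blast
  then obtain Y g G where YG0: "\<And>n. n < N \<Longrightarrow> conjugate_pair (xs n) (y n) (Y n) (g n) (G n)"
    by metis
  then have Y: "\<And>n. n < N \<Longrightarrow> Y n analytic_on cball 0 1"
    and G: "\<And>n. n < N \<Longrightarrow> G n analytic_on cball 0 1"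
    and g: "\<And>n. n < N \<Longrightarrow> g n \<in> bspace (xs n)"
    and yY: "\<And>n z. n < N \<Longrightarrow> z \<in> unit_disc \<Longrightarrow> h2_fun (y n) z = Y n z"
    and gG: "\<And>n z. n < N \<Longrightarrow> z \<in> unit_disc \<Longrightarrow> h2_fun (g n) z = G n z"
    and YG: "\<And>n z. n < N \<Longrightarrow> norm z = 1 \<Longrightarrow> z * G n z = B n z * cnj (Y n z)"
    unfolding conjugate_pair_def by blast+
  have ng: "norm (g n) = norm (y n)" if n: "n < N" for n
  proof -
    have "cmod (G n z) = cmod (Y n z)" if "norm z = 1" for z
      using arg_cong[OF YG[OF n that], of cmod] blaschke_prod_norm_eq[OF xs that] that by (simp add: norm_mult)
    then have "circle_sq 1 (G n) = circle_sq 1 (Y n)" by (rule circle_sq_cong)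
    then have "(norm (g n))\<^sup>2 = (norm (y n))\<^sup>2"
      using h2_norm_circle[OF Y[OF n] yY[OF n]] h2_norm_circle[OF G[OF n] gG[OF n]] by simp
    then show ?thesis by (simp add: power2_eq_iff_nonneg)
  qed
  have "(norm w)\<^sup>2 = circle_sq 1 (\<lambda>z. \<Sum>m<N. blaschke_prod (rest m) z * Y m z)"
  proof (rule h2_norm_circle)
    show "(\<lambda>z. \<Sum>m<N. blaschke_prod (rest m) z * Y m z) analytic_on cball 0 1"
      using analytic_blaschke_prod[OF rest_disc] Y by (intro analytic_intros) auto
    show "h2_fun w z = (\<Sum>m<N. blaschke_prod (rest m) z * Y m z)" if "z \<in> unit_disc" for z
      using that yY by (simp add: w_def h2_fun_mult[OF bounded_holo_blaschke_prod[OF rest_disc]])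
  qed
  also have "\<dots> = circle_sq 1 (\<lambda>z. \<Sum>m<N. G m z)"
  proof (rule circle_sq_cong)
    fix z :: complex assume z: "norm z = 1"
    let ?T = "blaschke_prod all_zeros z"
    have "blaschke_prod (rest m) z * Y m z = ?T * cnj (z * G m z)" if "m < N" for m
    proof -
      have "?T = B m z * blaschke_prod (rest m) z"
        using blaschke_prod_mset[OF mset_all_zeros[OF that]] by simp
      then have "?T * cnj (z * G m z) = (B m z * cnj (B m z)) * (blaschke_prod (rest m) z * Y m z)"
        unfolding YG[OF that z] by simp
      then show ?thesis using unit_cnj[OF blaschke_prod_norm_eq[OF xs z]] by simp
    qed
    then have "(\<Sum>m<N. blaschke_prod (rest m) z * Y m z) = ?T * cnj (z * (\<Sum>m<N. G m z))"
      by (simp add: sum_distrib_left)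
    then show "cmod (\<Sum>m<N. blaschke_prod (rest m) z * Y m z) = cmod (\<Sum>m<N. G m z)"
      using z blaschke_prod_norm_eq[OF all_zeros_disc z] by (simp add: norm_mult del: cnj_sum)
  qed
  also have "\<dots> = (norm (\<Sum>m<N. g m))\<^sup>2"
    using G gG by (intro h2_norm_circle[symmetric]) (auto intro!: analytic_intros)
  also have "\<dots> \<le> 4 * ?E * (\<Sum>m<N. (norm (g m))\<^sup>2)"
    by (rule riesz_upper[OF g])
  also have "\<dots> \<le> 4 * ?E * ?S"
    using ng y(2) carleson_pos by (intro mult_left_mono sum_mono power_mono) auto
  finally have w: "(norm w)\<^sup>2 \<le> 4 * ?E * ?S" .
  have "h2_inner f w = (\<Sum>n<N. \<Sum>m<N. h2_inner (h n) (h2_mult (blaschke_prod (rest m)) (y m)))"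
    unfolding f_def h2_inner_sum_left unfolding w_def h2_inner_sum_right ..
  also have "\<dots> = (\<Sum>n<N. \<Sum>m<N. if m = n then h2_inner (h n) (h2_mult (blaschke_prod (rest n)) (y n)) else 0)"
    using bspace_perp_rest h by (intro sum.cong refl) auto
  also have "\<dots> = (\<Sum>n<N. h2_inner (h n) (h2_mult (blaschke_prod (rest n)) (y n)))"
    by (intro sum.cong refl) simp
  \<comment> \<open>Only the diagonal terms of the pairing have survived. As the squared norm of
    \<open>w\<close> is at most \<open>4 * carleson_const * ?S\<close>, squaring this bound leaves
    one factor \<open>?S\<close> to cancel.\<close>
  finally have "c * ?S \<le> Re (h2_inner f w)"
    using sep by (auto simp: sum_distrib_left intro!: sum_mono)
  also have "\<dots> \<le> norm f * norm w"
    using complex_Re_le_cmod h2_Cauchy_Schwarz order_trans by blast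
  finally have "(c * ?S)\<^sup>2 \<le> (norm f * norm w)\<^sup>2"
    using c by (intro power_mono) (auto intro!: mult_nonneg_nonneg sum_nonneg)
  also have "\<dots> \<le> (norm f)\<^sup>2 * (4 * ?E * ?S)"
    unfolding power_mult_distrib by (intro mult_left_mono w) simp
  finally have *: "?S * (c\<^sup>2 * ?S) \<le> ?S * (4 * ?E * (norm f)\<^sup>2)"
    by (simp add: power2_eq_square mult_ac)
  have "0 \<le> ?S" by (intro sum_nonneg) auto
  show ?thesis
  proof (cases "?S = 0")
    case False
    then have "0 < ?S" using \<open>0 \<le> ?S\<close> by simp
    from mult_left_le_imp_le[OF * this] show ?thesis unfolding f_def .
  next
    case True
    show ?thesis unfolding True using carleson_pos by (simp del: sum_eq_0_iff)
  qed
qed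

end

subsection \<open>Consequences of strong separation\<close>

text \<open>The vector is the projection of the Szego kernel to the model space, hence the
  reproducing kernel of the model space at \<open>w\<close>.\<close>

lemma kernel_projection_in_bspace:
  assumes ys: "set ys \<subseteq> unit_disc" and w: "norm w < 1"
  shows "h2_kernel w - h2_scale (cnj (blaschke_prod ys w)) (h2_mult (blaschke_prod ys) (h2_kernel w)) \<in> bspace ys"
proof -
  note bh = bounded_holo_blaschke_prod[OF ys]
  have k: "h2_inner (h2_kernel w) g = cnj (h2_fun g w)" for g
    using h2_inner_commute[of "h2_kernel w" g] h2_inner_kernel[OF w] by simp
  show ?thesis
    unfolding bspace_def
    by (auto simp: h2_inner_simps h2_inner_blaschke[OF ys] k h2_fun_mult[OF bh w])
qed

lemma blaschke_prod_concat:
  assumes "distinct L"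
  shows "blaschke_prod (concat (map xs L)) z = (\<Prod>m\<in>set L. blaschke_prod (xs m) z)"
  using assms by (induction L) (auto simp: mult.commute)

text \<open>Strong separation in homogeneous form, without infima and unit vectors; finite sums
  suffice for the estimates, so \<open>k\<close> ranges over the span itself.\<close>

locale separated_family =
  fixes xs :: "nat \<Rightarrow> complex list" and \<delta> :: real
  assumes xs: "\<And>n. set (xs n) \<subseteq> unit_disc" and \<delta>: "0 < \<delta>"
    and sep: "\<And>n h k. h \<in> bspace (xs n) \<Longrightarrow> k \<in> h2_span (\<Union>j\<in>{j. j \<noteq> n}. bspace (xs j)) \<Longrightarrow>
      \<delta> * norm k \<le> norm (k - h)"
begin

lemma concat_disc: "set (concat (map xs L)) \<subseteq> unit_disc"
  using xs by auto

lemma sum_in_span: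
  assumes "\<And>j. j \<in> A \<Longrightarrow> h j \<in> bspace (xs j)" "n \<notin> A"
  shows "(\<Sum>j\<in>A. h j) \<in> h2_span (\<Union>j\<in>{j. j \<noteq> n}. bspace (xs j))"
proof (rule h2.span_sum)
  fix j assume "j \<in> A"
  then have "h j \<in> bspace (xs j)" "j \<noteq> n" using assms by auto
  then show "h j \<in> h2_span (\<Union>j\<in>{j. j \<noteq> n}. bspace (xs j))"
    by (intro h2.span_base) blast
qed

text \<open>Separation lets one model space meet the sum of the others only in 0, because a common
  vector has distance 0 from itself; then \<open>bspace_append_subset\<close> applies.\<close>

lemma bspace_concat:
  assumes "distinct L" "f \<in> bspace (concat (map xs L))"
  shows "\<exists>h. (\<forall>j\<in>set L. h j \<in> bspace (xs j)) \<and> f = (\<Sum>j\<in>set L. h j)"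
  using assms
proof (induction L arbitrary: f)
  case Nil
  then show ?case by (simp add: bspace_Nil)
next
  case (Cons n L)
  have "bspace (xs n) \<inter> bspace (concat (map xs L)) \<subseteq> {0}"
  proof
    fix k assume k: "k \<in> bspace (xs n) \<inter> bspace (concat (map xs L))"
    then obtain h where h: "\<forall>j\<in>set L. h j \<in> bspace (xs j)" "k = (\<Sum>j\<in>set L. h j)"
      using Cons.IH[of k] Cons.prems(1) by auto
    have "k \<in> h2_span (\<Union>j\<in>{j. j \<noteq> n}. bspace (xs j))"
      unfolding h(2) by (rule sum_in_span) (use h Cons.prems(1) in auto)
    then have "\<delta> * norm k \<le> norm (k - k)" using k by (intro sep) auto
    then show "k \<in> {0}" using \<delta> by (simp add: mult_le_0_iff)
  qed
  then obtain u v where uv: "u \<in> bspace (xs n)" "v \<in> bspace (concat (map xs L))" "f = u + v"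
    using bspace_append_subset[OF xs concat_disc] Cons.prems(2) by fastforce
  obtain h where h: "\<forall>j\<in>set L. h j \<in> bspace (xs j)" "v = (\<Sum>j\<in>set L. h j)"
    using Cons.IH[OF _ uv(2)] Cons.prems(1) by auto
  have "(\<Sum>j\<in>set L. (h(n := u)) j) = (\<Sum>j\<in>set L. h j)"
    using Cons.prems(1) by (intro sum.cong) auto
  then have "f = (\<Sum>j\<in>set (n # L). (h(n := u)) j)"
    using Cons.prems(1) uv(3) h(2) by simp
  then show ?case using h(1) uv(1) Cons.prems(1) by (intro exI[of _ "h(n := u)"]) auto
qed

definition others :: "nat \<Rightarrow> nat \<Rightarrow> complex list" where
  "others N n = concat (map xs (remove1 n [0..<N]))"

lemma others_disc: "set (others N n) \<subseteq> unit_disc"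
  unfolding others_def by (rule concat_disc)

lemma separated_others:
  assumes "h \<in> bspace (xs n)" "k \<in> bspace (others N n)"
  shows "\<delta> * norm k \<le> norm (k - h)"
proof -
  obtain h' where h': "\<forall>j\<in>set (remove1 n [0..<N]). h' j \<in> bspace (xs j)" "k = (\<Sum>j\<in>set (remove1 n [0..<N]). h' j)"
    using bspace_concat[of "remove1 n [0..<N]" k] assms(2) by (auto simp: others_def)
  have "k \<in> h2_span (\<Union>j\<in>{j. j \<noteq> n}. bspace (xs j))"
    unfolding h'(2) by (rule sum_in_span) (use h' in auto)
  then show ?thesis using assms by (intro sep)
qed

text \<open>The bound obtained by solving \<open>\<delta> * (1 - |b|) \<le> |a| + |b|\<close> for
  \<open>|a| + |b|\<close>.\<close>

definition gap :: real where "gap = \<delta> / (1 + \<delta>)"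

lemma gap: "0 < gap" "gap < 1" "\<delta> = gap * (1 + \<delta>)"
  using \<delta> by (auto simp: gap_def field_simps)

text \<open>If both products were small at \<open>w\<close>, the kernel at \<open>w\<close> would
  almost lie in both model spaces: its two projections would nearly coincide, although the one to
  \<open>bspace (others N n)\<close> keeps almost the full norm. Separation excludes this.\<close>

lemma blaschke_sum_ge:
  assumes w: "norm w < 1"
  shows "gap \<le> cmod (blaschke_prod (xs n) w) + cmod (blaschke_prod (others N n) w)"
proof -
  let ?k = "h2_kernel w"
  let ?a = "blaschke_prod (xs n) w" and ?b = "blaschke_prod (others N n) w"
  let ?u = "h2_scale (cnj ?a) (h2_mult (blaschke_prod (xs n)) ?k)"
  let ?v = "h2_scale (cnj ?b) (h2_mult (blaschke_prod (others N n)) ?k)"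
  have "\<delta> * norm (?k - ?v) \<le> norm ((?k - ?v) - (?k - ?u))"
    by (intro separated_others[of _ n _ N] kernel_projection_in_bspace xs others_disc w)
  also have "(?k - ?v) - (?k - ?u) = ?u - ?v" by simp
  also have "norm (?u - ?v) \<le> (cmod ?a + cmod ?b) * norm ?k"
    using norm_triangle_ineq4[of ?u ?v] by (simp add: xs others_disc distrib_right)
  finally have 1: "\<delta> * norm (?k - ?v) \<le> (cmod ?a + cmod ?b) * norm ?k" .
  have "norm ?k - norm ?v \<le> norm (?k - ?v)" by (rule norm_triangle_ineq2)
  then have "(1 - cmod ?b) * norm ?k \<le> norm (?k - ?v)"
    by (simp add: others_disc left_diff_distrib)
  then have "\<delta> * ((1 - cmod ?b) * norm ?k) \<le> (cmod ?a + cmod ?b) * norm ?k"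
    using 1 mult_left_mono[of _ "norm (?k - ?v)" \<delta>] \<delta> by (meson less_imp_le order_trans)
  then have "(\<delta> * (1 - cmod ?b)) * norm ?k \<le> (cmod ?a + cmod ?b) * norm ?k" by (simp add: mult.assoc)
  then have "\<delta> * (1 - cmod ?b) \<le> cmod ?a + cmod ?b"
    using h2_kernel_nonzero[OF w] by simp
  moreover have "0 \<le> \<delta> * cmod ?a" using \<delta> by simp
  ultimately have "\<delta> \<le> (1 + \<delta>) * (cmod ?a + cmod ?b)"
    unfolding distrib_right distrib_left right_diff_distrib by linarith
  then show ?thesis using \<delta> by (simp add: gap_def field_simps)
qed

text \<open>On the boundary of the set where all \<open>|B\<^sub>n| \<ge> gap / 2\<close> the product is bounded below by
  \<open>blaschke_sum_ge\<close>; the maximum principle for its inverse extends this to the whole set.\<close>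

lemma prod_ge_on_large_set:
  assumes z: "norm z \<le> 1" "\<And>n. n < N \<Longrightarrow> gap / 2 \<le> cmod (blaschke_prod (xs n) z)"
  shows "gap\<^sup>2 / 4 \<le> (\<Prod>n<N. cmod (blaschke_prod (xs n) z))"
proof -
  define F where "F = cball 0 1 \<inter> (\<Inter>n<N. {z \<in> cball 0 1. gap / 2 \<le> cmod (blaschke_prod (xs n) z)})"
  define T where "T z = (\<Prod>n<N. blaschke_prod (xs n) z)" for z
  have cB: "continuous_on (cball 0 1) (blaschke_prod (xs n))" for n
    by (intro continuous_intros analytic_blaschke_prod xs)
  have "closed F"
    unfolding F_def by (intro closed_Int closed_INT ballI closed_cball continuous_closed_preimage
      continuous_on_closed_Collect_le continuous_intros cB)
  then have clF: "closure F = F" by simp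
  have F1: "F \<subseteq> cball 0 1" by (auto simp: F_def)
  have zF: "z \<in> F" using z by (auto simp: F_def)
  have T0: "T z \<noteq> 0" if "z \<in> F" for z
  proof -
    have "blaschke_prod (xs n) z \<noteq> 0" if "n < N" for n
      using \<open>z \<in> F\<close> that gap(1) norm_zero unfolding F_def by force
    then show ?thesis by (simp add: T_def)
  qed
  have T_hol: "T analytic_on cball 0 1"
    unfolding T_def[abs_def] by (intro analytic_intros analytic_blaschke_prod xs)
  have "cmod (inverse (T z)) \<le> 4 / gap\<^sup>2"
  proof (rule maximum_modulus_frontier[of "\<lambda>z. inverse (T z)" F])
    show "(\<lambda>z. inverse (T z)) holomorphic_on interior F"
    proof (rule holomorphic_on_subset)
      show "(\<lambda>z. inverse (T z)) holomorphic_on F"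
        by (intro holomorphic_intros holomorphic_on_subset[OF analytic_imp_holomorphic[OF T_hol] F1] T0)
    qed (rule interior_subset)
    show "continuous_on (closure F) (\<lambda>z. inverse (T z))"
      unfolding clF by (intro continuous_intros continuous_on_subset[OF _ F1] T_hol) (use T0 in auto)
    show "bounded F" using F1 bounded_cball bounded_subset by blast
    show "z \<in> F" by (rule zF)
    fix w assume "w \<in> frontier F"
    then have w: "w \<in> F" "w \<notin> interior F" using clF by (auto simp: frontier_def)
    have "gap\<^sup>2 / 4 \<le> cmod (T w)"
    proof (cases "norm w = 1")
      case True
      then have "cmod (T w) = 1" unfolding T_def by (simp add: prod_norm[symmetric] blaschke_prod_norm_eq[OF xs])
      moreover have "gap\<^sup>2 \<le> 1" using gap by (simp add: abs_square_le_1)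
      ultimately show ?thesis by simp
    next
      case False
      then have w1: "norm w < 1" using w(1) F1 by fastforce
      \<comment> \<open>Otherwise all inequalities are strict, they persist in a neighbourhood, and
        \<open>w\<close> is an interior point of \<open>F\<close>.\<close>
      have "\<exists>n<N. cmod (blaschke_prod (xs n) w) \<le> gap / 2"
      proof (rule ccontr)
        assume *: "\<not> ?thesis"
        let ?O = "\<Inter>n<N. {z \<in> ball 0 1. gap / 2 < cmod (blaschke_prod (xs n) z)}"
        have "open (ball 0 1 \<inter> ?O)"
        proof (intro open_Int open_INT ballI open_ball finite_lessThan)
          fix n
          have "continuous_on (ball 0 1) (\<lambda>z. cmod (blaschke_prod (xs n) z))"
            by (intro continuous_intros continuous_on_subset[OF cB]) auto
          from continuous_open_preimage[OF this open_ball, of "{gap / 2<..}"]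
          show "open {z \<in> ball 0 1. gap / 2 < cmod (blaschke_prod (xs n) z)}"
            by (simp add: vimage_def Int_def)
        qed
        moreover have "w \<in> ball 0 1 \<inter> ?O" using * w1 by (auto simp: not_le)
        moreover have "ball 0 1 \<inter> ?O \<subseteq> F" by (force simp: F_def)
        ultimately have "w \<in> interior F" by (meson interiorI)
        then show False using w(2) by simp
      qed
      then obtain n where n: "n < N" "cmod (blaschke_prod (xs n) w) \<le> gap / 2" by blast
      have b: "gap / 2 \<le> cmod (blaschke_prod (others N n) w)"
        using blaschke_sum_ge[OF w1, of n N] n(2) by simp
      have a: "gap / 2 \<le> cmod (blaschke_prod (xs n) w)" using w(1) n(1) by (auto simp: F_def)
      have "T w = blaschke_prod (xs n) w * blaschke_prod (others N n) w"
        unfolding T_def others_def using n(1)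
        by (subst blaschke_prod_concat) (auto simp: prod.remove[of "{..<N}" n] atLeast0LessThan)
      then have "cmod (T w) = cmod (blaschke_prod (xs n) w) * cmod (blaschke_prod (others N n) w)"
        by (simp add: norm_mult)
      moreover have "gap / 2 * (gap / 2) \<le> cmod (blaschke_prod (xs n) w) * cmod (blaschke_prod (others N n) w)"
        using a b gap(1) by (intro mult_mono) auto
      ultimately show ?thesis by (simp add: power2_eq_square)
    qed
    then have "inverse (cmod (T w)) \<le> inverse (gap\<^sup>2 / 4)"
      using gap(1) by (intro le_imp_inverse_le) auto
    then show "cmod (inverse (T w)) \<le> 4 / gap\<^sup>2"
      by (simp add: norm_divide inverse_eq_divide)
  qed
  then have "inverse (cmod (T z)) \<le> inverse (gap\<^sup>2 / 4)" by (simp add: norm_divide inverse_eq_divide)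
  then have "gap\<^sup>2 / 4 \<le> cmod (T z)"
    using T0[OF zF] gap(1) by (subst (asm) inverse_le_iff_le) auto
  then show ?thesis by (simp add: T_def prod_norm)
qed

lemma two_cmod_le: "2 * t \<le> 1 + t\<^sup>2" for t :: real
  using zero_le_power2[of "t - 1"] by (simp add: power2_eq_square algebra_simps)

text \<open>If all moduli are at least \<open>gap / 2\<close>, then
  \<open>1 + t^2 \<ge> 2 * t\<close> reduces the claim to \<open>prod_ge_on_large_set\<close>. If
  one is smaller, the complementary product is at least \<open>gap / 2\<close> by
  \<open>blaschke_sum_ge\<close>, and the small factor costs only one power of 2.\<close>

lemma weight_ge:
  assumes z: "norm z \<le> 1"
  shows "gap\<^sup>2 / 4 * 2 ^ N \<le> (\<Prod>n<N. 1 + (cmod (blaschke_prod (xs n) z))\<^sup>2)"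
proof (cases "\<forall>n<N. gap / 2 \<le> cmod (blaschke_prod (xs n) z)")
  case True
  then have "gap\<^sup>2 / 4 * 2 ^ N \<le> (\<Prod>n<N. cmod (blaschke_prod (xs n) z)) * 2 ^ N"
    using prod_ge_on_large_set[OF z] by (intro mult_right_mono) auto
  also have "\<dots> = (\<Prod>n<N. 2 * cmod (blaschke_prod (xs n) z))"
    by (simp add: prod.distrib)
  also have "\<dots> \<le> (\<Prod>n<N. 1 + (cmod (blaschke_prod (xs n) z))\<^sup>2)"
    by (intro prod_mono) (simp add: two_cmod_le)
  finally show ?thesis .
next
  case False
  then obtain n where n: "n < N" "cmod (blaschke_prod (xs n) z) < gap / 2" by auto
  have "norm z \<noteq> 1" using blaschke_prod_norm_eq[OF xs, of z n] n(2) gap by auto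
  then have z1: "norm z < 1" using z by simp
  let ?M = "{..<N} - {n}"
  have "gap / 2 \<le> cmod (blaschke_prod (others N n) z)"
    using blaschke_sum_ge[OF z1, of n N] n(2) by simp
  also have "\<dots> = (\<Prod>m\<in>?M. cmod (blaschke_prod (xs m) z))"
    unfolding others_def by (subst blaschke_prod_concat) (auto simp: prod_norm atLeast0LessThan)
  finally have "gap / 2 * 2 ^ card ?M \<le> (\<Prod>m\<in>?M. cmod (blaschke_prod (xs m) z)) * 2 ^ card ?M"
    by (intro mult_right_mono) auto
  also have "\<dots> = (\<Prod>m\<in>?M. 2 * cmod (blaschke_prod (xs m) z))"
    by (simp add: prod.distrib)
  also have "\<dots> \<le> (\<Prod>m\<in>?M. 1 + (cmod (blaschke_prod (xs m) z))\<^sup>2)"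
    by (intro prod_mono) (simp add: two_cmod_le)
  also have "\<dots> \<le> (1 + (cmod (blaschke_prod (xs n) z))\<^sup>2) * (\<Prod>m\<in>?M. 1 + (cmod (blaschke_prod (xs m) z))\<^sup>2)"
    by (simp add: mult_le_cancel_right1) (smt (verit) prod_nonneg zero_le_power2)
  also have "\<dots> = (\<Prod>n<N. 1 + (cmod (blaschke_prod (xs n) z))\<^sup>2)"
    using n(1) by (simp add: prod.remove[of "{..<N}" n])
  finally have *: "gap / 2 * 2 ^ card ?M \<le> (\<Prod>n<N. 1 + (cmod (blaschke_prod (xs n) z))\<^sup>2)" .
  obtain N' where N': "N = Suc N'" using n(1) by (cases N) auto
  have "gap\<^sup>2 \<le> gap" using gap by (simp add: power2_eq_square mult_left_le)
  then have "gap\<^sup>2 / 4 * 2 ^ N \<le> gap / 4 * 2 ^ N" by (intro mult_right_mono) auto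
  also have "\<dots> = gap / 2 * 2 ^ card ?M" using n(1) by (simp add: N')
  finally show ?thesis using * by linarith
qed

text \<open>The weight constant is the same for all \<open>N\<close>, so the estimates of
  \<open>blaschke_family\<close> hold uniformly in the number of spaces.\<close>

sublocale fam: blaschke_family xs N "gap\<^sup>2 / 4" for N
  by unfold_locales (use xs gap weight_ge in auto)

lemma rest_eq: "fam.rest N n = others N n"
  by (simp add: fam.rest_def others_def)

text \<open>In \<open>h = k + B * w\<close>, with \<open>B\<close> the product over the other zeros,
  the norm of \<open>w\<close> is the distance of \<open>h\<close> from their model space, which
  separation bounds below by \<open>gap * norm h\<close>. Replacing \<open>w\<close> by its
  projection to \<open>bspace (xs n)\<close> keeps the pairing with \<open>h\<close>, because the
  discarded part is a multiple of the product over \<open>xs n\<close>.\<close>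

lemma testing_vector:
  assumes h: "h \<in> bspace (xs n)"
  shows "\<exists>y\<in>bspace (xs n). norm y \<le> norm h \<and>
    gap\<^sup>2 * (norm h)\<^sup>2 \<le> Re (h2_inner h (h2_mult (blaschke_prod (others N n)) y))"
proof -
  let ?B = "blaschke_prod (others N n)"
  obtain k w where k: "k \<in> bspace (others N n)" "h = k + h2_mult ?B w"
    using bspace_decomp[OF others_disc] by blast
  obtain y v where y: "y \<in> bspace (xs n)" "w = y + h2_mult (blaschke_prod (xs n)) v"
    using bspace_decomp[OF xs] by blast
  have nw: "norm w = norm (h - k)" using norm_h2_blaschke[OF others_disc[of N n], of w] k(2) by simp
  have "(norm h)\<^sup>2 = (norm k)\<^sup>2 + (norm (h2_mult ?B w))\<^sup>2"
    unfolding k(2) by (rule h2_norm_sq_add_orth[OF bspaceD[OF k(1)]])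
  then have "(norm w)\<^sup>2 \<le> (norm h)\<^sup>2" by (simp add: others_disc)
  then have wh: "norm w \<le> norm h" by (rule power2_le_imp_le) simp
  have "(norm w)\<^sup>2 = (norm y)\<^sup>2 + (norm (h2_mult (blaschke_prod (xs n)) v))\<^sup>2"
    unfolding y(2) by (rule h2_norm_sq_add_orth[OF bspaceD[OF y(1)]])
  then have "(norm y)\<^sup>2 \<le> (norm w)\<^sup>2" by simp
  then have yw: "norm y \<le> norm w" by (rule power2_le_imp_le) simp
  have "norm h \<le> norm k + norm w"
    using norm_triangle_ineq[of k "h - k"] nw by simp
  moreover have "\<delta> * norm k \<le> norm w"
    using separated_others[OF h k(1)] nw by (simp add: norm_minus_commute)
  ultimately have "\<delta> * norm h \<le> (1 + \<delta>) * norm w"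
    using \<delta> mult_left_mono[of "norm h" "norm k + norm w" \<delta>] by (simp add: algebra_simps)
  then have "gap * norm h \<le> norm w" using \<delta> by (simp add: gap_def field_simps)
  then have "(gap * norm h)\<^sup>2 \<le> (norm w)\<^sup>2" using gap by (intro power_mono) auto
  also have "\<dots> = Re (h2_inner h (h2_mult ?B w))"
    using bspaceD[OF k(1), of w] h2_inner_self_norm[of w]
    by (simp add: k(2) h2_inner_add_left h2_inner_blaschke[OF others_disc])
  also have "h2_inner h (h2_mult ?B w) = h2_inner h (h2_mult ?B y)"
  proof -
    have "h2_mult ?B (h2_mult (blaschke_prod (xs n)) v) = h2_mult (blaschke_prod (xs n)) (h2_mult ?B v)"
      using h2_mult_append[OF others_disc xs] h2_mult_append_commute[OF others_disc xs] by metis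
    then show ?thesis
      unfolding y(2) h2_mult_add[OF bounded_holo_blaschke_prod[OF others_disc]]
      using bspaceD[OF h] by (simp add: h2_inner_add_right)
  qed
  finally show ?thesis
    using y(1) yw wh by (intro bexI[of _ y]) (auto simp: power_mult_distrib)
qed

text \<open>With \<open>\<kappa> = gap^2 / 4\<close> the upper constant is
  \<open>4 * (4 / \<kappa>) = 64 / gap^2\<close>; the lower bound divides it by the square of the
  testing constant \<open>gap^2\<close>.\<close>

definition riesz_const :: real where "riesz_const = 64 / gap ^ 6"

lemma riesz_bounds:
  assumes h: "\<And>n. n < N \<Longrightarrow> h n \<in> bspace (xs n)"
  shows "(norm (\<Sum>n<N. h n))\<^sup>2 \<le> riesz_const * (\<Sum>n<N. (norm (h n))\<^sup>2)"
    and "(\<Sum>n<N. (norm (h n))\<^sup>2) \<le> riesz_const * (norm (\<Sum>n<N. h n))\<^sup>2"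
proof -
  have E: "4 * fam.carleson_const = 64 / gap\<^sup>2"
    by (simp add: fam.carleson_const_def)
  have "gap ^ 6 \<le> gap\<^sup>2" using gap by (intro power_decreasing) auto
  then have "64 / gap\<^sup>2 \<le> riesz_const"
    unfolding riesz_const_def using gap by (intro divide_left_mono) auto
  then show "(norm (\<Sum>n<N. h n))\<^sup>2 \<le> riesz_const * (\<Sum>n<N. (norm (h n))\<^sup>2)"
    using fam.riesz_upper[OF h] unfolding E
    by (meson mult_right_mono order_trans sum_nonneg zero_le_power2)
  have "\<exists>y. n < N \<longrightarrow> y \<in> bspace (xs n) \<and> norm y \<le> norm (h n) \<and>
    gap\<^sup>2 * (norm (h n))\<^sup>2 \<le> Re (h2_inner (h n) (h2_mult (blaschke_prod (others N n)) y))" for n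
    using testing_vector[OF h] by blast
  then obtain y where y: "\<And>n. n < N \<Longrightarrow> y n \<in> bspace (xs n)" "\<And>n. n < N \<Longrightarrow> norm (y n) \<le> norm (h n)"
    "\<And>n. n < N \<Longrightarrow> gap\<^sup>2 * (norm (h n))\<^sup>2 \<le> Re (h2_inner (h n) (h2_mult (blaschke_prod (others N n)) (y n)))"
    by metis
  have "(gap\<^sup>2)\<^sup>2 * (\<Sum>n<N. (norm (h n))\<^sup>2) \<le> 64 / gap\<^sup>2 * (norm (\<Sum>n<N. h n))\<^sup>2"
    unfolding E[symmetric] by (rule fam.riesz_lower[OF h _ y(1,2)]) (use y(3) rest_eq in auto)
  then have "gap ^ 6 * (\<Sum>n<N. (norm (h n))\<^sup>2) \<le> 64 * (norm (\<Sum>n<N. h n))\<^sup>2"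
    using gap by (simp add: field_simps flip: power_mult power_add)
  then show "(\<Sum>n<N. (norm (h n))\<^sup>2) \<le> riesz_const * (norm (\<Sum>n<N. h n))\<^sup>2"
    unfolding riesz_const_def using gap by (simp add: field_simps)
qed

end

subsection \<open>Commutant lifting\<close>

definition bshift :: "hardy2 \<Rightarrow> hardy2" where
  "bshift f = (SOME g. \<forall>k. hcoeff g k = hcoeff f (Suc k))"

lemma hcoeff_bshift [simp]: "hcoeff (bshift f) k = hcoeff f (Suc k)"
proof -
  have "\<exists>g. \<forall>k. hcoeff g k = hcoeff f (Suc k)"
    by (rule hardy2_of_coeffs) (subst summable_Suc_iff, rule h2_fun_summable)
  then show ?thesis unfolding bshift_def by (rule someI2_ex) simp
qed

lemma hcoeff_bshift_pow [simp]: "hcoeff ((bshift ^^ j) f) k = hcoeff f (k + j)"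
  by (induction j arbitrary: k) simp_all

lemma bshift_add: "bshift (f + g) = bshift f + bshift g"
  and bshift_scale: "bshift (h2_scale c f) = h2_scale c (bshift f)"
  and bshift_diff: "bshift (f - g) = bshift f - bshift g"
  by (rule hcoeff_eqI; simp)+

lemma bshift_pow_add: "(bshift ^^ j) (f + g) = (bshift ^^ j) f + (bshift ^^ j) g"
  and bshift_pow_scale: "(bshift ^^ j) (h2_scale c f) = h2_scale c ((bshift ^^ j) f)"
  and bshift_pow_diff: "(bshift ^^ j) (f - g) = (bshift ^^ j) f - (bshift ^^ j) g"
  by (rule hcoeff_eqI; simp)+

lemma bshift_pow_sum: "(bshift ^^ j) (\<Sum>i\<in>A. f i) = (\<Sum>i\<in>A. (bshift ^^ j) (f i))"
  by (rule hcoeff_eqI) simp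

lemma norm_bshift_le: "norm (bshift f) \<le> norm f"
proof -
  have "(norm (bshift f))\<^sup>2 + (cmod (hcoeff f 0))\<^sup>2 = (norm f)\<^sup>2"
    using suminf_split_head[OF h2_fun_summable[of f]] by (simp add: h2_norm_sq)
  then have "(norm (bshift f))\<^sup>2 \<le> (norm f)\<^sup>2" by (smt (verit) zero_le_power2)
  then show ?thesis by (rule power2_le_imp_le) simp
qed

text \<open>The backward shift is the adjoint of multiplication by \<open>z\<close>; the minus sign
  comes from \<open>blaschke_factor 0 z = - z\<close>.\<close>

lemma h2_inner_bshift:
  "h2_inner (bshift f) g = - h2_inner f (h2_mult (blaschke_prod [0]) g)"
proof -
  let ?a = "\<lambda>k. if k = 0 then 0 else hcoeff g (k - 1)"
  have "summable (\<lambda>k. (cmod (?a k))\<^sup>2)"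
    by (subst summable_Suc_iff[symmetric]) (simp add: h2_fun_summable)
  then obtain u where u: "\<And>k. hcoeff u k = ?a k" using hardy2_of_coeffs[of ?a] by blast
  have "h2_fun u z = z * h2_fun g z" if "norm z < 1" for z
  proof -
    have "(\<lambda>k. hcoeff u (Suc k) * z ^ Suc k) sums (z * h2_fun g z)"
      using sums_mult[OF h2_fun_sums[OF that, of g], of z] by (simp add: u mult_ac)
    then have "(\<lambda>k. hcoeff u k * z ^ k) sums (z * h2_fun g z + hcoeff u 0 * z ^ 0)"
      by (rule sums_Suc)
    then show ?thesis using h2_fun_sums[OF that, of u] sums_unique2 by (simp add: u)
  qed
  then have "h2_mult (blaschke_prod [0]) g = h2_scale (-1) u"
    by (intro h2_fun_eqI) (simp add: h2_fun_mult[OF bounded_holo_blaschke_prod] blaschke_factor_def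
      del: h2.scale_minus_left h2.scale_minus_right)
  moreover have "h2_inner f u = h2_inner (bshift f) g"
  proof -
    have "(\<lambda>k. hcoeff f (Suc k) * cnj (hcoeff u (Suc k))) sums h2_inner (bshift f) g"
      using h2_inner_sums[of "bshift f" g] by (simp add: u)
    then have "(\<lambda>k. hcoeff f k * cnj (hcoeff u k)) sums (h2_inner (bshift f) g + hcoeff f 0 * cnj (hcoeff u 0))"
      by (rule sums_Suc)
    then show ?thesis using h2_inner_sums[of f u] sums_unique2 by (simp add: u)
  qed
  ultimately show ?thesis
    by (simp add: h2_inner_scale_right del: h2.scale_minus_left h2.scale_minus_right)
qed

text \<open>The extra zero multiplies the product by \<open>- z\<close>, and the shift undoes this.
  Hence on the larger space all shifted values of a functional are known already, which makes an
  extension by one zero tractable.\<close>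

lemma bshift_in_bspace:
  assumes "set xs \<subseteq> unit_disc" "f \<in> bspace (xs @ [0])"
  shows "bshift f \<in> bspace xs"
  unfolding bspace_def
proof (intro CollectI allI)
  fix g
  have "h2_inner f (h2_mult (blaschke_prod [0]) (h2_mult (blaschke_prod xs) g)) = 0"
    using bspaceD[OF assms(2), of g] h2_mult_append_commute[of xs "[0]" g] assms(1) by simp
  then show "h2_inner (bshift f) (h2_mult (blaschke_prod xs) g) = 0"
    by (simp add: h2_inner_bshift)
qed

lemma bshift_in_bspace':
  assumes "set xs \<subseteq> unit_disc" "f \<in> bspace xs"
  shows "bshift f \<in> bspace xs"
  using bshift_in_bspace[OF assms(1)] bspace_mono1[of xs "[0]"] assms by auto

lemma bshift_pow_in_bspace:
  assumes "set xs \<subseteq> unit_disc" "f \<in> bspace xs"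
  shows "(bshift ^^ j) f \<in> bspace xs"
  by (induction j) (auto simp: assms intro: bshift_in_bspace'[OF assms(1)])

text \<open>The value at \<open>e\<close> is found along a minimising sequence of \<open>q (e + x)\<close>.\<close>

lemma quadratic_extension:
  fixes q :: "'a::real_vector \<Rightarrow> real" and l :: "'a \<Rightarrow> complex"
  assumes ne: "V \<noteq> {}" and conv: "\<And>x y t. x \<in> V \<Longrightarrow> y \<in> V \<Longrightarrow> (1 - t) *\<^sub>R x + t *\<^sub>R y \<in> V"
    and quad: "\<And>x y t. x \<in> V \<Longrightarrow> y \<in> V \<Longrightarrow>
      q (e + ((1 - t) *\<^sub>R x + t *\<^sub>R y)) = (1 - t) * q (e + x) + t * q (e + y) - t * (1 - t) * q (y - x)"
    and nn: "\<And>x. x \<in> V \<Longrightarrow> 0 \<le> q (e + x)"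
    and dom: "\<And>x y. x \<in> V \<Longrightarrow> y \<in> V \<Longrightarrow> (cmod (l y - l x))\<^sup>2 \<le> q (y - x)"
  shows "\<exists>c. \<forall>y\<in>V. (cmod (l y + c))\<^sup>2 \<le> q (e + y)"
proof -
  define m where "m = (INF x\<in>V. q (e + x))"
  have bdd: "bdd_below ((\<lambda>x. q (e + x)) ` V)" using nn by (auto intro: bdd_belowI[of _ 0])
  have m_le: "m \<le> q (e + x)" if "x \<in> V" for x
    unfolding m_def using bdd that by (rule cINF_lower)
  have m0: "0 \<le> m" unfolding m_def using ne nn by (rule cINF_greatest)
  have "\<exists>x\<in>V. q (e + x) < m + inverse (Suc n)" for n
    using cINF_less_iff[OF ne bdd, of "m + inverse (Suc n)"] by (simp add: m_def[symmetric])
  then obtain x where x: "\<And>n. x n \<in> V" "\<And>n. q (e + x n) < m + inverse (Suc n)" by metis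
  \<comment> \<open>The quadratic identity along the segment from \<open>x n\<close> to
    \<open>y\<close> is compared with the minimality of \<open>m\<close>. With
    \<open>t = 1/2\<close> it shows that near-minimisers are close in \<open>q\<close>; with
    \<open>n\<close> growing and then \<open>t\<close> shrinking to 0 it gives the final bound by
    \<open>q (e + y) - m\<close>.\<close>
  have close: "q (y - x n) \<le> (inverse (Suc n) / t + (q (e + y) - m)) / (1 - t)"
    if y: "y \<in> V" and t: "0 < t" "t < 1" for y n t
  proof -
    have "m \<le> (1 - t) * q (e + x n) + t * q (e + y) - t * (1 - t) * q (y - x n)"
      using m_le[OF conv[OF x(1) y]] quad[OF x(1) y] by metis
    moreover have "(1 - t) * q (e + x n) \<le> (1 - t) * (m + inverse (Suc n))"
      using x(2)[of n] t by (intro mult_left_mono) auto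
    moreover have "(1 - t) * inverse (Suc n) \<le> inverse (Suc n)"
      using t by (intro mult_left_le_one_le) auto
    ultimately have "t * ((1 - t) * q (y - x n)) \<le> inverse (Suc n) + t * (q (e + y) - m)"
      by (simp add: algebra_simps)
    moreover have "Q \<le> (i / t + D) / (1 - t)" if "t * ((1 - t) * Q) \<le> i + t * D" for Q i D
    proof -
      have "(1 - t) * Q \<le> i / t + D" using that t by (simp add: field_simps)
      then show ?thesis using t by (simp add: pos_le_divide_eq mult.commute)
    qed
    ultimately show ?thesis by blast
  qed
  have "Cauchy (\<lambda>n. l (x n))"
  proof (rule CauchyI')
    fix \<epsilon> :: real assume \<epsilon>: "0 < \<epsilon>"
    obtain M where M: "inverse (real (Suc M)) < \<epsilon>\<^sup>2 / 6"
      using reals_Archimedean[of "\<epsilon>\<^sup>2 / 6"] \<epsilon> by auto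
    show "\<exists>M. \<forall>k\<ge>M. \<forall>n>k. dist (l (x k)) (l (x n)) < \<epsilon>"
    proof (intro exI[of _ M] allI impI)
      fix k n assume kn: "M \<le> k" "k < n"
      have inv: "inverse (real (Suc n)) \<le> inverse (Suc M)" "inverse (real (Suc k)) \<le> inverse (Suc M)"
        using kn by (auto intro!: le_imp_inverse_le)
      have "(cmod (l (x k) - l (x n)))\<^sup>2 \<le> q (x k - x n)"
        by (rule dom[OF x(1) x(1)])
      also have "\<dots> \<le> (inverse (Suc n) / (1/2) + (q (e + x k) - m)) / (1 - 1/2)"
        by (rule close[OF x(1)]) auto
      also have "\<dots> = 4 * inverse (Suc n) + 2 * (q (e + x k) - m)" by simp
      also have "\<dots> < \<epsilon>\<^sup>2"
      proof -
        have "4 * a + 2 * (Q - m') < E" if "a \<le> i" "b \<le> i" "6 * i < E" "Q < m' + b" for a b i Q E m' :: real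
          using that by argo
        moreover have "6 * inverse (real (Suc M)) < \<epsilon>\<^sup>2" using M by simp
        ultimately show ?thesis using inv x(2)[of k] by blast
      qed
      finally show "dist (l (x k)) (l (x n)) < \<epsilon>"
        using \<epsilon> by (simp add: dist_norm power2_less_imp_less)
    qed
  qed
  then obtain c where c: "(\<lambda>n. l (x n)) \<longlonglongrightarrow> c"
    using Cauchy_convergent_iff convergent_def by blast
  show ?thesis
  proof (intro exI[of _ "- c"] ballI)
    fix y assume y: "y \<in> V"
    have bound: "(cmod (l y - c))\<^sup>2 \<le> (q (e + y) - m) / (1 - t)" if t: "0 < t" "t < 1" for t
    proof (rule LIMSEQ_le)
      show "(\<lambda>n. (cmod (l y - l (x n)))\<^sup>2) \<longlonglongrightarrow> (cmod (l y - c))\<^sup>2"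
        by (intro tendsto_intros c)
      have "(\<lambda>n. (inverse (real (Suc n)) / t + (q (e + y) - m)) / (1 - t)) \<longlonglongrightarrow> (0 / t + (q (e + y) - m)) / (1 - t)"
        using t by (intro tendsto_intros LIMSEQ_inverse_real_of_nat) auto
      then show "(\<lambda>n. (inverse (real (Suc n)) / t + (q (e + y) - m)) / (1 - t)) \<longlonglongrightarrow> (q (e + y) - m) / (1 - t)"
        by simp
      show "\<exists>M. \<forall>n\<ge>M. (cmod (l y - l (x n)))\<^sup>2 \<le> (inverse (real (Suc n)) / t + (q (e + y) - m)) / (1 - t)"
        using order_trans[OF dom[OF x(1) y] close[OF y t]] by blast
    qed
    have "((\<lambda>t. (q (e + y) - m) / (1 - t)) \<longlongrightarrow> (q (e + y) - m) / (1 - 0)) (at_right 0)"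
      by (intro tendsto_intros) auto
    moreover have "\<forall>\<^sub>F t in at_right 0. (cmod (l y - c))\<^sup>2 \<le> (q (e + y) - m) / (1 - t)"
      using bound by (auto simp: eventually_at_right_field intro!: exI[of _ 1])
    ultimately have "(cmod (l y - c))\<^sup>2 \<le> q (e + y) - m"
      using tendsto_lowerbound[of _ "(q (e + y) - m) / (1 - 0)" "at_right (0::real)"] by simp
    then show "(cmod (l y + - c))\<^sup>2 \<le> q (e + y)" using m0 by simp
  qed
qed

lemma h2_partial_sums_tendsto:
  "(\<lambda>n. norm (x - (\<Sum>j<n. h2_scale (hcoeff x j) (h2_power j)))) \<longlonglongrightarrow> 0"
proof -
  define P where "P n = (\<Sum>j<n. h2_scale (hcoeff x j) (h2_power j))" for n
  have hP: "hcoeff (P n) k = (if k < n then hcoeff x k else 0)" for n k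
    by (simp add: P_def if_distrib cong: if_cong)
  have "(norm (x - P n))\<^sup>2 = (norm x)\<^sup>2 - (\<Sum>k<n. (cmod (hcoeff x k))\<^sup>2)" for n
  proof -
    have "(\<lambda>k. (cmod (hcoeff (x - P n) k))\<^sup>2) = (\<lambda>k. (cmod (hcoeff x k))\<^sup>2 - (if k \<in> {..<n} then (cmod (hcoeff x k))\<^sup>2 else 0))"
      by (auto simp: hP)
    moreover have "\<dots> sums ((norm x)\<^sup>2 - (\<Sum>k<n. (cmod (hcoeff x k))\<^sup>2))"
      by (intro sums_diff h2_norm_sums sums_If_finite_set) simp
    ultimately have "(\<lambda>k. (cmod (hcoeff (x - P n) k))\<^sup>2) sums ((norm x)\<^sup>2 - (\<Sum>k<n. (cmod (hcoeff x k))\<^sup>2))"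
      by (simp only:)
    then show ?thesis by (rule sums_unique2[OF h2_norm_sums])
  qed
  moreover have "(\<lambda>n. (norm x)\<^sup>2 - (\<Sum>k<n. (cmod (hcoeff x k))\<^sup>2)) \<longlonglongrightarrow> (norm x)\<^sup>2 - (norm x)\<^sup>2"
    using h2_norm_sums[of x] unfolding sums_def by (intro tendsto_intros)
  ultimately have "(\<lambda>n. sqrt ((norm (x - P n))\<^sup>2)) \<longlonglongrightarrow> sqrt 0"
    by (intro tendsto_real_sqrt) simp
  then show ?thesis by (simp add: P_def)
qed

text \<open>The functional encodes an operator \<open>X\<close> from \<open>V\<close> to the Hardy
  space that commutes with the backward shift: the coefficient of \<open>X x\<close> at
  \<open>j\<close> is \<open>l ((bshift ^^ j) x)\<close>, and the last clause says that
  \<open>X\<close> has norm at most \<open>C\<close>.\<close>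

definition contractive_on :: "hardy2 set \<Rightarrow> real \<Rightarrow> (hardy2 \<Rightarrow> complex) \<Rightarrow> bool" where
  "contractive_on V C l \<longleftrightarrow>
    (\<forall>x\<in>V. \<forall>y\<in>V. l (x + y) = l x + l y) \<and> (\<forall>c. \<forall>x\<in>V. l (h2_scale c x) = c * l x) \<and>
    (\<forall>x\<in>V. \<forall>n. (\<Sum>j<n. (cmod (l ((bshift ^^ j) x)))\<^sup>2) \<le> C\<^sup>2 * (norm x)\<^sup>2)"

lemma convex_norm_sq:
  fixes x y :: "'a::real_inner"
  shows "(norm ((1 - t) *\<^sub>R x + t *\<^sub>R y))\<^sup>2 = (1 - t) * (norm x)\<^sup>2 + t * (norm y)\<^sup>2 - t * (1 - t) * (norm (y - x))\<^sup>2"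
  unfolding power2_norm_eq_inner by (simp add: inner_simps inner_commute algebra_simps power2_eq_square)

lemma scaleR_h2: "t *\<^sub>R (f :: hardy2) = h2_scale (of_real t) f"
  by (simp add: scaleR_hardy2_def)

text \<open>The larger space adds one vector \<open>e\<close>, and its shifts stay in the old space,
  so only the value at \<open>e\<close> has to be chosen. What the bound leaves after all shifted
  values are accounted for is a nonnegative quadratic form \<open>q\<close> that dominates
  \<open>|l|^2\<close> on the old space; the chosen value must preserve this domination.\<close>

lemma lifting_step:
  assumes ys: "set ys \<subseteq> unit_disc" and l: "contractive_on (bspace ys) C l"
  shows "\<exists>l'. contractive_on (bspace (ys @ [0])) C l' \<and> (\<forall>x\<in>bspace ys. l' x = l x)"
proof -
  let ?V = "bspace ys" and ?W = "bspace (ys @ [0])"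
  have add: "l (x + y) = l x + l y" and scale: "l (h2_scale c x) = c * l x" if "x \<in> ?V" "y \<in> ?V" for x y c
    using l that unfolding contractive_on_def by auto
  have bd: "(\<Sum>j<n. (cmod (l ((bshift ^^ j) x)))\<^sup>2) \<le> C\<^sup>2 * (norm x)\<^sup>2" if "x \<in> ?V" for x n
    using l that unfolding contractive_on_def by auto
  have diff: "l (y - x) = l y - l x" if "x \<in> ?V" "y \<in> ?V" for x y
    using add[of x "y - x"] bspace_diff[of y ys x] that by simp
  have VW: "?V \<subseteq> ?W" using ys by (intro bspace_mono1) auto
  have SW: "bshift x \<in> ?V" if "x \<in> ?W" for x using bshift_in_bspace[OF ys that] .
  have SjW: "(bshift ^^ j) (bshift x) \<in> ?V" if "x \<in> ?W" for x j
    using bshift_pow_in_bspace[OF ys SW[OF that]] .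
  define a where "a j x = (cmod (l ((bshift ^^ j) (bshift x))))\<^sup>2" for j x
  have sm: "summable (\<lambda>j. a j x)" and le: "(\<Sum>j. a j x) \<le> C\<^sup>2 * (norm (bshift x))\<^sup>2" if "x \<in> ?W" for x
  proof -
    have *: "(\<Sum>j<n. a j x) \<le> C\<^sup>2 * (norm (bshift x))\<^sup>2" for n
      unfolding a_def by (rule bd[OF SW[OF that]])
    then show s: "summable (\<lambda>j. a j x)"
      by (intro summableI_nonneg_bounded) (auto simp: a_def)
    show "(\<Sum>j. a j x) \<le> C\<^sup>2 * (norm (bshift x))\<^sup>2"
      using * s by (intro suminf_le_const)
  qed
  define q where "q x = C\<^sup>2 * (norm x)\<^sup>2 - (\<Sum>j. a j x)" for x
  have q0: "0 \<le> q x" if "x \<in> ?W" for x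
  proof -
    have "C\<^sup>2 * (norm (bshift x))\<^sup>2 \<le> C\<^sup>2 * (norm x)\<^sup>2"
      by (intro mult_left_mono power_mono norm_bshift_le) auto
    then show ?thesis using le[OF that] by (simp add: q_def)
  qed
  have dom: "(cmod (l x))\<^sup>2 \<le> q x" if "x \<in> ?V" for x
  proof -
    have "(cmod (l x))\<^sup>2 + (\<Sum>j<n. a j x) \<le> C\<^sup>2 * (norm x)\<^sup>2" for n
      using bd[OF that, of "Suc n"] unfolding sum.lessThan_Suc_shift a_def
      by (simp add: funpow_swap1)
    then have "(\<Sum>j<n. a j x) \<le> C\<^sup>2 * (norm x)\<^sup>2 - (cmod (l x))\<^sup>2" for n by (simp add: algebra_simps)
    then have "(\<Sum>j. a j x) \<le> C\<^sup>2 * (norm x)\<^sup>2 - (cmod (l x))\<^sup>2"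
      using sm VW that by (intro suminf_le_const) auto
    then show ?thesis by (simp add: q_def)
  qed
  have q_scale: "q (h2_scale c x) = (cmod c)\<^sup>2 * q x" if "x \<in> ?W" for c x
  proof -
    have "a j (h2_scale c x) = (cmod c)\<^sup>2 * a j x" for j
      using scale[OF SjW[OF that] SjW[OF that]]
      by (simp add: a_def bshift_scale bshift_pow_scale norm_mult power_mult_distrib)
    then have "q (h2_scale c x) = C\<^sup>2 * (cmod c * norm x)\<^sup>2 - (cmod c)\<^sup>2 * (\<Sum>j. a j x)"
      by (simp only: q_def norm_h2_scale suminf_mult[OF sm[OF that]])
    then show ?thesis by (simp add: q_def power_mult_distrib right_diff_distrib)
  qed
  have q_conv: "q ((1 - t) *\<^sub>R x + t *\<^sub>R y) = (1 - t) * q x + t * q y - t * (1 - t) * q (y - x)"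
    if xy: "x \<in> ?W" "y \<in> ?W" for x y t
  proof -
    have "a j ((1 - t) *\<^sub>R x + t *\<^sub>R y) = (1 - t) * a j x + t * a j y - t * (1 - t) * a j (y - x)" for j
    proof -
      let ?x = "(bshift ^^ j) (bshift x)" and ?y = "(bshift ^^ j) (bshift y)"
      have V: "?x \<in> ?V" "?y \<in> ?V" using SjW xy by auto
      have "l ((bshift ^^ j) (bshift ((1 - t) *\<^sub>R x + t *\<^sub>R y))) = (1 - t) *\<^sub>R l ?x + t *\<^sub>R l ?y"
        unfolding scaleR_h2 bshift_add bshift_scale bshift_pow_add bshift_pow_scale
        using add[of "h2_scale (of_real (1 - t)) ?x" "h2_scale (of_real t) ?y"] V scale bspace_scale
        by (simp add: scaleR_conv_of_real)
      moreover have "l ((bshift ^^ j) (bshift (y - x))) = l ?y - l ?x"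
        using diff[OF V] by (simp add: bshift_diff bshift_pow_diff)
      ultimately show ?thesis unfolding a_def by (simp only: convex_norm_sq)
    qed
    then have "(\<Sum>j. a j ((1 - t) *\<^sub>R x + t *\<^sub>R y)) = (\<Sum>j. (1 - t) * a j x + t * a j y - t * (1 - t) * a j (y - x))"
      by simp
    also have "\<dots> = (1 - t) * (\<Sum>j. a j x) + t * (\<Sum>j. a j y) - t * (1 - t) * (\<Sum>j. a j (y - x))"
    proof -
      have "(\<lambda>j. (1 - t) * a j x + t * a j y - t * (1 - t) * a j (y - x)) sums
        ((1 - t) * (\<Sum>j. a j x) + t * (\<Sum>j. a j y) - t * (1 - t) * (\<Sum>j. a j (y - x)))"
        using sm xy bspace_diff by (intro sums_diff sums_add sums_mult summable_sums) auto
      then show ?thesis by (simp add: sums_iff)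
    qed
    finally show ?thesis
      unfolding q_def convex_norm_sq by (simp add: algebra_simps)
  qed
  define e where "e = h2_mult (blaschke_prod ys) (h2_kernel 0)"
  have k0: "h2_kernel 0 = h2_power 0"
    by (rule hcoeff_eqI) (simp add: hcoeff_kernel)
  have e1: "norm e = 1" by (simp add: e_def k0 ys)
  have eW: "e \<in> ?W"
  proof -
    have "h2_kernel 0 \<in> bspace [0]" by (rule h2_kernel_in_bspace) auto
    then show ?thesis unfolding e_def using bspace_mult[of ys "[0]"] ys by simp
  qed
  have perp: "h2_inner x e = 0" if "x \<in> ?V" for x
    using bspaceD[OF that] by (simp add: e_def)
  have dec: "x - h2_scale (h2_inner x e) e \<in> ?V" if x: "x \<in> ?W" for x
  proof -
    obtain c k where k: "k \<in> ?V" "x = k + h2_scale c e"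
      using bspace_snoc_decomp[of 0 ys x] x ys by (auto simp: e_def)
    have "h2_inner x e = c"
      using perp[OF k(1)] h2_inner_self_norm[of e] e1 by (simp add: k(2) h2_inner_simps)
    then show ?thesis using k by simp
  qed
  have ne: "?V \<noteq> {}" using bspace_zero by blast
  obtain c where c: "\<And>y. y \<in> ?V \<Longrightarrow> (cmod (l y + c))\<^sup>2 \<le> q (e + y)"
  proof -
    have "\<exists>c. \<forall>y\<in>?V. (cmod (l y + c))\<^sup>2 \<le> q (e + y)"
    proof (rule quadratic_extension[OF ne])
      fix x y :: hardy2 and t :: real assume xy: "x \<in> ?V" "y \<in> ?V"
      show "(1 - t) *\<^sub>R x + t *\<^sub>R y \<in> ?V"
        unfolding scaleR_h2 by (intro bspace_add bspace_scale xy)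
      have "e + ((1 - t) *\<^sub>R x + t *\<^sub>R y) = (1 - t) *\<^sub>R (e + x) + t *\<^sub>R (e + y)"
        by (simp add: algebra_simps)
      then show "q (e + ((1 - t) *\<^sub>R x + t *\<^sub>R y)) = (1 - t) * q (e + x) + t * q (e + y) - t * (1 - t) * q (y - x)"
        using q_conv[of "e + x" "e + y" t] xy eW VW bspace_add[of e "ys @ [0]"] by auto
      show "(cmod (l y - l x))\<^sup>2 \<le> q (y - x)"
        using dom[of "y - x"] diff[OF xy] bspace_diff xy by auto
    next
      fix x assume "x \<in> ?V"
      then show "0 \<le> q (e + x)" using q0 eW VW bspace_add by blast
    qed
    then show ?thesis using that by blast
  qed
  define l' where "l' x = l (x - h2_scale (h2_inner x e) e) + h2_inner x e * c" for x
  have l'V: "l' x = l x" if "x \<in> ?V" for x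
    using perp[OF that] by (simp add: l'_def)
  \<comment> \<open>A vector with a nonzero component along \<open>e\<close> is a multiple of some
    \<open>e + y\<close>, so the affine bound from \<open>quadratic_extension\<close> suffices by
    homogeneity.\<close>
  have l'_dom: "(cmod (l' x))\<^sup>2 \<le> q x" if x: "x \<in> ?W" for x
  proof (cases "h2_inner x e = 0")
    case True
    then have "x \<in> ?V" using dec[OF x] by simp
    then show ?thesis using dom l'V by simp
  next
    case False
    let ?s = "h2_inner x e" and ?v = "x - h2_scale (h2_inner x e) e"
    let ?u = "h2_scale (1 / ?s) ?v"
    have v: "?v \<in> ?V" by (rule dec[OF x])
    then have u: "?u \<in> ?V" by (rule bspace_scale)
    have "x = h2_scale ?s (e + ?u)"
      using False by (simp add: h2.scale_right_distrib)
    then have "q x = (cmod ?s)\<^sup>2 * q (e + ?u)"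
      using q_scale[of "e + ?u" ?s] bspace_add[OF eW, of ?u] u VW by auto
    moreover have "l' x = ?s * (l ?u + c)"
      using False scale[OF v v, of "1 / ?s"] by (simp add: l'_def distrib_left)
    ultimately show ?thesis
      using c[OF u] by (simp add: norm_mult power_mult_distrib mult_left_mono)
  qed
  have "contractive_on ?W C l'"
    unfolding contractive_on_def
  proof (intro conjI ballI allI)
    fix x y assume xy: "x \<in> ?W" "y \<in> ?W"
    have "(x + y) - h2_scale (h2_inner (x + y) e) e =
      (x - h2_scale (h2_inner x e) e) + (y - h2_scale (h2_inner y e) e)"
      by (simp add: h2_inner_add_left h2.scale_left_distrib)
    then have "l ((x + y) - h2_scale (h2_inner (x + y) e) e) =
      l (x - h2_scale (h2_inner x e) e) + l (y - h2_scale (h2_inner y e) e)"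
      using add[OF dec[OF xy(1)] dec[OF xy(2)]] by (simp only:)
    then have "l' (x + y) = (l (x - h2_scale (h2_inner x e) e) + l (y - h2_scale (h2_inner y e) e)) + h2_inner (x + y) e * c"
      by (simp only: l'_def)
    also have "\<dots> = l' x + l' y"
      unfolding h2_inner_add_left l'_def distrib_right by (simp only: ac_simps)
    finally show "l' (x + y) = l' x + l' y" .
  next
    fix b x assume x: "x \<in> ?W"
    have "h2_scale b x - h2_scale (h2_inner (h2_scale b x) e) e = h2_scale b (x - h2_scale (h2_inner x e) e)"
      by (simp add: h2_inner_scale_left h2.scale_right_diff_distrib)
    then show "l' (h2_scale b x) = b * l' x"
      using scale[OF dec[OF x] dec[OF x]] by (simp add: l'_def h2_inner_scale_left distrib_left)
  next
    fix x n assume x: "x \<in> ?W"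
    show "(\<Sum>j<n. (cmod (l' ((bshift ^^ j) x)))\<^sup>2) \<le> C\<^sup>2 * (norm x)\<^sup>2"
    proof (cases n)
      case (Suc k)
      have "(\<Sum>j<n. (cmod (l' ((bshift ^^ j) x)))\<^sup>2) = (cmod (l' x))\<^sup>2 + (\<Sum>j<k. a j x)"
        unfolding Suc sum.lessThan_Suc_shift a_def using l'V[OF SjW[OF x]] by (simp add: funpow_swap1)
      also have "(\<Sum>j<k. a j x) \<le> (\<Sum>j. a j x)"
        by (rule sum_le_suminf[OF sm[OF x]]) (auto simp: a_def)
      also have "(cmod (l' x))\<^sup>2 + (\<Sum>j. a j x) \<le> C\<^sup>2 * (norm x)\<^sup>2"
        using l'_dom[OF x] by (simp add: q_def)
      finally show ?thesis by simp
    qed simp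
  qed
  then show ?thesis using l'V by blast
qed

lemma h2_power_in_bspace:
  assumes "j < n" "set xs \<subseteq> unit_disc"
  shows "h2_power j \<in> bspace (xs @ replicate n 0)"
proof -
  have "h2_power j \<in> bspace (replicate n 0)" using assms(1)
  proof (induction n)
    case (Suc n)
    have d: "set (replicate m 0) \<subseteq> unit_disc" for m by auto
    have r: "replicate (Suc n) 0 = replicate n (0::complex) @ [0]"
      by (simp add: replicate_append_same)
    show ?case
    proof (cases "j = n")
      case True
      have b: "blaschke_prod (replicate m 0) z = (- z) ^ m" for m z
        by (induction m) (auto simp: blaschke_factor_def)
      have "h2_kernel 0 \<in> bspace [0]" by (rule h2_kernel_in_bspace) auto
      then have "h2_mult (blaschke_prod (replicate n 0)) (h2_kernel 0) \<in> bspace (replicate (Suc n) 0)"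
        unfolding r using bspace_mult[of "replicate n 0" "[0]"] d by simp
      \<comment> \<open>The product with \<open>n\<close> zeros at 0 is \<open>(- z) ^ n\<close>;
        the sign is removed to obtain the monomial.\<close>
      then have "h2_scale ((-1) ^ n) (h2_mult (blaschke_prod (replicate n 0)) (h2_kernel 0)) \<in> bspace (replicate (Suc n) 0)"
        by (rule bspace_scale)
      also have "h2_scale ((-1) ^ n) (h2_mult (blaschke_prod (replicate n 0)) (h2_kernel 0)) = h2_power n"
        by (rule h2_fun_eqI)
          (simp add: h2_fun_mult[OF bounded_holo_blaschke_prod[OF d]] h2_fun_kernel h2_fun_power b
            flip: power_mult_distrib)
      finally show ?thesis using True by simp
    next
      case False
      then have "h2_power j \<in> bspace (replicate n 0)" using Suc by simp
      then show ?thesis unfolding r using bspace_mono1[of "replicate n 0" "[0]"] d by auto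
    qed
  qed simp
  then show ?thesis using bspace_mono2[of xs "replicate n 0"] assms by auto
qed

text \<open>Adding zeros at 0 one by one extends the functional to all polynomials; its values on the
  monomials are the conjugated Taylor coefficients of \<open>\<phi>\<close>.\<close>

lemma commutant_lifting:
  assumes xs: "set xs \<subseteq> unit_disc" and C: "0 \<le> C" and l: "contractive_on (bspace xs) C l"
  shows "\<exists>\<phi>. bounded_holo \<phi> C \<and> (\<forall>x\<in>bspace xs. l x = h2_inner x (h2_mult \<phi> (h2_power 0)))"
proof -
  let ?V = "\<lambda>k. bspace (xs @ replicate k 0)"
  have d: "set (xs @ replicate k 0) \<subseteq> unit_disc" for k using xs by auto
  have r: "xs @ replicate (Suc k) 0 = (xs @ replicate k 0) @ [0]" for k
    by (simp add: replicate_append_same)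
  obtain L where L: "\<And>k. contractive_on (?V k) C (L k)" "\<And>x. x \<in> ?V 0 \<Longrightarrow> L 0 x = l x"
    "\<And>k x. x \<in> ?V k \<Longrightarrow> L (Suc k) x = L k x"
  proof -
    \<comment> \<open>The clause for \<open>k = 0\<close> makes the chain of choices start at
      \<open>l\<close>.\<close>
    have "\<exists>L. \<forall>k. (contractive_on (?V k) C (L k) \<and> (k = 0 \<longrightarrow> L k = l)) \<and> (\<forall>x\<in>?V k. L (Suc k) x = L k x)"
    proof (rule dependent_nat_choice)
      show "\<exists>x. contractive_on (?V 0) C x \<and> (0 = (0::nat) \<longrightarrow> x = l)"
        using l by auto
      show "\<exists>y. (contractive_on (?V (Suc n)) C y \<and> (Suc n = 0 \<longrightarrow> y = l)) \<and> (\<forall>x\<in>?V n. y x = L x)"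
        if "contractive_on (?V n) C L \<and> (n = 0 \<longrightarrow> L = l)" for L n
        unfolding r using lifting_step[OF d, of n C L] that by auto
    qed
    then show ?thesis using that by blast
  qed
  have mono: "?V k \<subseteq> ?V m" if "k \<le> m" for k m
  proof -
    have "xs @ replicate m 0 = (xs @ replicate k 0) @ replicate (m - k) 0"
      using that by (simp flip: replicate_add)
    moreover have "set (replicate (m - k) (0::complex)) \<subseteq> unit_disc" by auto
    ultimately show ?thesis using bspace_mono1[OF d, of "replicate (m - k) 0" k] by metis
  qed
  have agree: "L m x = L k x" if "x \<in> ?V k" "k \<le> m" for k m x
    using that(2)
  proof (induction m rule: dec_induct)
    case (step n)
    then have "x \<in> ?V n" using mono[of k n] that(1) by blast
    then show ?case using L(3) step.IH by simp
  qed simp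
  have Ladd: "L k (x + y) = L k x + L k y" and Lscale: "L k (h2_scale c x) = c * L k x"
    if "x \<in> ?V k" "y \<in> ?V k" for k x y c
    using L(1)[of k] that unfolding contractive_on_def by auto
  have Lbd: "(\<Sum>j<n. (cmod (L k ((bshift ^^ j) x)))\<^sup>2) \<le> C\<^sup>2 * (norm x)\<^sup>2" if "x \<in> ?V k" for k n x
    using L(1)[of k] that unfolding contractive_on_def by auto
  have Lnorm: "cmod (L k x) \<le> C * norm x" if "x \<in> ?V k" for k x
  proof (rule power2_le_imp_le)
    show "(cmod (L k x))\<^sup>2 \<le> (C * norm x)\<^sup>2"
      using Lbd[OF that, of 1] by (simp add: power_mult_distrib)
  qed (use C in simp)
  have Lzero: "L k 0 = 0" for k using Lscale[of 0 k 0 0] by simp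
  have Lsum: "L k (\<Sum>i\<in>A. f i) = (\<Sum>i\<in>A. L k (f i))" if "\<And>i. i \<in> A \<Longrightarrow> f i \<in> ?V k" for k f and A :: "nat set"
    using that
    by (induction A rule: infinite_finite_induct) (auto simp: Lzero Ladd bspace_sum)
  have pV: "h2_power j \<in> ?V k" if "j < k" for j k using h2_power_in_bspace[OF that xs] .
  define p where "p j = cnj (L (Suc j) (h2_power j))" for j
  have Lp: "L k (h2_power j) = cnj (p j)" if "j < k" for j k
    using agree[OF pV[of j "Suc j"], of k] that by (simp add: p_def)
  have poly: "L k (\<Sum>j<n. h2_scale (b j) (h2_power j)) = (\<Sum>j<n. b j * cnj (p j))" if "n \<le> k" for n k b
  proof -
    have "L k (\<Sum>j<n. h2_scale (b j) (h2_power j)) = (\<Sum>j<n. L k (h2_scale (b j) (h2_power j)))"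
      using that pV by (intro Lsum bspace_scale) auto
    also have "\<dots> = (\<Sum>j<n. b j * cnj (p j))"
      using that pV Lp by (intro sum.cong refl) (simp add: Lscale[of _ _ 0])
    finally show ?thesis .
  qed
  have polyV: "(\<Sum>j<n. h2_scale (b j) (h2_power j)) \<in> ?V n" for n b
    using pV by (intro bspace_sum bspace_scale) auto
  define \<phi> where "\<phi> z = (\<Sum>j. p j * z ^ j)" for z
  have pC: "cmod (p j) \<le> C" for j
    using Lnorm[OF pV[of j "Suc j"]] by (simp add: p_def)
  have sums: "(\<lambda>j. p j * z ^ j) sums \<phi> z" if "norm z < 1" for z
  proof -
    have "summable (\<lambda>j. p j * z ^ j)"
    proof (rule summable_comparison_test')
      show "summable (\<lambda>j. C * norm z ^ j)"
        using that by (intro summable_mult summable_geometric) auto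
      show "norm (p j * z ^ j) \<le> C * norm z ^ j" for j
        using pC[of j] by (simp add: norm_mult norm_power mult_right_mono)
    qed
    then show ?thesis unfolding \<phi>_def by (rule summable_sums)
  qed
  have hol: "\<phi> holomorphic_on unit_disc"
  proof -
    have "\<phi> holomorphic_on ball 0 1"
      by (rule power_series_holomorphic[of 0 1 p]) (use sums in auto)
    then show ?thesis .
  qed
  \<comment> \<open>Contractivity is tested on truncations of the Szego kernel at \<open>w\<close>:
    the shifts of such a vector have as values \<open>cnj w ^ j\<close> times a conjugated partial
    sum of the series of \<open>\<phi>\<close> at \<open>w\<close>. In the limit both sides contain
    the factor \<open>1 / (1 - |w|^2)\<close>, which cancels.\<close>
  have bound: "cmod (\<phi> w) \<le> C" if w: "norm w < 1" for w
  proof -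
    let ?r = "(cmod w)\<^sup>2"
    have r1: "?r < 1" "0 \<le> ?r" using w by (auto simp: abs_square_less_1)
    define s where "s n = (\<Sum>k<n. p k * w ^ k)" for n
    have s: "s \<longlonglongrightarrow> \<phi> w" using sums[OF w] unfolding sums_def s_def .
    have fin: "(\<Sum>j<J. ?r ^ j * (cmod (s (n - j)))\<^sup>2) \<le> C\<^sup>2 * (1 / (1 - ?r))" if "J \<le> n" for J n
    proof -
      define x where "x = (\<Sum>k<n. h2_scale (cnj w ^ k) (h2_power k))"
      have hx: "hcoeff x k = (if k < n then cnj w ^ k else 0)" for k
        by (simp add: x_def if_distrib cong: if_cong)
      have "L n ((bshift ^^ j) x) = cnj w ^ j * cnj (s (n - j))" if "j < J" for j
      proof -
        have "(bshift ^^ j) x = (\<Sum>k<n - j. h2_scale (cnj w ^ (k + j)) (h2_power k))"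
          by (rule hcoeff_eqI) (auto simp: hx if_distrib cong: if_cong)
        then show ?thesis
          by (simp add: poly s_def power_add sum_distrib_left mult_ac)
      qed
      then have "(\<Sum>j<J. ?r ^ j * (cmod (s (n - j)))\<^sup>2) = (\<Sum>j<J. (cmod (L n ((bshift ^^ j) x)))\<^sup>2)"
        by (intro sum.cong refl) (simp add: norm_mult norm_power power_mult_distrib power2_eq_square mult_ac)
      also have "\<dots> \<le> C\<^sup>2 * (norm x)\<^sup>2"
        unfolding x_def by (rule Lbd[OF polyV])
      also have "(norm x)\<^sup>2 \<le> 1 / (1 - ?r)"
      proof -
        have "(\<lambda>k. ?r ^ k) sums (1 / (1 - ?r))" using r1 by (intro geometric_sums) auto
        moreover have "(cmod (hcoeff x k))\<^sup>2 \<le> ?r ^ k" for k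
          by (auto simp: hx norm_power simp flip: power_mult) (simp add: mult.commute)
        ultimately show ?thesis using sums_le[OF _ h2_norm_sums[of x]] by blast
      qed
      finally show ?thesis by (simp add: mult_left_mono)
    qed
    have lim1: "(\<Sum>j<J. ?r ^ j * (cmod (\<phi> w))\<^sup>2) \<le> C\<^sup>2 * (1 / (1 - ?r))" for J
    proof (rule LIMSEQ_le_const2)
      have "(\<lambda>n. s (n - j)) \<longlonglongrightarrow> \<phi> w" for j
        by (rule LIMSEQ_offset[where k = j]) (simp add: s)
      then show "(\<lambda>n. \<Sum>j<J. ?r ^ j * (cmod (s (n - j)))\<^sup>2) \<longlonglongrightarrow> (\<Sum>j<J. ?r ^ j * (cmod (\<phi> w))\<^sup>2)"
        by (intro tendsto_intros)
      show "\<exists>N. \<forall>n\<ge>N. (\<Sum>j<J. ?r ^ j * (cmod (s (n - j)))\<^sup>2) \<le> C\<^sup>2 * (1 / (1 - ?r))"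
        using fin by blast
    qed
    have "(\<lambda>j. ?r ^ j * (cmod (\<phi> w))\<^sup>2) sums (1 / (1 - ?r) * (cmod (\<phi> w))\<^sup>2)"
      using r1 by (intro sums_mult2 geometric_sums) auto
    then have "1 / (1 - ?r) * (cmod (\<phi> w))\<^sup>2 \<le> C\<^sup>2 * (1 / (1 - ?r))"
      unfolding sums_def by (rule LIMSEQ_le_const2) (use lim1 in blast)
    then have "1 / (1 - ?r) * (cmod (\<phi> w))\<^sup>2 \<le> 1 / (1 - ?r) * C\<^sup>2" by (simp only: mult.commute)
    then have "(cmod (\<phi> w))\<^sup>2 \<le> C\<^sup>2" by (rule mult_left_le_imp_le) (use r1 in simp)
    then show ?thesis using C by (rule power2_le_imp_le)
  qed
  have bh: "bounded_holo \<phi> C" using hol bound C by (simp add: bounded_holo_def)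
  let ?\<Phi> = "h2_mult \<phi> (h2_power 0)"
  have \<Phi>: "hcoeff ?\<Phi> j = p j" for j
  proof -
    have "taylor_coeff (h2_fun ?\<Phi>) j = taylor_coeff \<phi> j"
      by (rule taylor_coeff_cong[where R = 1]) (auto simp: h2_fun_mult[OF bh] h2_fun_power)
    also have "\<dots> = p j"
    proof -
      have cr: "1 \<le> conv_radius p"
      proof (rule conv_radius_geI_ex')
        fix r :: real assume "0 < r" "ereal r < 1"
        then show "summable (\<lambda>n. p n * of_real r ^ n)" using sums[of "of_real r"] by (auto simp: sums_iff)
      qed
      then have "0 < conv_radius p" by (rule order_less_le_trans[rotated]) simp
      then have "eval_fps (Abs_fps p) has_fps_expansion Abs_fps p"
        by (intro eval_fps_has_fps_expansion) (simp add: fps_conv_radius_def)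
      moreover have "eval_fps (Abs_fps p) = \<phi>" by (auto simp: eval_fps_def \<phi>_def)
      ultimately show ?thesis using taylor_coeff_eqI[of \<phi> "Abs_fps p"] by simp
    qed
    finally show ?thesis .
  qed
  have "l x = h2_inner x ?\<Phi>" if x: "x \<in> bspace xs" for x
  proof -
    define P where "P n = (\<Sum>j<n. h2_scale (hcoeff x j) (h2_power j))" for n
    have xV: "x \<in> ?V n" for n using mono[of 0 n] x by auto
    define T where "T n = (\<Sum>j<n. hcoeff x j * cnj (hcoeff ?\<Phi> j))" for n
    \<comment> \<open>\<open>x\<close> and its Taylor polynomial both lie in \<open>?V n\<close>, so
      the bound for \<open>L n\<close>, which is the same for all \<open>n\<close>, applies to their
      difference.\<close>
    have est: "norm (T n - l x) \<le> C * norm (x - P n)" for n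
    proof -
      have PV: "P n \<in> ?V n" unfolding P_def by (rule polyV)
      have "L n x = L n (P n) + L n (x - P n)"
        using Ladd[OF PV bspace_diff[OF xV PV]] by simp
      moreover have "L n x = l x" using agree[of x 0 n] x L(2) by simp
      moreover have "L n (P n) = T n"
        unfolding P_def T_def by (simp add: poly \<Phi>)
      ultimately show ?thesis
        using Lnorm[OF bspace_diff[OF xV PV]] by (simp add: norm_minus_commute)
    qed
    have "(\<lambda>n. norm (x - P n)) \<longlonglongrightarrow> 0"
      unfolding P_def by (rule h2_partial_sums_tendsto)
    then have "(\<lambda>n. C * norm (x - P n)) \<longlonglongrightarrow> 0" by (rule tendsto_mult_right_zero)
    then have "(\<lambda>n. T n - l x) \<longlonglongrightarrow> 0"
      using est by (metis (no_types, lifting) Lim_null_comparison eventually_sequentiallyI)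
    then have "T \<longlonglongrightarrow> l x" by (rule LIM_zero_cancel)
    moreover have "T \<longlonglongrightarrow> h2_inner x ?\<Phi>"
      using h2_inner_sums[of x ?\<Phi>] by (simp only: sums_def T_def[abs_def])
    ultimately show ?thesis by (rule LIMSEQ_unique)
  qed
  then show ?thesis using bh by blast
qed

subsection \<open>The functional calculus\<close>

text \<open>The power series is differentiated \<open>d\<close> times term by term; division by
  \<open>fact d\<close> turns falling factorials into binomial coefficients, which are the ones in
  the powers of a Jordan block.\<close>

lemma higher_deriv_sums:
  assumes f: "f holomorphic_on unit_disc" and a: "norm a < 1"
  shows "(\<lambda>k. taylor_coeff f k * (of_nat (k choose d) * a ^ (k - d))) sums ((deriv ^^ d) f a / fact d)"
proof -
  \<comment> \<open>The expansion at 0 of the derivative of order \<open>d\<close> divided by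
    \<open>fact d\<close>.\<close>
  define G where "G d = Abs_fps (\<lambda>k. taylor_coeff f (k + d) * of_nat ((k + d) choose d))" for d
  have G0: "G 0 = fps_expansion f 0" by (rule fps_ext) (simp add: G_def)
  have Gd: "fps_deriv (G d) = fps_const (of_nat (Suc d)) * G (Suc d)" for d
  proof (rule fps_ext)
    fix k
    have "Suc k * (Suc (k + d) choose d) = Suc d * (Suc (k + d) choose Suc d)"
    proof -
      have "Suc d * (Suc (k + d) choose Suc d) = Suc (k + d) * ((k + d) choose d)"
        by (rule Suc_times_binomial_eq[symmetric, of "k + d" d, simplified mult.commute]) 
      also have "\<dots> = Suc k * (Suc (k + d) choose Suc k)"
        using Suc_times_binomial_eq[of "k + d" k] binomial_symmetric[of d "k + d"] by (simp add: mult.commute)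
      also have "Suc (k + d) choose Suc k = Suc (k + d) choose d"
        using binomial_symmetric[of d "Suc (k + d)"] by simp
      finally show ?thesis by simp
    qed
    then have "of_nat (Suc k) * of_nat (Suc (k + d) choose d) = (of_nat (Suc d) * of_nat (Suc (k + d) choose Suc d) :: complex)"
      by (simp only: flip: of_nat_mult)
    then show "fps_nth (fps_deriv (G d)) k = fps_nth (fps_const (of_nat (Suc d)) * G (Suc d)) k"
      unfolding G_def by (simp del: of_nat_Suc binomial_Suc_Suc)
  qed
  have cr: "1 \<le> fps_conv_radius (G d)" for d
  proof (induction d)
    case 0
    show ?case using conv_radius_fps_expansion[of f 0 1] f unfolding G0 by (simp add: one_ereal_def)
  next
    case (Suc d)
    have "G (Suc d) = fps_const (1 / of_nat (Suc d)) * fps_deriv (G d)"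
      unfolding Gd by (simp add: mult.assoc[symmetric] del: of_nat_Suc)
    moreover have "fps_conv_radius (fps_const (1 / of_nat (Suc d)) * fps_deriv (G d)) \<ge> fps_conv_radius (fps_deriv (G d))"
      by (rule order_trans[OF _ fps_conv_radius_mult]) simp
    ultimately show ?case using Suc fps_conv_radius_deriv[of "G d"] by (metis order_trans)
  qed
  have main: "(deriv ^^ d) f z = fact d * eval_fps (G d) z" if "norm z < 1" for d z
    using that
  proof (induction d arbitrary: z)
    case 0
    then show ?case using eval_fps_expansion'[of f 0 1 z] f unfolding G0 by (simp add: one_ereal_def)
  next
    case (Suc d)
    have in_r: "ereal (norm z) < fps_conv_radius (G d)" for d
      using Suc.prems cr[of d] by (meson ereal_less(3) less_ereal.simps(1) one_ereal_def order_less_le_trans)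
    have "(deriv ^^ Suc d) f z = deriv (\<lambda>z. fact d * eval_fps (G d) z) z"
      unfolding funpow.simps o_def
    proof (rule deriv_cong_ev)
      show "\<forall>\<^sub>F w in nhds z. (deriv ^^ d) f w = fact d * eval_fps (G d) w"
        by (rule eventually_nhds_in_open[of unit_disc, THEN eventually_mono])
          (use Suc in auto)
    qed simp
    also have "\<dots> = fact d * deriv (eval_fps (G d)) z"
      by (rule deriv_cmult)
        (use in_r in \<open>auto intro!: holomorphic_on_imp_differentiable_at[of _ "eball 0 (fps_conv_radius (G d))"]
          holomorphic_on_eval_fps simp: in_eball_iff\<close>)
    also have "deriv (eval_fps (G d)) z = eval_fps (fps_deriv (G d)) z"
      using in_r[of d] by (rule eval_fps_deriv[symmetric])
    also have "\<dots> = of_nat (Suc d) * eval_fps (G (Suc d)) z"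
      unfolding Gd using in_r[of "Suc d"] by (subst eval_fps_mult) (auto simp del: of_nat_Suc)
    finally show ?case by (simp add: mult_ac)
  qed
  have "(\<lambda>k. fps_nth (G d) k * a ^ k) sums eval_fps (G d) a"
    using a cr[of d]
    by (intro sums_eval_fps) (meson ereal_less(3) less_ereal.simps(1) one_ereal_def order_less_le_trans)
  also have "eval_fps (G d) a = (deriv ^^ d) f a / fact d"
    using main[OF a, of d] by simp
  finally have "(\<lambda>k. taylor_coeff f (k + d) * (of_nat ((k + d) choose d) * a ^ ((k + d) - d))) sums
      ((deriv ^^ d) f a / fact d)"
    by (simp add: G_def mult.assoc)
  \<comment> \<open>The terms with \<open>k < d\<close> vanish because their binomial coefficients
    do.\<close>
  then show ?thesis
    by (subst (asm) sums_zero_iff_shift[of d "\<lambda>k. taylor_coeff f k * (of_nat (k choose d) * a ^ (k - d))"]) auto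
qed

text \<open>The functional calculus on a single Jordan block: an upper triangular Toeplitz matrix of
  Taylor coefficients at the eigenvalue.\<close>

definition jordan_value :: "(complex \<Rightarrow> complex) \<Rightarrow> nat \<Rightarrow> complex \<Rightarrow> complex mat" where
  "jordan_value f n a = mat n n (\<lambda>(i, j). if i \<le> j then (deriv ^^ (j - i)) f a / fact (j - i) else 0)"

lemma jordan_value_dim [simp]: "dim_row (jordan_value f n a) = n" "dim_col (jordan_value f n a) = n"
  by (simp_all add: jordan_value_def)

lemma jordan_block_sums:
  assumes "f holomorphic_on unit_disc" "norm a < 1" "i < n" "j < n"
  shows "(\<lambda>k. taylor_coeff f k * (jordan_block n a ^\<^sub>m k) $$ (i, j)) sums (jordan_value f n a $$ (i, j))"
proof (cases "i \<le> j")
  case True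
  then have "k + i - j = k - (j - i)" for k by simp
  then show ?thesis
    using higher_deriv_sums[OF assms(1,2), of "j - i"] True assms(3,4)
    by (simp add: jordan_block_pow jordan_value_def)
qed (use assms(3,4) in \<open>simp add: jordan_block_pow jordan_value_def\<close>)

abbreviation jordan_values :: "(complex \<Rightarrow> complex) \<Rightarrow> (nat \<times> complex) list \<Rightarrow> complex mat" where
  "jordan_values f n_as \<equiv> diag_block_mat (map (\<lambda>(n, a). jordan_value f n a) n_as)"

lemma jordan_values_dim:
  "dim_row (jordan_values f n_as) = sum_list (map fst n_as)"
  "dim_col (jordan_values f n_as) = sum_list (map fst n_as)"
  by (simp_all add: dim_diag_block_mat o_def case_prod_beta)

lemma diag_block_mat_Cons_index:
  assumes "A \<in> carrier_mat n n" "diag_block_mat As \<in> carrier_mat s s" "i < n + s" "j < n + s"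
  shows "diag_block_mat (A # As) $$ (i, j) = (if i < n then if j < n then A $$ (i, j) else 0
    else if j < n then 0 else diag_block_mat As $$ (i - n, j - n))"
  using assms by (auto simp: Let_def)

lemma jordan_matrix_sums:
  assumes "f holomorphic_on unit_disc" "\<And>n a. (n, a) \<in> set n_as \<Longrightarrow> norm a < 1"
    and "i < sum_list (map fst n_as)" "j < sum_list (map fst n_as)"
  shows "(\<lambda>k. taylor_coeff f k * (jordan_matrix n_as ^\<^sub>m k) $$ (i, j)) sums (jordan_values f n_as $$ (i, j))"
  using assms(2-)
proof (induction n_as arbitrary: i j)
  case (Cons p n_as)
  obtain n a where p: "p = (n, a)" by (cases p)
  let ?s = "sum_list (map fst n_as)"
  let ?J = "\<lambda>k. diag_block_mat (map (\<lambda>(n, a). jordan_block n a ^\<^sub>m k) n_as)"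
  have dJ: "dim_row (?J k) = ?s" "dim_col (?J k) = ?s" for k
    by (simp_all add: dim_diag_block_mat o_def case_prod_beta cong: if_cong)
  have IH: "(\<lambda>k. taylor_coeff f k * ?J k $$ (i, j)) sums (jordan_values f n_as $$ (i, j))"
    if "i < ?s" "j < ?s" for i j
    using Cons.IH[of i j] Cons.prems(1) that unfolding jordan_matrix_pow by auto
  have blk: "(\<lambda>k. taylor_coeff f k * (jordan_block n a ^\<^sub>m k) $$ (i, j)) sums (jordan_value f n a $$ (i, j))"
    if "i < n" "j < n" for i j
    using Cons.prems(1)[of n a] that p by (intro jordan_block_sums[OF assms(1)]) auto
  have ij: "i < n + ?s" "j < n + ?s" using Cons.prems(2,3) p by auto
  have "(\<lambda>k. taylor_coeff f k * (if i < n then if j < n then (jordan_block n a ^\<^sub>m k) $$ (i, j) else 0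
      else if j < n then 0 else ?J k $$ (i - n, j - n))) sums
    (if i < n then if j < n then jordan_value f n a $$ (i, j) else 0
      else if j < n then 0 else jordan_values f n_as $$ (i - n, j - n))"
    using ij blk IH[of "i - n" "j - n"] by simp
  moreover have "jordan_values f (p # n_as) $$ (i, j) = (if i < n then if j < n then jordan_value f n a $$ (i, j) else 0
      else if j < n then 0 else jordan_values f n_as $$ (i - n, j - n))"
    unfolding p list.map prod.case
    by (rule diag_block_mat_Cons_index[where s = ?s]) (use ij jordan_values_dim in auto)
  moreover have "(jordan_matrix (p # n_as) ^\<^sub>m k) $$ (i, j) = (if i < n then if j < n then (jordan_block n a ^\<^sub>m k) $$ (i, j) else 0
      else if j < n then 0 else ?J k $$ (i - n, j - n))" for k
    unfolding jordan_matrix_pow p list.map prod.case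
    by (rule diag_block_mat_Cons_index[where s = ?s]) (use ij dJ in auto)
  ultimately show ?case by simp
qed simp

lemma mat_mult3_index:
  assumes "P \<in> carrier_mat n n" "X \<in> carrier_mat n n" "Q \<in> carrier_mat n n" "i < n" "j < n"
  shows "(P * X * Q) $$ (i, j) = (\<Sum>l<n. \<Sum>m<n. P $$ (i, l) * X $$ (l, m) * Q $$ (m, j))"
  using assms by (auto simp: scalar_prod_def sum_distrib_left mult.assoc atLeast0LessThan intro!: sum.cong)

lemma mat_fun_jordan:
  assumes f: "f holomorphic_on unit_disc" and wit: "similar_mat_wit A (jordan_matrix n_as) P Q"
    and ev: "\<And>n a. (n, a) \<in> set n_as \<Longrightarrow> norm a < 1"
  shows "mat_fun f A = P * jordan_values f n_as * Q"
proof -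
  define n where "n = dim_row A"
  note w = similar_mat_witD[OF n_def wit]
  have s: "sum_list (map fst n_as) = n" using w(5) by (metis carrier_matD(1) jordan_matrix_dim(1))
  have X: "jordan_values f n_as \<in> carrier_mat n n" using jordan_values_dim s by auto
  have J: "jordan_matrix n_as ^\<^sub>m k \<in> carrier_mat n n" for k using w(5) by simp
  have dA: "dim_row A = n" "dim_col A = n" using w(4) by auto
  show ?thesis
  proof (rule eq_matI)
    fix i j assume "i < dim_row (P * jordan_values f n_as * Q)" "j < dim_col (P * jordan_values f n_as * Q)"
    then have ij: "i < n" "j < n" using w by auto
    have "(\<lambda>k. taylor_coeff f k * (A ^\<^sub>m k) $$ (i, j)) sums
      (\<Sum>l<n. \<Sum>m<n. P $$ (i, l) * jordan_values f n_as $$ (l, m) * Q $$ (m, j))"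
    proof -
      have "(\<lambda>k. \<Sum>l<n. \<Sum>m<n. P $$ (i, l) * (taylor_coeff f k * (jordan_matrix n_as ^\<^sub>m k) $$ (l, m)) * Q $$ (m, j)) sums
        (\<Sum>l<n. \<Sum>m<n. P $$ (i, l) * jordan_values f n_as $$ (l, m) * Q $$ (m, j))"
        by (intro sums_sum sums_mult sums_mult2 jordan_matrix_sums[OF f ev]) (use s in auto)
      moreover have "taylor_coeff f k * (A ^\<^sub>m k) $$ (i, j) =
        (\<Sum>l<n. \<Sum>m<n. P $$ (i, l) * (taylor_coeff f k * (jordan_matrix n_as ^\<^sub>m k) $$ (l, m)) * Q $$ (m, j))" for k
        unfolding similar_mat_wit_pow_id[OF wit] mat_mult3_index[OF w(6) J w(7) ij]
        by (simp add: sum_distrib_left mult_ac)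
      ultimately show ?thesis by simp
    qed
    then show "mat_fun f A $$ (i, j) = (P * jordan_values f n_as * Q) $$ (i, j)"
      unfolding mat_mult3_index[OF w(6) X w(7) ij] using ij dA
      by (simp add: mat_fun_def sums_iff)
  qed (use w dA in \<open>auto simp: mat_fun_def\<close>)
qed

lemma jordan_values_eq_iff:
  "jordan_values f n_as = jordan_values g n_as \<longleftrightarrow>
    (\<forall>(n, a) \<in> set n_as. \<forall>d<n. (deriv ^^ d) f a = (deriv ^^ d) g a)"
proof (induction n_as)
  case (Cons p n_as)
  obtain n a where p: "p = (n, a)" by (cases p)
  let ?s = "sum_list (map fst n_as)"
  have X: "jordan_values f n_as \<in> carrier_mat ?s ?s" "jordan_values g n_as \<in> carrier_mat ?s ?s"
    using jordan_values_dim by auto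
  have "jordan_values f (p # n_as) = jordan_values g (p # n_as) \<longleftrightarrow>
    jordan_value f n a = jordan_value g n a \<and> jordan_values f n_as = jordan_values g n_as"
  proof
    assume eq: "jordan_values f (p # n_as) = jordan_values g (p # n_as)"
    have idx: "jordan_values h (p # n_as) $$ (i, j) = (if i < n then if j < n then jordan_value h n a $$ (i, j) else 0
        else if j < n then 0 else jordan_values h n_as $$ (i - n, j - n))"
      if "i < n + ?s" "j < n + ?s" for h i j
      unfolding p list.map prod.case
      by (rule diag_block_mat_Cons_index[where s = ?s]) (use that jordan_values_dim in auto)
    have e: "(if i < n then if j < n then jordan_value f n a $$ (i, j) else 0
        else if j < n then 0 else jordan_values f n_as $$ (i - n, j - n)) =
      (if i < n then if j < n then jordan_value g n a $$ (i, j) else 0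
        else if j < n then 0 else jordan_values g n_as $$ (i - n, j - n))"
      if "i < n + ?s" "j < n + ?s" for i j
      using arg_cong[OF eq, of "\<lambda>X. X $$ (i, j)"] unfolding idx[OF that] .
    have "jordan_value f n a = jordan_value g n a"
    proof (rule eq_matI)
      fix i j assume "i < dim_row (jordan_value g n a)" "j < dim_col (jordan_value g n a)"
      then show "jordan_value f n a $$ (i, j) = jordan_value g n a $$ (i, j)"
        using e[of i j] by simp
    qed simp_all
    moreover have "jordan_values f n_as = jordan_values g n_as"
    proof (rule eq_matI)
      fix i j assume "i < dim_row (jordan_values g n_as)" "j < dim_col (jordan_values g n_as)"
      then show "jordan_values f n_as $$ (i, j) = jordan_values g n_as $$ (i, j)"
        using e[of "i + n" "j + n"] X by simp
    qed (use X in auto)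
    ultimately show "jordan_value f n a = jordan_value g n a \<and> jordan_values f n_as = jordan_values g n_as" ..
  qed (simp add: p)
  also have "jordan_value f n a = jordan_value g n a \<longleftrightarrow> (\<forall>d<n. (deriv ^^ d) f a = (deriv ^^ d) g a)"
  proof
    assume eq: "jordan_value f n a = jordan_value g n a"
    show "\<forall>d<n. (deriv ^^ d) f a = (deriv ^^ d) g a"
    proof (intro allI impI)
      fix d assume d: "d < n"
      \<comment> \<open>The first row already contains every derivative of order below
        \<open>n\<close>.\<close>
      then have "jordan_value f n a $$ (0, d) = jordan_value g n a $$ (0, d)" using eq by simp
      then show "(deriv ^^ d) f a = (deriv ^^ d) g a" using d by (simp add: jordan_value_def)
    qed
  qed (auto simp: jordan_value_def intro!: cong_mat)
  finally show ?case unfolding Cons.IH by (simp add: p)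
qed simp

lemma mat_fun_eq_iff:
  assumes "f holomorphic_on unit_disc" "g holomorphic_on unit_disc" "jordan_nf A n_as"
    and ev: "\<And>n a. (n, a) \<in> set n_as \<Longrightarrow> norm a < 1"
  shows "mat_fun f A = mat_fun g A \<longleftrightarrow> (\<forall>(n, a) \<in> set n_as. \<forall>d<n. (deriv ^^ d) f a = (deriv ^^ d) g a)"
proof -
  obtain P Q where wit: "similar_mat_wit A (jordan_matrix n_as) P Q"
    using assms(3) by (auto simp: jordan_nf_def similar_mat_def)
  define n where "n = dim_row A"
  note w = similar_mat_witD[OF n_def wit]
  have s: "sum_list (map fst n_as) = n" using w(5) by (metis carrier_matD(1) jordan_matrix_dim(1))
  have X: "jordan_values h n_as \<in> carrier_mat n n" for h using jordan_values_dim s by auto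
  have inv: "Q * (P * jordan_values h n_as * Q) * P = jordan_values h n_as" for h
  proof -
    have "Q * (P * jordan_values h n_as * Q) * P = (Q * P) * jordan_values h n_as * (Q * P)"
      using w(6,7) X[of h] by (simp add: assoc_mult_mat[of _ n n _ n _ n])
    then show ?thesis using w(2) X[of h] by simp
  qed
  have mf: "mat_fun f A = P * jordan_values f n_as * Q" "mat_fun g A = P * jordan_values g n_as * Q"
    by (rule mat_fun_jordan[OF assms(1) wit], rule ev, assumption)
      (rule mat_fun_jordan[OF assms(2) wit], rule ev, assumption)
  have "mat_fun f A = mat_fun g A \<longleftrightarrow> jordan_values f n_as = jordan_values g n_as"
    using inv[of f] inv[of g] unfolding mf by metis
  then show ?thesis unfolding jordan_values_eq_iff .
qed

subsection \<open>Divisibility by Blaschke products\<close>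

definition vanishes :: "(complex \<Rightarrow> complex) \<Rightarrow> complex \<Rightarrow> nat \<Rightarrow> bool" where
  "vanishes f a m \<longleftrightarrow> (\<forall>d<m. (deriv ^^ d) f a = 0)"

lemma vanishes_iff: "vanishes f a m \<longleftrightarrow> (\<forall>d<m. fps_nth (fps_expansion f a) d = 0)"
  by (simp add: vanishes_def fps_expansion_def)

lemma fps_expansion_eqI:
  assumes "(\<lambda>w. f (a + w)) has_fps_expansion F"
  shows "fps_expansion f a = F"
proof (rule fps_ext)
  fix k
  have "(deriv ^^ k) (\<lambda>w. f (a + w)) 0 = (deriv ^^ k) f a"
    by (subst (2) higher_deriv_shift_0) (simp add: o_def)
  then show "fps_nth (fps_expansion f a) k = fps_nth F k"
    using fps_nth_fps_expansion[OF assms, of k] by (simp add: fps_expansion_def)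
qed

lemma disc_has_fps_expansion:
  assumes "f holomorphic_on unit_disc" "norm a < 1"
  shows "(\<lambda>w. f (a + w)) has_fps_expansion fps_expansion f a"
  using assms by (intro analytic_at_imp_has_fps_expansion)
    (auto simp: analytic_at intro!: exI[of _ unit_disc])

lemma disc_expansion_mult:
  assumes "u holomorphic_on unit_disc" "g holomorphic_on unit_disc" "norm a < 1"
    and eq: "\<And>z. norm z < 1 \<Longrightarrow> f z = u z * g z"
  shows "fps_expansion f a = fps_expansion u a * fps_expansion g a"
proof -
  have "fps_expansion f a = fps_expansion (\<lambda>z. u z * g z) a"
    using eq assms(3) by (intro fps_expansion_cong eventually_nhds_in_open[of unit_disc, THEN eventually_mono]) auto
  also have "\<dots> = fps_expansion u a * fps_expansion g a"
    by (rule fps_expansion_eqI) (intro has_fps_expansion_mult disc_has_fps_expansion assms)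
  finally show ?thesis .
qed

lemma vanishes_cancel:
  assumes "u holomorphic_on unit_disc" "g holomorphic_on unit_disc" "norm a < 1"
    and eq: "\<And>z. norm z < 1 \<Longrightarrow> f z = u z * g z" and u: "u a \<noteq> 0" and f: "vanishes f a m"
  shows "vanishes g a m"
proof -
  let ?U = "fps_expansion u a"
  have "fps_nth ?U 0 \<noteq> 0" using u by (simp add: fps_expansion_def)
  moreover have "fps_expansion f a = ?U * fps_expansion g a"
    by (rule disc_expansion_mult[OF assms(1-3)]) (rule eq)
  ultimately have "fps_expansion g a = inverse ?U * fps_expansion f a"
    by (simp add: inverse_mult_eq_1 flip: mult.assoc)
  then show ?thesis using f unfolding vanishes_iff by (simp add: fps_mult_nth)
qed

text \<open>A Blaschke factor is \<open>z - a\<close> times a zero-free function, so the expansion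
  of \<open>f\<close> at \<open>a\<close> is that of another function shifted by \<open>m\<close>
  places, and its coefficient at \<open>m\<close> is a nonzero multiple of
  \<open>g a\<close>.\<close>

lemma blaschke_power_expansion:
  assumes g: "g holomorphic_on unit_disc" and a: "norm a < 1"
    and eq: "\<And>z. norm z < 1 \<Longrightarrow> f z = blaschke_factor a z ^ m * g z"
  shows "vanishes f a m" and "(deriv ^^ m) f a = 0 \<longleftrightarrow> g a = 0"
proof -
  define u where "u z = - 1 / (1 - cnj a * z)" for z
  have u: "u holomorphic_on unit_disc"
    unfolding u_def[abs_def] using one_minus_cnj_mult_nonzero[OF a] by (intro holomorphic_intros) auto
  have ua: "u a \<noteq> 0" using one_minus_cnj_mult_nonzero[OF a, of a] a by (simp add: u_def)
  have bu: "blaschke_factor a z = (z - a) * u z" for z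
    by (simp only: blaschke_factor_def u_def times_divide_eq_right) simp
  define h where "h z = u z ^ m * g z" for z
  have h: "h holomorphic_on unit_disc" unfolding h_def[abs_def] by (intro holomorphic_intros u g)
  have E: "fps_expansion f a = fps_expansion (\<lambda>z. (z - a) ^ m) a * fps_expansion h a"
    by (rule disc_expansion_mult[OF _ h a]) (auto intro!: holomorphic_intros simp: eq bu h_def power_mult_distrib)
  have "fps_expansion (\<lambda>z. (z - a) ^ m) a = fps_X ^ m"
    by (rule fps_expansion_eqI) (simp add: has_fps_expansion_fps_X_power)
  then have nth: "fps_nth (fps_expansion f a) d = (if d < m then 0 else fps_nth (fps_expansion h a) (d - m))" for d
    unfolding E by (simp add: fps_X_power_mult_nth)
  then show "vanishes f a m" by (simp add: vanishes_iff)
  show "(deriv ^^ m) f a = 0 \<longleftrightarrow> g a = 0"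
  proof -
    have "(deriv ^^ m) f a = fact m * (u a ^ m * g a)"
      using nth[of m] by (simp add: fps_expansion_def h_def field_simps)
    then show ?thesis using ua by simp
  qed
qed

lemma vanishes_imp_factor:
  assumes f: "f holomorphic_on unit_disc" and a: "norm a < 1" and "vanishes f a m"
  shows "\<exists>g. g holomorphic_on unit_disc \<and> (\<forall>z\<in>unit_disc. f z = blaschke_factor a z ^ m * g z)"
  using assms(3)
proof (induction m)
  case 0
  then show ?case using f by auto
next
  case (Suc m)
  then have "vanishes f a m" by (simp add: vanishes_def)
  then obtain g where g: "g holomorphic_on unit_disc" "\<forall>z\<in>unit_disc. f z = blaschke_factor a z ^ m * g z"
    using Suc.IH by blast
  have "(deriv ^^ m) f a = 0" using Suc.prems by (simp add: vanishes_def)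
  then have "g a = 0" using blaschke_power_expansion(2)[OF g(1) a, of f m] g(2) by simp
  then obtain g' where g': "g' holomorphic_on unit_disc" "\<forall>z\<in>unit_disc. g z = blaschke_factor a z * g' z"
    using holomorphic_divide_blaschke_factor[OF g(1) a] by blast
  then show ?case using g by (intro exI[of _ g']) (auto simp: mult_ac)
qed

lemma blaschke_factor_nonzero:
  assumes "norm a < 1" "norm z < 1" "z \<noteq> a"
  shows "blaschke_factor a z \<noteq> 0"
  using assms one_minus_cnj_mult_nonzero[of a z] by (simp add: blaschke_factor_def)

text \<open>One point is divided out at a time: the factors of the other points are nonzero at
  \<open>a\<close>, so the vanishing at \<open>a\<close> passes to the quotient.\<close>

lemma divisible_iff_vanishes:
  assumes f: "f holomorphic_on unit_disc" and "finite E" "E \<subseteq> unit_disc"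
  shows "(\<forall>a\<in>E. vanishes f a (m a)) \<longleftrightarrow>
    (\<exists>g. g holomorphic_on unit_disc \<and> (\<forall>z\<in>unit_disc. f z = (\<Prod>a\<in>E. blaschke_factor a z ^ m a) * g z))"
  (is "?L \<longleftrightarrow> ?R")
proof
  assume ?L
  with assms(2,3) show ?R
  proof (induction E rule: finite_induct)
    case empty
    then show ?case using f by auto
  next
    case (insert a E)
    then obtain g where g: "g holomorphic_on unit_disc"
      "\<forall>z\<in>unit_disc. f z = (\<Prod>a\<in>E. blaschke_factor a z ^ m a) * g z"
      by auto
    have a: "norm a < 1" using insert.prems by simp
    have "vanishes g a (m a)"
    proof (rule vanishes_cancel[OF _ g(1) a])
      show "(\<lambda>z. \<Prod>a\<in>E. blaschke_factor a z ^ m a) holomorphic_on unit_disc"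
        using insert.prems bounded_holo_blaschke_factor by (intro holomorphic_intros) (auto simp: bounded_holo_def)
      show "(\<Prod>b\<in>E. blaschke_factor b a ^ m b) \<noteq> 0"
      proof -
        have "blaschke_factor b a \<noteq> 0" if "b \<in> E" for b
          using insert.prems insert(2) that by (intro blaschke_factor_nonzero[OF _ a]) auto
        then show ?thesis using insert(1) by simp
      qed
      show "vanishes f a (m a)" using insert.prems by simp
    qed (use g in auto)
    then obtain g' where "g' holomorphic_on unit_disc" "\<forall>z\<in>unit_disc. g z = blaschke_factor a z ^ m a * g' z"
      using vanishes_imp_factor[OF g(1) a] by blast
    then show ?case using g insert(1,2) by (intro exI[of _ g']) (auto simp: mult_ac)
  qed
next
  assume ?R
  then obtain g where g: "g holomorphic_on unit_disc"
    "\<And>z. z \<in> unit_disc \<Longrightarrow> f z = (\<Prod>a\<in>E. blaschke_factor a z ^ m a) * g z" by auto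
  show ?L
  proof
    fix a assume a: "a \<in> E"
    let ?h = "\<lambda>z. (\<Prod>b\<in>E - {a}. blaschke_factor b z ^ m b) * g z"
    have "?h holomorphic_on unit_disc"
      using assms(3) bounded_holo_blaschke_factor by (intro holomorphic_intros g) (auto simp: bounded_holo_def)
    then show "vanishes f a (m a)"
      by (rule blaschke_power_expansion(1)) (use a assms g(2) in \<open>auto simp: prod.remove[of E a]\<close>)
  qed
qed

text \<open>On a Jordan block of size \<open>k\<close>, equal values mean equal derivatives of order
  below \<open>k\<close>; for each eigenvalue the largest block decides, and its size is the
  multiplicity in \<open>mat_blaschke\<close>. The list is nonempty because a matrix of positive
  dimension has an eigenvalue.\<close>

lemma matrix_blaschke:
  assumes sq: "square_mat A" and pos: "dim_row A > 0" and sp: "spectrum A \<subseteq> unit_disc"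
  shows "\<exists>xs. xs \<noteq> [] \<and> set xs \<subseteq> unit_disc \<and> mat_blaschke A = blaschke_prod xs \<and>
    (\<forall>f g. f holomorphic_on unit_disc \<longrightarrow> g holomorphic_on unit_disc \<longrightarrow>
      (mat_fun f A = mat_fun g A \<longleftrightarrow>
        (\<exists>h. h holomorphic_on unit_disc \<and> (\<forall>z\<in>unit_disc. f z - g z = blaschke_prod xs z * h z))))"
proof -
  define n where "n = dim_row A"
  have A: "A \<in> carrier_mat n n" using sq by (auto simp: n_def)
  obtain n_as where jnf: "jordan_nf A n_as"
    using char_poly_factorized[OF A] jordan_nf_exists[OF A] by blast
  have pos_blocks: "k > 0" if "(k, a) \<in> set n_as" for k a
    using jnf that by (force simp: jordan_nf_def)
  have spec: "spectrum A = snd ` set n_as"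
  proof -
    have "poly (char_poly A) a = 0 \<longleftrightarrow> a \<in> snd ` set n_as" for a
      unfolding jordan_nf_char_poly[OF jnf] using pos_blocks
      by (induction n_as) (auto simp: poly_power, (metis less_irrefl)+)
    then show ?thesis unfolding spectrum_root_char_poly[OF A] by blast
  qed
  have ev: "norm a < 1" if "(k, a) \<in> set n_as" for k a
    using sp that spec by force
  have fin: "finite (spectrum A)" using spec by simp
  have ne: "spectrum A \<noteq> {}"
    using spectrum_non_empty[OF A] pos n_def by simp
  let ?m = "eigenvalue_order A"
  have m: "?m a = Max {k. (k, a) \<in> set n_as}" for a by (rule eigenvalue_order_eq[OF jnf])
  have finm: "finite {k. (k, a) \<in> set n_as}" for a
    by (rule finite_subset[of _ "fst ` set n_as"]) force+
  have m_ge: "k \<le> ?m a" if "(k, a) \<in> set n_as" for k a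
    unfolding m using finm that by (intro Max_ge) auto
  have m_in: "(?m a, a) \<in> set n_as" if "a \<in> spectrum A" for a
    using Max_in[OF finm, of a] that spec unfolding m by force
  obtain es where es: "set es = spectrum A" "distinct es" using finite_distinct_list[OF fin] by blast
  let ?xs = "concat (map (\<lambda>a. replicate (?m a) a) es)"
  have rep: "blaschke_prod (replicate k a) z = blaschke_factor a z ^ k" for k a z
    by (induction k) auto
  have B: "blaschke_prod ?xs z = (\<Prod>a\<in>spectrum A. blaschke_factor a z ^ ?m a)" for z
    using blaschke_prod_concat[OF es(2), of "\<lambda>a. replicate (?m a) a" z] by (simp add: es(1) rep)
  show ?thesis
  proof (intro exI[of _ ?xs] conjI allI impI)
    obtain a where a: "a \<in> spectrum A" using ne by blast
    then have "0 < ?m a" using m_in pos_blocks by blast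
    then show "?xs \<noteq> []" using a es(1) by auto
    show "set ?xs \<subseteq> unit_disc" using sp es(1) by auto
    show "mat_blaschke A = blaschke_prod ?xs"
      by (rule ext) (simp add: mat_blaschke_def B)
    fix f g assume f: "f holomorphic_on unit_disc" and g: "g holomorphic_on unit_disc"
    have fg: "(\<lambda>z. f z - g z) holomorphic_on unit_disc" using f g by (intro holomorphic_intros)
    have d: "(deriv ^^ d) (\<lambda>z. f z - g z) a = (deriv ^^ d) f a - (deriv ^^ d) g a" if "norm a < 1" for d a
      using that by (intro higher_deriv_diff[OF f g]) auto
    have "mat_fun f A = mat_fun g A \<longleftrightarrow> (\<forall>(k, a) \<in> set n_as. \<forall>d<k. (deriv ^^ d) f a = (deriv ^^ d) g a)"
      by (rule mat_fun_eq_iff[OF f g jnf ev])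
    also have "\<dots> \<longleftrightarrow> (\<forall>a\<in>spectrum A. vanishes (\<lambda>z. f z - g z) a (?m a))"
    proof
      assume *: "\<forall>(k, a) \<in> set n_as. \<forall>d<k. (deriv ^^ d) f a = (deriv ^^ d) g a"
      show "\<forall>a\<in>spectrum A. vanishes (\<lambda>z. f z - g z) a (?m a)"
        unfolding vanishes_def using * m_in d ev by fastforce
    next
      assume *: "\<forall>a\<in>spectrum A. vanishes (\<lambda>z. f z - g z) a (?m a)"
      show "\<forall>(k, a) \<in> set n_as. \<forall>d<k. (deriv ^^ d) f a = (deriv ^^ d) g a"
      proof safe
        fix k a j assume ka: "(k, a) \<in> set n_as" "j < k"
        then have "a \<in> spectrum A" "j < ?m a" using spec m_ge[OF ka(1)] by force+
        then have "(deriv ^^ j) (\<lambda>z. f z - g z) a = 0" using * by (simp add: vanishes_def)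
        then show "(deriv ^^ j) f a = (deriv ^^ j) g a" using d[OF ev[OF ka(1)]] by simp
      qed
    qed
    also have "\<dots> \<longleftrightarrow> (\<exists>h. h holomorphic_on unit_disc \<and> (\<forall>z\<in>unit_disc. f z - g z = blaschke_prod ?xs z * h z))"
      unfolding B by (rule divisible_iff_vanishes[OF fg fin sp])
    finally show "mat_fun f A = mat_fun g A \<longleftrightarrow>
      (\<exists>h. h holomorphic_on unit_disc \<and> (\<forall>z\<in>unit_disc. f z - g z = blaschke_prod ?xs z * h z))" .
  qed
qed

subsection \<open>Congruence modulo a Blaschke product\<close>

definition blaschke_cong :: "complex list \<Rightarrow> (complex \<Rightarrow> complex) \<Rightarrow> (complex \<Rightarrow> complex) \<Rightarrow> bool" where
  "blaschke_cong xs f g \<longleftrightarrow>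
    (\<exists>h. h holomorphic_on unit_disc \<and> (\<forall>z\<in>unit_disc. f z - g z = blaschke_prod xs z * h z))"

lemma blaschke_cong_refl: "blaschke_cong xs f f"
  unfolding blaschke_cong_def by (intro exI[of _ "\<lambda>_. 0"]) auto

lemma blaschke_cong_diff:
  assumes "blaschke_cong xs f g" "blaschke_cong xs f' g'"
  shows "blaschke_cong xs (\<lambda>z. f z - f' z) (\<lambda>z. g z - g' z)"
proof -
  obtain h h' where "h holomorphic_on unit_disc" "\<forall>z\<in>unit_disc. f z - g z = blaschke_prod xs z * h z"
    "h' holomorphic_on unit_disc" "\<forall>z\<in>unit_disc. f' z - g' z = blaschke_prod xs z * h' z"
    using assms unfolding blaschke_cong_def by auto
  then show ?thesis
    unfolding blaschke_cong_def
    by (intro exI[of _ "\<lambda>z. h z - h' z"]) (auto intro!: holomorphic_intros simp: algebra_simps)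
qed

lemma bounded_holo_diff:
  assumes "bounded_holo f C" "bounded_holo g D"
  shows "bounded_holo (\<lambda>z. f z - g z) (C + D)"
proof -
  have "cmod (f z - g z) \<le> C + D" if "z \<in> unit_disc" for z
  proof -
    have "cmod (f z) \<le> C" "cmod (g z) \<le> D" using assms that by (auto simp: bounded_holo_def)
    then show ?thesis using norm_triangle_ineq4[of "f z" "g z"] by linarith
  qed
  then show ?thesis
    using assms by (auto simp: bounded_holo_def intro!: holomorphic_intros simp del: mem_ball)
qed

lemma bounded_holo_mono: "bounded_holo f C \<Longrightarrow> C \<le> D \<Longrightarrow> bounded_holo f D"
  by (force simp: bounded_holo_def)

lemma bounded_holo_const: "bounded_holo (\<lambda>_. c) (cmod c)"
  by (simp add: bounded_holo_def)

lemma bounded_holo_montel: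
  assumes "\<And>k. bounded_holo (F k) R"
  obtains g r where "bounded_holo g R" "strict_mono (r :: nat \<Rightarrow> nat)"
    "\<And>z. norm z < 1 \<Longrightarrow> (\<lambda>k. F (r k) z) \<longlonglongrightarrow> g z"
proof -
  obtain g r where g: "g holomorphic_on unit_disc" "strict_mono (r :: nat \<Rightarrow> nat)"
    "\<And>z. z \<in> unit_disc \<Longrightarrow> (\<lambda>k. F (r k) z) \<longlonglongrightarrow> g z"
  proof (rule Montel[of unit_disc "{h. bounded_holo h R}" F])
    show "\<exists>B. \<forall>h\<in>{h. bounded_holo h R}. \<forall>z\<in>K. cmod (h z) \<le> B" if "K \<subseteq> unit_disc" for K
      using that by (intro exI[of _ R]) (auto simp: bounded_holo_def)
  qed (use assms in \<open>auto simp: bounded_holo_def\<close>)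
  have "cmod (g z) \<le> R" if "z \<in> unit_disc" for z
    using assms that by (intro LIMSEQ_le_const2[OF tendsto_norm[OF g(3)[OF that]]]) (auto simp: bounded_holo_def)
  then have "bounded_holo g R"
    using g(1) assms by (auto simp: bounded_holo_def)
  then show ?thesis using that g by auto
qed

text \<open>To carry divisibility to the limit, the quotients are made to converge as well: division
  by a Blaschke product keeps the bound \<open>R + C\<close>, so Montel's theorem applies to them a
  second time.\<close>

lemma interpolation_limit:
  assumes xs: "\<And>n. set (xs n) \<subseteq> unit_disc" and \<phi>: "\<And>n. bounded_holo (\<phi> n) C"
    and fin: "\<And>N. \<exists>\<psi>. bounded_holo \<psi> R \<and> (\<forall>n<N. blaschke_cong (xs n) \<psi> (\<phi> n))"
  shows "\<exists>\<psi>. bounded_holo \<psi> R \<and> (\<forall>n::nat. blaschke_cong (xs n) \<psi> (\<phi> n))"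
proof -
  obtain \<psi> where \<psi>: "\<And>N. bounded_holo (\<psi> N) R" "\<And>N n. n < N \<Longrightarrow> blaschke_cong (xs n) (\<psi> N) (\<phi> n)"
    using fin by metis
  obtain g r where g: "bounded_holo g R" "strict_mono (r :: nat \<Rightarrow> nat)"
    "\<And>z. norm z < 1 \<Longrightarrow> (\<lambda>k. \<psi> (r k) z) \<longlonglongrightarrow> g z"
    by (rule bounded_holo_montel[of \<psi> R, OF \<psi>(1)], rule that)
  have "blaschke_cong (xs n) g (\<phi> n)" for n
  proof -
    \<comment> \<open>The shift by \<open>Suc n\<close> discards the interpolants that do not yet
      treat the index \<open>n\<close>.\<close>
    have "n < r (k + Suc n)" for k
      using seq_suble[OF g(2), of "k + Suc n"] by linarith
    then have "\<forall>k. \<exists>h. h holomorphic_on unit_disc \<and>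
      (\<forall>z\<in>unit_disc. \<psi> (r (k + Suc n)) z - \<phi> n z = blaschke_prod (xs n) z * h z)"
      using \<psi>(2) unfolding blaschke_cong_def by blast
    then obtain h where h: "\<And>k. h k holomorphic_on unit_disc"
      "\<And>k z. z \<in> unit_disc \<Longrightarrow> \<psi> (r (k + Suc n)) z - \<phi> n z = blaschke_prod (xs n) z * h k z"
      by metis
    have "bounded_holo (h k) (R + C)" for k
    proof -
      note b = bounded_holo_diff[OF \<psi>(1) \<phi>, of "r (k + Suc n)" n]
      have "cmod (blaschke_prod (xs n) w * h k w) \<le> R + C" if "norm w < 1" for w
      proof -
        have w: "w \<in> unit_disc" using that by simp
        show ?thesis unfolding h(2)[OF w, symmetric] using b w by (auto simp: bounded_holo_def)
      qed
      then have "cmod (h k z) \<le> R + C" if "norm z < 1" for z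
        using bounded_divide_blaschke[OF xs h(1) _ that] by blast
      then show ?thesis using h(1) b by (auto simp: bounded_holo_def)
    qed
    from bounded_holo_montel[of h "R + C", OF this] obtain h' s where h': "bounded_holo h' (R + C)" "strict_mono (s :: nat \<Rightarrow> nat)"
      "\<And>z. norm z < 1 \<Longrightarrow> (\<lambda>k. h (s k) z) \<longlonglongrightarrow> h' z"
      by blast
    have "g z - \<phi> n z = blaschke_prod (xs n) z * h' z" if z: "norm z < 1" for z
    proof -
      have "strict_mono (\<lambda>k. s k + Suc n)"
        using h'(2) by (auto simp: strict_mono_def)
      then have "(\<lambda>k. \<psi> (r (s k + Suc n)) z) \<longlonglongrightarrow> g z"
        using LIMSEQ_subseq_LIMSEQ[OF g(3)[OF z], of "\<lambda>k. s k + Suc n"] by (simp add: o_def)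
      then have "(\<lambda>k. \<psi> (r (s k + Suc n)) z - \<phi> n z) \<longlonglongrightarrow> g z - \<phi> n z"
        by (intro tendsto_intros)
      moreover have "(\<lambda>k. blaschke_prod (xs n) z * h (s k) z) \<longlonglongrightarrow> blaschke_prod (xs n) z * h' z"
        by (intro tendsto_intros h'(3) z)
      ultimately show ?thesis
        using h(2) z by (simp add: LIMSEQ_unique)
    qed
    then show ?thesis
      unfolding blaschke_cong_def using h'(1) by (intro exI[of _ h']) (auto simp: bounded_holo_def)
  qed
  then show ?thesis using g(1) by blast
qed

text \<open>The bound \<open>R\<close> may depend on the data here; a uniform constant has to be
  proved.\<close>

definition blaschke_interpolating :: "(nat \<Rightarrow> complex list) \<Rightarrow> bool" where
  "blaschke_interpolating xs \<longleftrightarrow>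
    (\<forall>\<phi> C. (\<forall>n. bounded_holo (\<phi> n) C) \<longrightarrow> (\<exists>\<psi> R. bounded_holo \<psi> R \<and> (\<forall>n. blaschke_cong (xs n) \<psi> (\<phi> n))))"

subsection \<open>Interpolating sequences are strongly separated\<close>

text \<open>The interpolation constant for 0-1 valued data is bounded by a category argument on the
  Cantor space: if no cylinder were interpolated with a uniform bound, then a limit point of nested
  cylinders could not be interpolated at all.\<close>

lemma uniform_cylinder:
  fixes E :: "nat \<Rightarrow> nat \<Rightarrow> (nat \<Rightarrow> bool) \<Rightarrow> bool"
  assumes anti: "\<And>M N N' s. E M N' s \<Longrightarrow> N \<le> N' \<Longrightarrow> E M N s"
    and local: "\<And>M N s t. (\<And>i. i < N \<Longrightarrow> s i = t i) \<Longrightarrow> E M N s \<Longrightarrow> E M N t"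
    and mono: "\<And>M M' N s. E M N s \<Longrightarrow> M \<le> M' \<Longrightarrow> E M' N s"
    and ex: "\<And>s. \<exists>M. \<forall>N. E M N s"
  shows "\<exists>M N s. \<forall>t. (\<forall>i<N. t i = s i) \<longrightarrow> (\<forall>N'. E M N' t)"
proof (rule ccontr)
  assume no: "\<not> ?thesis"
  have bad: "\<exists>t N'. (\<forall>i<N. t i = s i) \<and> \<not> E M N' t" for M N s
  proof (rule ccontr)
    assume "\<nexists>t N'. (\<forall>i<N. t i = s i) \<and> \<not> E M N' t"
    then have "\<forall>t. (\<forall>i<N. t i = s i) \<longrightarrow> (\<forall>N'. E M N' t)" by blast
    then have "\<exists>M N s. \<forall>t. (\<forall>i<N. t i = s i) \<longrightarrow> (\<forall>N'. E M N' t)" by (intro exI)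
    with no show False by (rule notE)
  qed
  \<comment> \<open>A stage is a 0-1 sequence together with the number of its entries that are fixed
    from then on; the bound \<open>k\<close> fails at stage \<open>Suc k\<close>.\<close>
  have "\<exists>f. \<forall>k. True \<and> (snd (f k) < snd (f (Suc k)) \<and> (\<forall>i<snd (f k). fst (f (Suc k)) i = fst (f k) i) \<and>
      \<not> E k (snd (f (Suc k))) (fst (f (Suc k))))"
  proof (rule dependent_nat_choice)
    fix p :: "(nat \<Rightarrow> bool) \<times> nat" and k
    obtain t N' where t: "\<forall>i<snd p. t i = fst p i" "\<not> E k N' t" using bad[of "snd p" "fst p" k] by blast
    have "\<not> E k (max N' (Suc (snd p))) t" using t(2) anti[of k "max N' (Suc (snd p))" t N'] by auto
    then show "\<exists>y. True \<and> (snd p < snd y \<and> (\<forall>i<snd p. fst y i = fst p i) \<and> \<not> E k (snd y) (fst y))"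
      using t(1) by (intro exI[of _ "(t, max N' (Suc (snd p)))"]) auto
  qed simp
  then obtain f where f: "\<And>k. snd (f k) < snd (f (Suc k))" "\<And>k i. i < snd (f k) \<Longrightarrow> fst (f (Suc k)) i = fst (f k) i"
    "\<And>k. \<not> E k (snd (f (Suc k))) (fst (f (Suc k)))"
    by blast
  have smono: "strict_mono (\<lambda>k. snd (f k))" by (intro strict_mono_Suc_iff[THEN iffD2] allI f(1))
  have agree: "fst (f m) i = fst (f k) i" if "i < snd (f k)" "k \<le> m" for i k m
    using that(2)
  proof (induction m rule: dec_induct)
    case (step m)
    have "snd (f k) \<le> snd (f m)" using strict_mono_less_eq[OF smono, of k m] step.hyps(1) by simp
    then show ?case using f(2)[of i m] that(1) step.IH by simp
  qed simp
  \<comment> \<open>Entry \<open>i\<close> is settled by stage \<open>Suc i\<close>, since the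
    number of fixed entries grows strictly.\<close>
  define t where "t i = fst (f (Suc i)) i" for i
  have t: "t i = fst (f k) i" if "i < snd (f k)" for i k
  proof (cases "Suc i \<le> k")
    case True
    have "Suc i \<le> snd (f (Suc i))" using seq_suble[OF smono, of "Suc i"] .
    then show ?thesis using agree[of i "Suc i" k] True by (simp add: t_def)
  next
    case False
    then show ?thesis using agree[OF that, of "Suc i"] by (simp add: t_def)
  qed
  obtain M where "\<And>N. E M N t" using ex by blast
  then have "E M (snd (f (Suc M))) (fst (f (Suc M)))"
    using local[of "snd (f (Suc M))" t "fst (f (Suc M))"] t by blast
  then show False using f(3) by blast
qed

text \<open>A uniform bound on a cylinder of length \<open>N\<close> handles the indices from
  \<open>N\<close> on: the wanted function is a difference of two interpolants whose data lie in the
  cylinder and differ at one index. The finitely many smaller indices enter through their individual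
  bounds.\<close>

lemma interpolating_uniform:
  assumes xs: "\<And>n. set (xs n) \<subseteq> unit_disc" and int: "blaschke_interpolating xs"
  shows "\<exists>C. \<forall>n. \<exists>f. bounded_holo f C \<and> (\<forall>j. blaschke_cong (xs j) f (\<lambda>_. if j = n then 1 else 0))"
proof -
  define E where "E M N s \<longleftrightarrow> (\<exists>\<psi>. bounded_holo \<psi> (real M) \<and>
      (\<forall>n<N. blaschke_cong (xs n) \<psi> (\<lambda>_. if s n then 1 else 0)))" for M N and s :: "nat \<Rightarrow> bool"
  have const: "bounded_holo (\<lambda>_. if b then 1 else 0) 1" for b
    by (simp add: bounded_holo_def)
  have ex: "\<exists>\<psi> R. bounded_holo \<psi> R \<and> (\<forall>n. blaschke_cong (xs n) \<psi> (\<lambda>_. if s n then 1 else 0))" for s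
    by (rule int[unfolded blaschke_interpolating_def, rule_format, of "\<lambda>n _. if s n then 1 else 0" 1]) (rule const)
  have "\<exists>M N s. \<forall>t. (\<forall>i<N. t i = s i) \<longrightarrow> (\<forall>N'. E M N' t)"
  proof (rule uniform_cylinder)
    show "\<exists>M. \<forall>N. E M N s" for s
    proof -
      obtain \<psi> R where \<psi>: "bounded_holo \<psi> R" "\<forall>n. blaschke_cong (xs n) \<psi> (\<lambda>_. if s n then 1 else 0)"
        using ex by blast
      obtain M :: nat where "R \<le> real M" using real_arch_simple by blast
      then show ?thesis using \<psi> bounded_holo_mono unfolding E_def by blast
    qed
  next
    fix M N N' s assume "E M N' s" "N \<le> N'"
    then show "E M N s" unfolding E_def by (meson order_less_le_trans)
  next
    fix M N s t assume st: "\<And>i. i < N \<Longrightarrow> s i = t i" and "E M N s"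
    then obtain \<psi> where "bounded_holo \<psi> (real M)" "\<forall>n<N. blaschke_cong (xs n) \<psi> (\<lambda>_. if s n then 1 else 0)"
      unfolding E_def by blast
    then show "E M N t" unfolding E_def using st by (intro exI[of _ \<psi>]) simp
  next
    fix M M' N s assume "E M N s" and M: "M \<le> M'"
    then show "E M' N s" unfolding E_def using bounded_holo_mono[OF _ of_nat_mono[OF M]] by blast
  qed
  then obtain M N s where "\<forall>t. (\<forall>i<N. t i = s i) \<longrightarrow> (\<forall>N'. E M N' t)" by (elim exE)
  then have MN: "E M N' t" if "\<forall>i<N. t i = s i" for t N' using that by blast
  have lim: "\<exists>\<psi>. bounded_holo \<psi> (real M) \<and> (\<forall>n. blaschke_cong (xs n) \<psi> (\<lambda>_. if t n then 1 else 0))"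
    if "\<forall>i<N. t i = s i" for t
    using MN[OF that] unfolding E_def by (intro interpolation_limit[OF xs const]) auto
  have large: "\<exists>f. bounded_holo f (2 * M) \<and> (\<forall>j. blaschke_cong (xs j) f (\<lambda>_. if j = n then 1 else 0))" if "N \<le> n" for n
  proof -
    obtain f1 where f1: "bounded_holo f1 M" "\<forall>j. blaschke_cong (xs j) f1 (\<lambda>_. if (if j < N then s j else j = n) then 1 else 0)"
      using lim[of "\<lambda>j. if j < N then s j else j = n"] by auto
    obtain f0 where f0: "bounded_holo f0 M" "\<forall>j. blaschke_cong (xs j) f0 (\<lambda>_. if (if j < N then s j else False) then 1 else 0)"
      using lim[of "\<lambda>j. if j < N then s j else False"] by auto
    have "blaschke_cong (xs j) (\<lambda>z. f1 z - f0 z) (\<lambda>_. if j = n then 1 else 0)" for j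
    proof -
      have "(\<lambda>z::complex. (if (if j < N then s j else j = n) then 1 else 0) - (if (if j < N then s j else False) then 1 else 0)) =
        (\<lambda>_. if j = n then 1 else (0::complex))" using that by auto
      then show ?thesis using blaschke_cong_diff[OF f1(2)[rule_format, of j] f0(2)[rule_format, of j]] by simp
    qed
    moreover have "bounded_holo (\<lambda>z. f1 z - f0 z) (2 * M)"
    proof -
      have "real M + real M = real (2 * M)" by simp
      then show ?thesis using bounded_holo_diff[OF f1(1) f0(1)] by (simp only: of_nat_mult of_nat_numeral)
    qed
    ultimately show ?thesis by blast
  qed
  have "\<exists>f R. bounded_holo f R \<and> (\<forall>j. blaschke_cong (xs j) f (\<lambda>_. if j = n then 1 else 0))" for n
    using ex[of "\<lambda>j. j = n"] by simp
  then obtain f R where fR: "\<And>n. bounded_holo (f n) (R n)"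
    "\<And>n j. blaschke_cong (xs j) (f n) (\<lambda>_. if j = n then 1 else 0)"
    by metis
  have R0: "0 \<le> R n" for n using fR(1)[of n] by (simp add: bounded_holo_def)
  let ?C = "2 * M + (\<Sum>n<N. R n)"
  have "\<exists>f. bounded_holo f ?C \<and> (\<forall>j. blaschke_cong (xs j) f (\<lambda>_. if j = n then 1 else 0))" for n
  proof (cases "n < N")
    case True
    have "R n \<le> (\<Sum>n<N. R n)" using True R0 by (intro member_le_sum) auto
    then show ?thesis using fR bounded_holo_mono[of "f n" "R n" ?C] by (intro exI[of _ "f n"]) auto
  next
    case False
    have "0 \<le> (\<Sum>n<N. R n)" using R0 by (intro sum_nonneg) auto
    then have le: "2 * M \<le> ?C" by simp
    obtain f where "bounded_holo f (2 * M)" "\<forall>j. blaschke_cong (xs j) f (\<lambda>_. if j = n then 1 else 0)"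
      using large[OF leI[OF False]] by blast
    then show ?thesis using bounded_holo_mono[OF _ le] by blast
  qed
  then show ?thesis by blast
qed

text \<open>The quotient of \<open>f\<close> by the product is bounded, hence itself a
  multiplier.\<close>

lemma multiple_perp:
  assumes xs: "set xs \<subseteq> unit_disc" and f: "bounded_holo f C" and c: "blaschke_cong xs f (\<lambda>_. 0)"
    and k: "k \<in> bspace xs"
  shows "h2_inner k (h2_mult f g) = 0"
proof -
  obtain h where h: "h holomorphic_on unit_disc" "\<And>z. norm z < 1 \<Longrightarrow> f z = blaschke_prod xs z * h z"
    using c unfolding blaschke_cong_def by auto
  have "cmod (blaschke_prod xs w * h w) \<le> C" if "norm w < 1" for w
    unfolding h(2)[OF that, symmetric] using f that by (simp add: bounded_holo_def)
  then have "cmod (h z) \<le> C" if "norm z < 1" for z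
    using bounded_divide_blaschke[OF xs h(1) _ that] by blast
  then have bh: "bounded_holo h C" using h(1) f by (auto simp: bounded_holo_def)
  have "h2_mult f g = h2_mult (blaschke_prod xs) (h2_mult h g)"
    by (rule h2_fun_eqI) (simp add: h2_fun_mult[OF f] h2_fun_mult[OF bh] h2_fun_mult[OF bounded_holo_blaschke_prod[OF xs]] h(2))
  then show ?thesis using bspaceD[OF k] by simp
qed

lemma separation_estimate:
  assumes xs: "\<And>n. set (xs n) \<subseteq> unit_disc" and f: "bounded_holo f C"
    and c: "\<And>j. blaschke_cong (xs j) f (\<lambda>_. if j = n then 1 else 0)"
    and k: "k \<in> closure (h2_span (\<Union>j\<in>{j. j \<noteq> n}. bspace (xs j)))" and h: "h \<in> bspace (xs n)"
  shows "norm k \<le> (1 + C) * norm (k - h)"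
proof -
  let ?S = "\<Union>j\<in>{j. j \<noteq> n}. bspace (xs j)"
  let ?f = "\<lambda>z. 1 - f z"
  have C: "0 \<le> C" using f by (simp add: bounded_holo_def)
  have f1: "bounded_holo ?f (1 + C)" using bounded_holo_diff[OF bounded_holo_const[of 1] f] by simp
  have cf: "blaschke_cong (xs n) ?f (\<lambda>_. 0)"
    using blaschke_cong_diff[OF blaschke_cong_refl[of "xs n" "\<lambda>_. 1"] c[of n]] by simp
  have "h2_span ?S \<subseteq> {k. \<forall>g. h2_inner k (h2_mult f g) = 0}"
  proof (rule h2.span_minimal)
    show "?S \<subseteq> {k. \<forall>g. h2_inner k (h2_mult f g) = 0}"
      using multiple_perp[OF xs f] c by (fastforce split: if_splits)
    show "h2.subspace {k. \<forall>g. h2_inner k (h2_mult f g) = 0}"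
      by (rule h2.subspaceI) (simp_all add: h2_inner_simps)
  qed
  then have perp: "h2_inner k (h2_mult f g) = 0" if "k \<in> h2_span ?S" for k g using that by blast
  have est: "norm k \<le> (1 + C) * norm (k - h)" if k: "k \<in> h2_span ?S" for k
  proof -
    have m: "h2_mult ?f k = k - h2_mult f k"
      by (rule h2_fun_eqI) (simp add: h2_fun_mult[OF f] h2_fun_mult[OF f1] algebra_simps)
    \<comment> \<open>Two orthogonality relations meet: \<open>(1 - f) k\<close> is a multiple of
      the product over \<open>xs n\<close> and hence orthogonal to \<open>h\<close>, and
      \<open>f k\<close> is orthogonal to \<open>k\<close> because \<open>f\<close> is divisible by
      all the other products.\<close>
    have "h2_inner (k - h) (h2_mult ?f k) = h2_inner k k"
      using perp[OF k, of k] multiple_perp[OF xs f1 cf h] by (simp add: h2_inner_diff_left) (simp add: m h2_inner_diff_right)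
    then have "(norm k)\<^sup>2 = cmod (h2_inner (k - h) (h2_mult ?f k))"
      using h2_inner_self_norm[of k] by (simp add: norm_power)
    also have "\<dots> \<le> norm (k - h) * norm (h2_mult ?f k)" by (rule h2_Cauchy_Schwarz)
    also have "\<dots> \<le> norm (k - h) * ((1 + C) * norm k)"
      by (intro mult_left_mono norm_h2_mult_le[OF f1]) simp
    finally have "norm k * norm k \<le> norm k * ((1 + C) * norm (k - h))" by (simp add: power2_eq_square mult_ac)
    then show ?thesis
      using C mult_left_le_imp_le[of "norm k" "norm k" "(1 + C) * norm (k - h)"] by (cases "k = 0") auto
  qed
  have "closed {k. norm k \<le> (1 + C) * norm (k - h)}"
    by (intro closed_Collect_le continuous_intros)
  then have "closure (h2_span ?S) \<subseteq> {k. norm k \<le> (1 + C) * norm (k - h)}"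
    using est by (intro closure_minimal) auto
  then show ?thesis using k by blast
qed

text \<open>The infimum in \<open>subspace_sin\<close> is meaningful only over a nonempty set; a
  normalised kernel at a zero of the next index lies in it.\<close>

lemma unit_vectors_nonempty:
  fixes xs :: "nat \<Rightarrow> complex list"
  assumes xs: "\<And>n. set (xs n) \<subseteq> unit_disc" and ne: "\<And>n. xs n \<noteq> []"
  shows "{k \<in> closure (h2_span (\<Union>j\<in>{j. j \<noteq> n}. bspace (xs j))). norm k = 1} \<noteq> {}"
proof -
  obtain x where x: "x \<in> set (xs (Suc n))" using last_in_set[OF ne] by blast
  then have nx: "norm x < 1" using xs by force
  let ?k = "h2_scale (of_real (1 / norm (h2_kernel x))) (h2_kernel x)"
  have "?k \<in> bspace (xs (Suc n))" by (intro bspace_scale h2_kernel_in_bspace nx xs x)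
  then have "?k \<in> h2_span (\<Union>j\<in>{j. j \<noteq> n}. bspace (xs j))"
    by (intro h2.span_base UN_I[of "Suc n"]) auto
  then have "?k \<in> closure (h2_span (\<Union>j\<in>{j. j \<noteq> n}. bspace (xs j)))" using closure_subset by blast
  moreover have "norm ?k = 1" using h2_kernel_nonzero[OF nx] by (simp add: norm_divide)
  ultimately show ?thesis by blast
qed

lemma bspace_nonempty: "bspace xs \<noteq> {}"
  using bspace_zero by blast

lemma interpolating_imp_separated:
  fixes xs :: "nat \<Rightarrow> complex list"
  assumes xs: "\<And>n. set (xs n) \<subseteq> unit_disc" and ne: "\<And>n. xs n \<noteq> []" and int: "blaschke_interpolating xs"
  shows "strongly_separated (\<lambda>n. bspace (xs n))"
proof -
  obtain C where C: "\<And>n. \<exists>f. bounded_holo f C \<and> (\<forall>j. blaschke_cong (xs j) f (\<lambda>_. if j = n then 1 else 0))"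
    using interpolating_uniform[OF xs int] by blast
  have C0: "0 \<le> C" using C[of 0] by (auto simp: bounded_holo_def)
  have "1 / (1 + C) \<le> subspace_sin (bspace (xs n)) (closure (h2_span (\<Union>j\<in>{j. j \<noteq> n}. bspace (xs j))))" for n
    unfolding subspace_sin_def
  proof (rule cINF_greatest[OF unit_vectors_nonempty[OF xs ne]])
    fix k assume "k \<in> {k \<in> closure (h2_span (\<Union>j\<in>{j. j \<noteq> n}. bspace (xs j))). norm k = 1}"
    then have k: "k \<in> closure (h2_span (\<Union>j\<in>{j. j \<noteq> n}. bspace (xs j)))" "norm k = 1" by auto
    obtain f where f: "bounded_holo f C" "\<And>j. blaschke_cong (xs j) f (\<lambda>_. if j = n then 1 else 0)"
      using C[of n] by blast
    show "1 / (1 + C) \<le> infdist k (bspace (xs n))"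
      unfolding infdist_notempty[OF bspace_nonempty]
    proof (rule cINF_greatest[OF bspace_nonempty])
      fix h assume "h \<in> bspace (xs n)"
      then have "1 \<le> (1 + C) * norm (k - h)" using separation_estimate[OF xs f k(1)] k(2) by metis
      then show "1 / (1 + C) \<le> dist k h" using C0 by (simp add: dist_norm field_simps)
    qed
  qed
  then have "1 / (1 + C) \<le> (INF n. subspace_sin (bspace (xs n)) (closure (h2_span (\<Union>j\<in>{j. j \<noteq> n}. bspace (xs j)))))"
    by (intro cINF_greatest) auto
  moreover have "0 < 1 / (1 + C)" using C0 by simp
  ultimately show ?thesis unfolding strongly_separated_def by linarith
qed

subsection \<open>Strongly separated sequences are interpolating\<close>

text \<open>Scaling \<open>k\<close> to norm 1 and \<open>h\<close> by the same factor turns the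
  bound on \<open>infdist\<close> into a homogeneous estimate.\<close>

lemma strongly_separated_family:
  fixes xs :: "nat \<Rightarrow> complex list"
  assumes xs: "\<And>n. set (xs n) \<subseteq> unit_disc" and ne: "\<And>n. xs n \<noteq> []"
    and sep: "strongly_separated (\<lambda>n. bspace (xs n))"
  shows "\<exists>\<delta>. separated_family xs \<delta>"
proof -
  let ?H = "\<lambda>n. closure (h2_span (\<Union>j\<in>{j. j \<noteq> n}. bspace (xs j)))"
  define \<delta> where "\<delta> = (INF n. subspace_sin (bspace (xs n)) (?H n))"
  have pos: "0 < \<delta>" using sep by (simp add: strongly_separated_def \<delta>_def)
  have nn: "0 \<le> subspace_sin (bspace (xs n)) (?H n)" for n
    unfolding subspace_sin_def
    by (rule cINF_greatest[OF unit_vectors_nonempty[OF xs ne]]) (rule infdist_nonneg)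
  have le: "\<delta> \<le> subspace_sin (bspace (xs n)) (?H n)" for n
    unfolding \<delta>_def by (rule cINF_lower) (use nn in \<open>auto intro: bdd_belowI[of _ 0]\<close>)
  have "separated_family xs \<delta>"
  proof
    fix n h k assume h: "h \<in> bspace (xs n)" and k: "k \<in> h2_span (\<Union>j\<in>{j. j \<noteq> n}. bspace (xs j))"
    show "\<delta> * norm k \<le> norm (k - h)"
    proof (cases "k = 0")
      case False
      let ?c = "of_real (1 / norm k) :: complex"
      have "h2_scale ?c k \<in> ?H n"
        using h2.span_scale[OF k] closure_subset by blast
      moreover have "norm (h2_scale ?c k) = 1" using False by (simp add: norm_divide)
      ultimately have "subspace_sin (bspace (xs n)) (?H n) \<le> infdist (h2_scale ?c k) (bspace (xs n))"
        unfolding subspace_sin_def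
        by (intro cINF_lower) (auto intro!: bdd_belowI[of _ 0] infdist_nonneg)
      also have "\<dots> \<le> dist (h2_scale ?c k) (h2_scale ?c h)"
        by (rule infdist_le) (rule bspace_scale[OF h])
      also have "\<dots> = norm (k - h) / norm k"
        unfolding dist_norm h2.scale_right_diff_distrib[symmetric] norm_h2_scale norm_of_real by simp
      finally have "\<delta> \<le> norm (k - h) / norm k" using le[of n] by linarith
      then show ?thesis using False by (simp add: field_simps)
    qed simp
  qed (use xs pos in auto)
  then show ?thesis ..
qed

section \<open>Adjoints of multipliers on model spaces\<close>

lemma h2_inner_bshift_pow:
  assumes \<phi>: "bounded_holo \<phi> C"
  shows "h2_inner ((bshift ^^ j) h) (h2_mult \<phi> (h2_power i)) = h2_inner h (h2_mult \<phi> (h2_power (i + j)))"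
proof (induction j arbitrary: i)
  case (Suc j)
  have "h2_mult (blaschke_prod [0]) (h2_mult \<phi> (h2_power i)) = h2_scale (-1) (h2_mult \<phi> (h2_power (Suc i)))"
    by (rule h2_fun_eqI) (simp add: h2_fun_mult[OF bounded_holo_blaschke_prod[of "[0]"]] h2_fun_mult[OF \<phi>]
        h2_fun_power blaschke_factor_def del: h2.scale_minus_left)
  then have "h2_inner (bshift f) (h2_mult \<phi> (h2_power i)) = h2_inner f (h2_mult \<phi> (h2_power (Suc i)))" for f
    by (simp add: h2_inner_bshift h2_inner_scale_right del: h2.scale_minus_left)
  then show ?case using Suc.IH[of "Suc i"] by simp
qed simp

text \<open>The vector \<open>y\<close> is the image of \<open>h\<close> under the adjoint of
  multiplication by \<open>\<phi>\<close>, constructed from its coefficients. The model space is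
  invariant under this adjoint because multiplication by \<open>\<phi>\<close> preserves the
  multiples of the product.\<close>

lemma adjoint_multiplier:
  assumes ys: "set ys \<subseteq> unit_disc" and \<phi>: "bounded_holo \<phi> C" and h: "h \<in> bspace ys"
  shows "\<exists>y\<in>bspace ys. norm y \<le> C * norm h \<and> (\<forall>j. hcoeff y j = h2_inner h (h2_mult \<phi> (h2_power j)))"
proof -
  have C: "0 \<le> C" using \<phi> by (simp add: bounded_holo_def)
  have zero: "h2_mult \<phi> 0 = 0" using h2_mult_diff[OF \<phi>, of 0 0] by simp
  have msum: "h2_mult \<phi> (\<Sum>j<n. h2_scale (b j) (h2_power j)) = (\<Sum>j<n. h2_scale (b j) (h2_mult \<phi> (h2_power j)))" for n b
    by (induction n) (simp_all add: zero h2_mult_add[OF \<phi>] h2_mult_scale[OF \<phi>])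
  define a where "a j = h2_inner h (h2_mult \<phi> (h2_power j))" for j
  have bound: "(\<Sum>j<n. (cmod (a j))\<^sup>2) \<le> (C * norm h)\<^sup>2" for n
  proof -
    let ?S = "\<Sum>j<n. (cmod (a j))\<^sup>2"
    \<comment> \<open>The test polynomial has the numbers \<open>a j\<close> as its own
      coefficients, so that its squared norm equals its pairing with \<open>h\<close> after
      multiplication by \<open>\<phi>\<close>.\<close>
    define g where "g = (\<Sum>j<n. h2_scale (a j) (h2_power j))"
    have "hcoeff g k = (if k < n then a k else 0)" for k
      by (simp add: g_def if_distrib cong: if_cong)
    then have "(\<lambda>k. (cmod (hcoeff g k))\<^sup>2) = (\<lambda>k. if k \<in> {..<n} then (cmod (a k))\<^sup>2 else 0)" by auto
    moreover have "(\<lambda>k. if k \<in> {..<n} then (cmod (a k))\<^sup>2 else 0) sums ?S" by (rule sums_If_finite_set) simp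
    ultimately have g: "(norm g)\<^sup>2 = ?S" using h2_norm_sums[of g] sums_unique2 by simp
    have "h2_inner h (h2_mult \<phi> g) = (\<Sum>j<n. cnj (a j) * a j)"
      unfolding g_def msum h2_inner_sum_right h2_inner_scale_right a_def ..
    also have "\<dots> = of_real ?S" by (simp add: complex_norm_square mult.commute del: of_real_power)
    finally have "?S = cmod (h2_inner h (h2_mult \<phi> g))" by (simp add: sum_nonneg del: of_real_sum)
    also have "\<dots> \<le> norm h * (C * norm g)"
      by (rule order_trans[OF h2_Cauchy_Schwarz]) (intro mult_left_mono norm_h2_mult_le[OF \<phi>], simp)
    finally have "norm g * norm g \<le> norm g * (C * norm h)" using g by (simp add: power2_eq_square mult_ac)
    then have "norm g \<le> C * norm h"
      using C mult_left_le_imp_le[of "norm g" "norm g" "C * norm h"] by (cases "g = 0") auto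
    then show ?thesis unfolding g[symmetric] by (intro power_mono) auto
  qed
  have sm: "summable (\<lambda>j. (cmod (a j))\<^sup>2)"
    by (rule summableI_nonneg_bounded[OF _ bound]) simp
  then obtain y where y: "\<And>j. hcoeff y j = a j" using hardy2_of_coeffs[of a] by blast
  have "(norm y)\<^sup>2 \<le> (C * norm h)\<^sup>2"
    unfolding h2_norm_sq y by (rule suminf_le_const[OF sm bound])
  then have ny: "norm y \<le> C * norm h" by (rule power2_le_imp_le) (use C in simp)
  have adj: "h2_inner y p = h2_inner h (h2_mult \<phi> p)" for p
  proof -
    define P where "P n = (\<Sum>j<n. h2_scale (hcoeff p j) (h2_power j))" for n
    define T where "T n = (\<Sum>j<n. hcoeff y j * cnj (hcoeff p j))" for n
    have T: "T n = h2_inner h (h2_mult \<phi> (P n))" for n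
      unfolding T_def P_def msum h2_inner_sum_right h2_inner_scale_right y a_def
      by (intro sum.cong refl) (rule mult.commute)
    have est: "norm (T n - h2_inner h (h2_mult \<phi> p)) \<le> norm h * C * norm (p - P n)" for n
    proof -
      have "T n - h2_inner h (h2_mult \<phi> p) = - h2_inner h (h2_mult \<phi> (p - P n))"
        by (simp add: T h2_mult_diff[OF \<phi>] h2_inner_diff_right)
      then have "norm (T n - h2_inner h (h2_mult \<phi> p)) \<le> norm h * norm (h2_mult \<phi> (p - P n))"
        using h2_Cauchy_Schwarz by simp
      also have "\<dots> \<le> norm h * (C * norm (p - P n))"
        by (intro mult_left_mono norm_h2_mult_le[OF \<phi>]) simp
      finally show ?thesis by (simp add: mult.assoc)
    qed
    have "(\<lambda>n. norm (p - P n)) \<longlonglongrightarrow> 0" unfolding P_def by (rule h2_partial_sums_tendsto)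
    then have "(\<lambda>n. norm h * C * norm (p - P n)) \<longlonglongrightarrow> 0" by (rule tendsto_mult_right_zero)
    then have "(\<lambda>n. T n - h2_inner h (h2_mult \<phi> p)) \<longlonglongrightarrow> 0"
      using est by (metis (no_types, lifting) Lim_null_comparison eventually_sequentiallyI)
    then have "T \<longlonglongrightarrow> h2_inner h (h2_mult \<phi> p)" by (rule LIM_zero_cancel)
    moreover have "T \<longlonglongrightarrow> h2_inner y p"
      using h2_inner_sums[of y p] by (simp only: sums_def T_def[abs_def])
    ultimately show ?thesis by (rule LIMSEQ_unique[symmetric])
  qed
  have "h2_inner y (h2_mult (blaschke_prod ys) g) = 0" for g
  proof -
    have "h2_mult \<phi> (h2_mult (blaschke_prod ys) g) = h2_mult (blaschke_prod ys) (h2_mult \<phi> g)"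
      by (rule h2_fun_eqI) (simp add: h2_fun_mult[OF \<phi>] h2_fun_mult[OF bounded_holo_blaschke_prod[OF ys]])
    then show ?thesis using bspaceD[OF h] by (simp add: adj)
  qed
  then have "y \<in> bspace ys" by (simp add: bspace_def)
  then show ?thesis using ny y by (auto simp: a_def)
qed

context separated_family
begin

lemma riesz_const_pos: "0 < riesz_const"
  using gap by (simp add: riesz_const_def)

lemma decomposition_unique:
  assumes "\<And>n. n < N \<Longrightarrow> h n \<in> bspace (xs n)" "\<And>n. n < N \<Longrightarrow> h' n \<in> bspace (xs n)"
    and "(\<Sum>n<N. h n) = (\<Sum>n<N. h' n)" "n < N"
  shows "h n = h' n"
proof -
  have "(\<Sum>n<N. (norm (h n - h' n))\<^sup>2) \<le> riesz_const * (norm (\<Sum>n<N. h n - h' n))\<^sup>2"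
    by (rule riesz_bounds(2)) (use assms in \<open>auto intro: bspace_diff\<close>)
  then have "(\<Sum>n<N. (norm (h n - h' n))\<^sup>2) = 0"
    using assms(3) sum_nonneg[of "{..<N}" "\<lambda>n. (norm (h n - h' n))\<^sup>2"] by (simp add: sum_subtractf)
  then have "(norm (h n - h' n))\<^sup>2 = 0"
    using assms(4) by (subst (asm) sum_nonneg_eq_0_iff) auto
  then show ?thesis by simp
qed

text \<open>The operator that acts on each summand \<open>bspace (xs n)\<close> as the adjoint of
  multiplication by \<open>\<phi> n\<close> commutes with the backward shift. Its norm is at most
  \<open>riesz_const * C\<close>, because each of the two Riesz bounds contributes a factor
  \<open>riesz_const\<close> to the square.\<close>

lemma finite_interpolation:
  assumes \<phi>: "\<And>n. bounded_holo (\<phi> n) C"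
  shows "\<exists>\<psi>. bounded_holo \<psi> (riesz_const * C) \<and> (\<forall>n<N. blaschke_cong (xs n) \<psi> (\<phi> n))"
proof -
  let ?R = riesz_const
  have C: "0 \<le> C" using \<phi>[of 0] by (simp add: bounded_holo_def)
  let ?zs = "concat (map xs [0..<N])"
  have zs: "set ?zs \<subseteq> unit_disc" by (rule concat_disc)
  have set_upt: "set [0..<N] = {..<N}" by auto
  have "\<exists>h. x \<in> bspace ?zs \<longrightarrow> (\<forall>n<N. h n \<in> bspace (xs n)) \<and> x = (\<Sum>n<N. h n)" for x
    using bspace_concat[of "[0..<N]" x] unfolding set_upt by auto
  then obtain h where h: "\<And>x n. x \<in> bspace ?zs \<Longrightarrow> n < N \<Longrightarrow> h x n \<in> bspace (xs n)"
    "\<And>x. x \<in> bspace ?zs \<Longrightarrow> x = (\<Sum>n<N. h x n)"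
    by metis
  have sub: "bspace (xs n) \<subseteq> bspace ?zs" if n: "n < N" for n
  proof -
    have "mset ?zs = mset (xs n @ concat (map xs (remove1 n [0..<N])))"
      by (rule mset_concat_remove1) (use n in simp)
    then show ?thesis
      using bspace_cong_mset bspace_mono1[OF xs concat_disc] by metis
  qed
  \<comment> \<open>The decompositions are picked by choice; uniqueness makes them compatible with
    sums and scalars.\<close>
  have hsum: "h (\<Sum>n<N. g n) m = g m" if g: "\<And>n. n < N \<Longrightarrow> g n \<in> bspace (xs n)" and m: "m < N" for g m
  proof -
    have x: "(\<Sum>n<N. g n) \<in> bspace ?zs" using g sub by (intro bspace_sum) auto
    show ?thesis using decomposition_unique[OF h(1)[OF x] g h(2)[OF x, symmetric] m] by simp
  qed
  \<comment> \<open>The constant coefficient of the image of \<open>x\<close> under the operator;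
    the other coefficients are its values at the shifts of \<open>x\<close>.\<close>
  define l where "l x = (\<Sum>n<N. h2_inner (h x n) (h2_mult (\<phi> n) (h2_power 0)))" for x
  have lsum: "l (\<Sum>n<N. g n) = (\<Sum>n<N. h2_inner (g n) (h2_mult (\<phi> n) (h2_power 0)))"
    if g: "\<And>n. n < N \<Longrightarrow> g n \<in> bspace (xs n)" for g
    unfolding l_def using hsum[OF g] by (intro sum.cong refl) simp
  have "contractive_on (bspace ?zs) (?R * C) l"
    unfolding contractive_on_def
  proof (intro conjI ballI allI)
    fix x y assume xy: "x \<in> bspace ?zs" "y \<in> bspace ?zs"
    have "x + y = (\<Sum>n<N. h x n + h y n)"
      using h(2)[OF xy(1)] h(2)[OF xy(2)] by (simp add: sum.distrib)
    then have "l (x + y) = (\<Sum>n<N. h2_inner (h x n + h y n) (h2_mult (\<phi> n) (h2_power 0)))"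
      using lsum[of "\<lambda>n. h x n + h y n"] h(1) xy bspace_add by metis
    then show "l (x + y) = l x + l y" by (simp add: l_def h2_inner_add_left sum.distrib)
  next
    fix c x assume x: "x \<in> bspace ?zs"
    have "h2_scale c x = (\<Sum>n<N. h2_scale c (h x n))"
      using arg_cong[OF h(2)[OF x], of "h2_scale c"] by (simp only: h2.scale_sum_right)
    then have "l (h2_scale c x) = (\<Sum>n<N. h2_inner (h2_scale c (h x n)) (h2_mult (\<phi> n) (h2_power 0)))"
      using lsum[of "\<lambda>n. h2_scale c (h x n)"] h(1) x bspace_scale by metis
    then show "l (h2_scale c x) = c * l x" by (simp add: l_def h2_inner_scale_left sum_distrib_left)
  next
    fix x J assume x: "x \<in> bspace ?zs"
    have "\<exists>y. n < N \<longrightarrow> y \<in> bspace (xs n) \<and> norm y \<le> C * norm (h x n) \<and>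
      (\<forall>j. hcoeff y j = h2_inner (h x n) (h2_mult (\<phi> n) (h2_power j)))" for n
      using adjoint_multiplier[OF xs \<phi> h(1)[OF x]] by blast
    then obtain y where y: "\<And>n. n < N \<Longrightarrow> y n \<in> bspace (xs n)" "\<And>n. n < N \<Longrightarrow> norm (y n) \<le> C * norm (h x n)"
      "\<And>n j. n < N \<Longrightarrow> hcoeff (y n) j = h2_inner (h x n) (h2_mult (\<phi> n) (h2_power j))"
      by metis
    have lj: "l ((bshift ^^ j) x) = hcoeff (\<Sum>n<N. y n) j" for j
    proof -
      have "(bshift ^^ j) x = (\<Sum>n<N. (bshift ^^ j) (h x n))"
        using h(2)[OF x] bshift_pow_sum by metis
      moreover have "(bshift ^^ j) (h x n) \<in> bspace (xs n)" if "n < N" for n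
        by (rule bshift_pow_in_bspace[OF xs h(1)[OF x that]])
      ultimately have "l ((bshift ^^ j) x) = (\<Sum>n<N. h2_inner ((bshift ^^ j) (h x n)) (h2_mult (\<phi> n) (h2_power 0)))"
        using lsum[of "\<lambda>n. (bshift ^^ j) (h x n)"] by simp
      then show ?thesis using y(3) by (simp add: h2_inner_bshift_pow[OF \<phi>])
    qed
    have "(\<Sum>j<J. (cmod (l ((bshift ^^ j) x)))\<^sup>2) \<le> (norm (\<Sum>n<N. y n))\<^sup>2"
      unfolding lj h2_norm_sq by (rule sum_le_suminf[OF h2_fun_summable]) auto
    also have "\<dots> \<le> ?R * (\<Sum>n<N. (norm (y n))\<^sup>2)"
      by (rule riesz_bounds(1)[OF y(1)])
    also have "\<dots> \<le> ?R * (\<Sum>n<N. C\<^sup>2 * (norm (h x n))\<^sup>2)"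
      using y(2) riesz_const_pos
      by (intro mult_left_mono sum_mono) (auto simp flip: power_mult_distrib intro!: power_mono)
    also have "\<dots> = ?R * C\<^sup>2 * (\<Sum>n<N. (norm (h x n))\<^sup>2)" by (simp add: sum_distrib_left mult_ac)
    also have "\<dots> \<le> ?R * C\<^sup>2 * (?R * (norm (\<Sum>n<N. h x n))\<^sup>2)"
      using riesz_const_pos by (intro mult_left_mono riesz_bounds(2) h(1)[OF x]) auto
    also have "\<dots> = (?R * C)\<^sup>2 * (norm x)\<^sup>2"
      using h(2)[OF x] by (simp add: power2_eq_square)
    finally show "(\<Sum>j<J. (cmod (l ((bshift ^^ j) x)))\<^sup>2) \<le> (?R * C)\<^sup>2 * (norm x)\<^sup>2" .
  qed
  then obtain \<psi> where \<psi>: "bounded_holo \<psi> (?R * C)"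
    "\<And>x. x \<in> bspace ?zs \<Longrightarrow> l x = h2_inner x (h2_mult \<psi> (h2_power 0))"
    using commutant_lifting[OF zs, of "?R * C" l] C riesz_const_pos by auto
  have "blaschke_cong (xs n) \<psi> (\<phi> n)" if n: "n < N" for n
  proof -
    let ?f = "h2_mult \<psi> (h2_power 0) - h2_mult (\<phi> n) (h2_power 0)"
    \<comment> \<open>On \<open>bspace (xs n)\<close> the lifted functional of \<open>\<psi>\<close>
      is that of \<open>\<phi> n\<close>, so the difference is orthogonal to the model space and
      therefore divisible by the product.\<close>
    have "h2_inner k ?f = 0" if k: "k \<in> bspace (xs n)" for k
    proof -
      let ?g = "\<lambda>m. if m = n then k else 0"
      have g: "?g m \<in> bspace (xs m)" for m using k by simp
      have "k = (\<Sum>m<N. ?g m)" using n by simp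
      then have "l k = (\<Sum>m<N. h2_inner (?g m) (h2_mult (\<phi> m) (h2_power 0)))"
        using lsum[of ?g] g by metis
      also have "\<dots> = (\<Sum>m<N. if m = n then h2_inner k (h2_mult (\<phi> n) (h2_power 0)) else 0)"
        by (intro sum.cong refl) auto
      also have "\<dots> = h2_inner k (h2_mult (\<phi> n) (h2_power 0))" using n by simp
      finally show ?thesis
        using \<psi>(2)[of k] sub[OF n] k by (auto simp: h2_inner_diff_right)
    qed
    then obtain g where g: "?f = h2_mult (blaschke_prod (xs n)) g"
      using bspace_perp[OF xs] by blast
    have "\<psi> z - \<phi> n z = blaschke_prod (xs n) z * h2_fun g z" if z: "norm z < 1" for z
      using arg_cong[OF g, of "\<lambda>f. h2_fun f z"] z
      by (simp add: h2_fun_mult[OF \<psi>(1)] h2_fun_mult[OF \<phi>] h2_fun_mult[OF bounded_holo_blaschke_prod[OF xs]] h2_fun_power)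
    then show ?thesis
      unfolding blaschke_cong_def using h2_fun_holomorphic by (intro exI[of _ "h2_fun g"]) auto
  qed
  then show ?thesis using \<psi>(1) by blast
qed

end

lemma separated_imp_interpolating:
  fixes xs :: "nat \<Rightarrow> complex list"
  assumes xs: "\<And>n. set (xs n) \<subseteq> unit_disc" and ne: "\<And>n. xs n \<noteq> []"
    and sep: "strongly_separated (\<lambda>n. bspace (xs n))"
  shows "blaschke_interpolating xs"
  unfolding blaschke_interpolating_def
proof (intro allI impI)
  fix \<phi> :: "nat \<Rightarrow> complex \<Rightarrow> complex" and C
  assume \<phi>: "\<forall>n. bounded_holo (\<phi> n) C"
  obtain \<delta> where "separated_family xs \<delta>" using strongly_separated_family[OF xs ne sep] by blast
  then interpret separated_family xs \<delta> .
  show "\<exists>\<psi> R. bounded_holo \<psi> R \<and> (\<forall>n. blaschke_cong (xs n) \<psi> (\<phi> n))"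
  proof -
    have "bounded_holo (\<phi> n) C" for n using \<phi> by blast
    from interpolation_limit[of xs \<phi> C "riesz_const * C", OF xs this finite_interpolation[of \<phi> C, OF this]]
    show ?thesis by blast
  qed
qed

subsection \<open>Matrices\<close>

lemma Hinf_iff: "f \<in> Hinf \<longleftrightarrow> (\<exists>C. bounded_holo f C)"
proof
  assume "f \<in> Hinf"
  then obtain B where "f holomorphic_on unit_disc" "\<forall>z\<in>unit_disc. cmod (f z) \<le> B"
    by (auto simp: Hinf_def bounded_iff)
  then show "\<exists>C. bounded_holo f C"
    by (intro exI[of _ "max 0 B"]) (auto simp: bounded_holo_def max.coboundedI2)
qed (auto simp: Hinf_def bounded_holo_def bounded_iff)

lemma bounded_Hinf_seq_iff: "bounded_Hinf_seq \<phi> \<longleftrightarrow> (\<exists>C. \<forall>n. bounded_holo (\<phi> n) C)"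
proof
  assume *: "bounded_Hinf_seq \<phi>"
  then obtain C where C: "\<forall>n. \<forall>z\<in>unit_disc. cmod (\<phi> n z) \<le> C" by (auto simp: bounded_Hinf_seq_def)
  then have "cmod (\<phi> 0 0) \<le> C" by simp
  then have "0 \<le> C" by (rule order_trans[OF norm_ge_zero])
  then show "\<exists>C. \<forall>n. bounded_holo (\<phi> n) C"
    using * C by (auto simp: bounded_Hinf_seq_def bounded_holo_def Hinf_def)
qed (auto simp: bounded_Hinf_seq_def Hinf_iff, auto simp: bounded_holo_def)

theorem theorem1p5:
  fixes A :: "nat \<Rightarrow> complex mat"
  assumes "\<And>n. square_mat (A n)" and "\<And>n. dim_row (A n) > 0"
    and "\<And>n. spectrum (A n) \<subseteq> unit_disc"
  shows "interpolating A \<longleftrightarrow> strongly_separated (\<lambda>n. model_space (A n))"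
proof -
  obtain xs where ne: "\<And>n. xs n \<noteq> []" and xs: "\<And>n. set (xs n) \<subseteq> unit_disc"
    and B: "\<And>n. mat_blaschke (A n) = blaschke_prod (xs n)"
    and mf: "\<And>n f g. f holomorphic_on unit_disc \<Longrightarrow> g holomorphic_on unit_disc \<Longrightarrow>
      mat_fun f (A n) = mat_fun g (A n) \<longleftrightarrow> blaschke_cong (xs n) f g"
    using matrix_blaschke[OF assms] unfolding blaschke_cong_def by metis
  \<comment> \<open>The functions tested in \<open>model_space\<close> are exactly the images of
    \<open>h2_mult\<close>, since a Hardy function is determined by its values in the disc.\<close>
  have "model_space (A n) = bspace (xs n)" for n
  proof -
    note bh = bounded_holo_blaschke_prod[OF xs, of n]
    have "(\<forall>z\<in>unit_disc. h2_fun h z = blaschke_prod (xs n) z * h2_fun g z) \<longleftrightarrow> h = h2_mult (blaschke_prod (xs n)) g" for g h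
      by (auto simp: h2_fun_mult[OF bh] intro!: h2_fun_eqI)
    then show ?thesis by (auto simp: model_space_def bspace_def B)
  qed
  moreover have "interpolating A \<longleftrightarrow> blaschke_interpolating xs"
  proof -
    have "(\<exists>\<psi>\<in>Hinf. \<forall>n. mat_fun \<psi> (A n) = mat_fun (\<phi> n) (A n)) \<longleftrightarrow>
      (\<exists>\<psi> R. bounded_holo \<psi> R \<and> (\<forall>n. blaschke_cong (xs n) \<psi> (\<phi> n)))" if "bounded_Hinf_seq \<phi>" for \<phi>
    proof -
      have "\<phi> n holomorphic_on unit_disc" for n using that by (auto simp: bounded_Hinf_seq_def Hinf_def)
      then have "mat_fun \<psi> (A n) = mat_fun (\<phi> n) (A n) \<longleftrightarrow> blaschke_cong (xs n) \<psi> (\<phi> n)"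
        if "bounded_holo \<psi> R" for \<psi> R n
        using that by (intro mf) (auto simp: bounded_holo_def)
      then show ?thesis unfolding Hinf_iff Bex_def by blast
    qed
    then show ?thesis
      unfolding interpolating_def blaschke_interpolating_def bounded_Hinf_seq_iff by blast
  qed
  ultimately show ?thesis
    using interpolating_imp_separated[OF xs ne] separated_imp_interpolating[OF xs ne] by auto
qed

end
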